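(* For every $p$ with $1<p<\infty$ there exists a constant $A_p>0$ depending only on $p$ such that for every non-empty family $\mathcal{B}\subset\mathcal{T}$ one has $$A_p\,\log\big(\lambda_{[\mathcal{B}]}\big)\le \|M_{\mathcal{B}}\|_p^p ,$$ where $\lambda_{[\mathcal{B}]}\in\mathbb{N}\cup\{\infty\}$ is the analytic split of $\mathcal{B}$ (with the conventions $\log\infty=\infty$ and $\log 0=-\infty$; in particular, $\|M_{\mathcal{B}}\|_p=\infty$ whenever $\lambda_{[\mathcal{B}]}=\infty$).
   Context: $|\cdot|$ denotes Lebesgue measure on $\mathbb{R}^2$. **The collection $\mathcal{T}$.** For $n\ge 0$ and $0\le k\le 2^n-1$ let $u_n(k)\subset\mathbb{R}^2$ be the parallelogram with vertices $(0,0),(0,\frac1{2^n}),(1,\frac{k}{2^n}),(1,\frac{k+1}{2^n})$. Put $\mathcal{T}=\{u_n(k): n\ge 0,\ 0\le k\le 2^n-1\}$. **Maximal operator.** For a non-empty family $\mathcal{B}\subset\mathcal{T}$ put $\mathcal{B}^*=\{\vec t+hr:\vec t\in\mathbb{R}^2,\ h>0,\ r\in\mathcal{B}\}$ and, for $f\in L^1_{loc}(\mathbb{R}^2)$ and $x\in\mathbb{R}^2$, $$M_{\mathcal{B}}f(x)=\sup_{x\in r\in\mathcal{B}^*}\frac1{|r|}\int_r|f|,$$ the supremum being over all $r\in\mathcal{B}^*$ containing $x$. Put $\|M_{\mathcal{B}}\|_p=\sup_{\|f\|_p=1}\|M_{\mathcal{B}}f\|_p\in[0,\infty]$, with norms in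 $L^p(\mathbb{R}^2)$. **Binary tree structure.** For $u,v\in\mathcal{T}$, $u$ is a child of $v$ (and $v$ is the parent of $u$) if $u\subset v$ and $2|u|=|v|$; each $v\in\mathcal{T}$ has exactly two children. A path is a (finite or infinite) sequence $(u_i)$ in $\mathcal{T}$ such that $u_{i+1}$ is a child of $u_i$ for each $i$; it is identified with the set of its elements. **Trees.** For a non-empty $\mathcal{B}\subset\mathcal{T}$, its root $r_{\mathcal{B}}$ is the unique element of $\mathcal{T}$ of minimal area containing every $u\in\mathcal{B}$, and $[\mathcal{B}]=\{u\in\mathcal{T}:\exists v\in\mathcal{B},\ v\subset u\subset r_{\mathcal{B}}\}$. A subset of $\mathcal{T}$ of this form is called a tree. The boundary $\partial[\mathcal{B}]$ is the set of paths contained in $[\mathcal{B}]$ that are maximal for inclusion among paths contained in $[\mathcal{B}]$. For $\mathcal{P}\in\partial[\mathcal{B}]$, its splitting number relative to $[\mathcal{B}]$ is $$s_{\mathcal{P},[\mathcal{B}]}=\#\{u\in[\mathcal{B}]\setminus\mathcal{P}:\exists v\in\mathcal{P},\ u\subset v,\ 2|u|=|v|\}.$$ **Fig trees.** A tree $[\mathcal{F}]$ is a fig tree of scale $n$ and height $h$ if $[\mathcal{F}]$ is finite, $\#\partial[\mathcal{F}]=2^n$, and for every $\mathcal{P}\in\partial[\mathcal{F}]$ one has $s_{\mathcal{P},[\mathcal{F}]}=n$ and $\#\mathcal{P}=h$. **Analytic split.** $\lambda_{[\mathcal{B}]}$ is the integer $n$ such that $[\mathcal{B}]$ contains (as a subset)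 a fig tree of scale $n$ and contains no fig tree of scale $n+1$; if $[\mathcal{B}]$ contains fig trees of arbitrarily large scale, $\lambda_{[\mathcal{B}]}=\infty$. *)

theory Defs
  imports "HOL-Analysis.Analysis"
begin

type_synonym plane = "real \<times> real"

(* Convention: all parallelograms are closed. *)
definition para :: "nat \<Rightarrow> nat \<Rightarrow> plane set" where
  "para n k = convex hull {(0, 0), (0, 1 / 2 ^ n), (1, real k / 2 ^ n), (1, (real k + 1) / 2 ^ n)}"

definition paras :: "plane set set" where
  "paras = {para n k | n k. k \<le> 2 ^ n - 1}"

abbreviation area :: "plane set \<Rightarrow> real" where
  "area u \<equiv> measure lebesgue u"


definition dilates :: "plane set set \<Rightarrow> plane set set" where
  "dilates B = {(\<lambda>y. t + h *\<^sub>R y) ` r | t h r. h > 0 \<and> r \<in> B}"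

(* Norms and the maximal function may be infinite, so they live in ennreal.  Integration is
   with respect to the completed measure: a union of closed dilates of elements of paras is
   always Lebesgue measurable, but not always Borel. *)
definition maximal_function :: "plane set set \<Rightarrow> (plane \<Rightarrow> real) \<Rightarrow> plane \<Rightarrow> ennreal" where
  "maximal_function B f x =
     (SUP r \<in> {r \<in> dilates B. x \<in> r}.
        (\<integral>\<^sup>+ y \<in> r. ennreal \<bar>f y\<bar> \<partial>lebesgue) / emeasure lebesgue r)"

(* Real powers on [0, \<infinity>]; only used for exponents q > 0. *)
definition ennreal_rpow :: "ennreal \<Rightarrow> real \<Rightarrow> ennreal" where
  "ennreal_rpow a q = (if a = \<infinity> then \<infinity> else ennreal (enn2real a powr q))"

definition Lp_norm :: "real \<Rightarrow> (plane \<Rightarrow> ennreal) \<Rightarrow> ennreal" where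
  "Lp_norm p g = ennreal_rpow (\<integral>\<^sup>+ x. ennreal_rpow (g x) p \<partial>lebesgue) (1 / p)"

definition maximal_norm :: "real \<Rightarrow> plane set set \<Rightarrow> ennreal" where
  "maximal_norm p B =
     (SUP f \<in> {f \<in> borel_measurable lebesgue. Lp_norm p (\<lambda>x. ennreal \<bar>f x\<bar>) = 1}.
        Lp_norm p (maximal_function B f))"


definition is_child :: "plane set \<Rightarrow> plane set \<Rightarrow> bool" where
  "is_child u v \<longleftrightarrow> u \<in> paras \<and> v \<in> paras \<and> u \<subseteq> v \<and> 2 * area u = area v"

(* Paths are non-empty; they are represented by their sets of elements, which loses nothing
   since area strictly decreases along a path. *)
definition is_path :: "plane set set \<Rightarrow> bool" where
  "is_path P \<longleftrightarrow> P \<subseteq> paras \<and>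
     ((\<exists>(u :: nat \<Rightarrow> plane set) N. P = u ` {..N} \<and> (\<forall>i<N. is_child (u (Suc i)) (u i))) \<or>
      (\<exists>u :: nat \<Rightarrow> plane set. P = range u \<and> (\<forall>i. is_child (u (Suc i)) (u i))))"

definition tree_root :: "plane set set \<Rightarrow> plane set" where
  "tree_root B = (THE r. r \<in> paras \<and> (\<forall>u\<in>B. u \<subseteq> r) \<and>
     (\<forall>w\<in>paras. (\<forall>u\<in>B. u \<subseteq> w) \<longrightarrow> area r \<le> area w))"

definition tree_of :: "plane set set \<Rightarrow> plane set set" where
  "tree_of B = {u \<in> paras. \<exists>v\<in>B. v \<subseteq> u \<and> u \<subseteq> tree_root B}"

definition is_tree :: "plane set set \<Rightarrow> bool" where
  "is_tree T \<longleftrightarrow> (\<exists>B. B \<noteq> {} \<and> B \<subseteq> paras \<and> T = tree_of B)"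

definition boundary :: "plane set set \<Rightarrow> plane set set set" where
  "boundary T = {P. is_path P \<and> P \<subseteq> T \<and> (\<forall>Q. is_path Q \<and> Q \<subseteq> T \<and> P \<subseteq> Q \<longrightarrow> Q = P)}"

definition splitting_number :: "plane set set \<Rightarrow> plane set set \<Rightarrow> enat" where
  "splitting_number P T =
     (let S = {u \<in> T - P. \<exists>v\<in>P. u \<subseteq> v \<and> 2 * area u = area v}
      in if finite S then enat (card S) else \<infinity>)"

(* Since F is finite, so are its boundary and the elements of its boundary; the cardinalities
   below are therefore genuine. *)
definition is_fig_tree :: "plane set set \<Rightarrow> nat \<Rightarrow> nat \<Rightarrow> bool" where
  "is_fig_tree F n h \<longleftrightarrow> is_tree F \<and> finite F \<and> card (boundary F) = 2 ^ n \<and>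
     (\<forall>P\<in>boundary F. splitting_number P F = enat n \<and> card P = h)"

definition contains_fig_tree :: "plane set set \<Rightarrow> nat \<Rightarrow> bool" where
  "contains_fig_tree T n \<longleftrightarrow> (\<exists>F h. F \<subseteq> T \<and> is_fig_tree F n h)"

definition analytic_split :: "plane set set \<Rightarrow> enat" where
  "analytic_split T =
     (if \<forall>N. \<exists>n\<ge>N. contains_fig_tree T n then \<infinity>
      else enat (THE n. contains_fig_tree T n \<and> \<not> contains_fig_tree T (n + 1)))"

definition log_enat :: "enat \<Rightarrow> ereal" where
  "log_enat m = (case m of \<infinity> \<Rightarrow> \<infinity> | enat n \<Rightarrow> if n = 0 then -\<infinity> else ereal (ln (real n)))"

end

theory Submission
  imports Defs
begin

text \<open>
  A fig tree of scale \<open>N\<close> contains, after discarding about \<open>\<surd>N\<close> splittings between any two that are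
  kept, a binary tree of slopes of height \<open>k \<approx> \<surd>N\<close> in which the two subtrees below a vertex have
  diameter exponentially small compared with their distance \<open>D\<close>.  On such a tree one builds
  a Kakeya-type set recursively: at a vertex, juxtapose two blocks of length \<open>D\<close>, each made of
  copies, spaced periodically, of the sets built for the two subtrees, and translate the second
  block by a random phase.  Over abscissa \<open>x\<close> the blocks are displaced by \<open>D (1 + x)\<close>.  Since a block is
  almost periodic, averaging over the phase makes the two blocks independent where they overlap,
  so the expected densities satisfy \<open>d = (d\<^sub>0 + d\<^sub>1) / 2 - c(x) d\<^sub>0 d\<^sub>1\<close> up to a negligible error, where
  \<open>2 c(x)\<close> is the overlapping fraction.  Around \<open>x = -1\<close> this fraction is bounded below, whence
  \<open>d \<lesssim> 1 / k\<close>; for \<open>0 \<le> x \<le> 1/2\<close> it is \<open>x\<close> (the overlap is with the next period), whence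
  \<open>d \<ge> 1 / (1 + k x)\<close>, whose integral is of order \<open>log k / k\<close>.  Testing the maximal operator on the
  indicator of the part around \<open>x = -1\<close> gives \<open>log k \<lesssim> \<parallel>M\<parallel>\<^sub>p\<^sup>p\<close>, uniformly over the height of the tree.
\<close>

text \<open>Only means are tracked, never a single configuration. The sets for the two subtrees of a
  vertex are drawn independently, and the overlap estimate is affine in each of the two densities,
  so the means obey a closed recursion. A configuration is selected only at the very end, by
  comparing the mean areas over the two ranges of abscissae. Errors come from the ragged ends of the
  blocks and from the grid of phases. Each is a multiple of \<open>\<epsilon> * D\<close>, where
  \<epsilon> bounds the ratio of a subtree's period to the distance D at its parent. A generation
  adds at most \<open>9 * \<epsilon>\<close> to the relative error, and neither recursion amplifies
  what is inherited. The total \<open>9 * k * \<epsilon>\<close> must stay below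
  \<open>1 / (2 * k)\<close>, as the densities around x = -1 are themselves of order 1/k. So
  \<epsilon> has to be small against k^-2; the value 2^-k used below is lavish, but N of order k^2
  costs merely a factor 2 under the logarithm. Only the ratios p/D and q/D enter, not the levels of
  the vertices, and D may vary from vertex to vertex. This is where uniformity in the height comes
  from.\<close>

abbreviation len :: "real set \<Rightarrow> real" where
  "len \<equiv> measure lborel"

section \<open>Measure of bounded Borel sets and of their translates\<close>

definition bounded_borel :: "real set \<Rightarrow> bool" where
  "bounded_borel S \<longleftrightarrow> S \<in> sets borel \<and> bounded S"

lemma bounded_borel_fmeasurable: "bounded_borel S \<Longrightarrow> S \<in> fmeasurable lborel"
  unfolding bounded_borel_def fmeasurable_def
  using emeasure_bounded_finite[of S] by (auto simp: less_top)

lemma bounded_borel_Un: "bounded_borel S \<Longrightarrow> bounded_borel T \<Longrightarrow> bounded_borel (S \<union> T)"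
  unfolding bounded_borel_def by auto

lemma bounded_borel_Int1: "bounded_borel S \<Longrightarrow> T \<in> sets borel \<Longrightarrow> bounded_borel (S \<inter> T)"
  and bounded_borel_Int2: "bounded_borel S \<Longrightarrow> T \<in> sets borel \<Longrightarrow> bounded_borel (T \<inter> S)"
  unfolding bounded_borel_def by (auto intro: bounded_subset)

lemma bounded_borel_interval [simp]: "bounded_borel {a..b}" "bounded_borel {a..<b}" "bounded_borel {a}" "bounded_borel {}"
  unfolding bounded_borel_def by (auto intro: bounded_subset[of "{a..b}"])

lemma bounded_borel_borel: "bounded_borel S \<Longrightarrow> S \<in> sets borel"
  by (simp add: bounded_borel_def)

lemma len_mono: "bounded_borel T \<Longrightarrow> S \<in> sets borel \<Longrightarrow> S \<subseteq> T \<Longrightarrow> len S \<le> len T"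
  by (rule measure_mono_fmeasurable) (auto simp: bounded_borel_fmeasurable)

lemma len_Un: "bounded_borel S \<Longrightarrow> bounded_borel T \<Longrightarrow> len (S \<union> T) = len S + len T - len (S \<inter> T)"
  using measure_Un3[of S lborel T] by (simp add: bounded_borel_fmeasurable)

lemma len_disjoint: "bounded_borel S \<Longrightarrow> bounded_borel T \<Longrightarrow> S \<inter> T = {} \<Longrightarrow> len (S \<union> T) = len S + len T"
  by (simp add: len_Un)

lemma len_Un_le: "bounded_borel S \<Longrightarrow> bounded_borel T \<Longrightarrow> len (S \<union> T) \<le> len S + len T"
  using len_Un[of S T] measure_nonneg[of lborel "S \<inter> T"] by linarith

text \<open>Translates are encoded as preimages, so that membership unfolds without quantifiers.\<close>

definition shift :: "real \<Rightarrow> real set \<Rightarrow> real set" where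
  "shift c S = {y. y - c \<in> S}"

lemma mem_shift [simp]: "y \<in> shift c S \<longleftrightarrow> y - c \<in> S"
  by (simp add: shift_def)

lemma shift_shift [simp]: "shift c (shift d S) = shift (c + d) S"
  by (auto simp: algebra_simps)

lemma shift_Un: "shift c (S \<union> T) = shift c S \<union> shift c T"
  and shift_Int: "shift c (S \<inter> T) = shift c S \<inter> shift c T"
  by auto

lemma shift_image: "shift c S = (+) c ` S"
  by (auto simp: image_iff intro!: bexI[of _ "_ - c"])

lemma shift_borel [simp]: "S \<in> sets borel \<Longrightarrow> shift c S \<in> sets borel"
proof -
  assume "S \<in> sets borel"
  then have "(\<lambda>y. y - c) -` S \<inter> space borel \<in> sets (borel :: real measure)"
    by (intro measurable_sets[of _ borel borel]) auto
  then show ?thesis by (simp add: shift_def vimage_def)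
qed

lemma bounded_borel_shift: "bounded_borel S \<Longrightarrow> bounded_borel (shift c S)"
  unfolding bounded_borel_def by (auto simp: shift_image intro: bounded_translation shift_borel[unfolded shift_image])

lemma len_shift [simp]:
  assumes "S \<in> sets borel" shows "len (shift c S) = len S"
proof -
  have "len S = measure (distr lborel borel (\<lambda>y. (-c) + y)) S"
    by (subst lborel_distr_plus) (rule refl)
  also have "\<dots> = measure lborel ((\<lambda>y. (-c) + y) -` S \<inter> space lborel)"
    using assms by (intro measure_distr) auto
  also have "(\<lambda>y. (-c) + y) -` S \<inter> space lborel = shift c S"
    by auto
  finally show ?thesis by simp
qed

subsection \<open>Periodization and density\<close>

definition periodize :: "real \<Rightarrow> real set \<Rightarrow> real set" where
  "periodize P S = {y. \<exists>n::int. y + of_int n * P \<in> S}"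

text \<open>Overlapping translates count once, so the density can be smaller than
  \<open>len S / P\<close>. The recursion bounds lengths from above and densities from below;
  \<open>dens_le_len\<close> converts between the two.\<close>

definition dens :: "real \<Rightarrow> real set \<Rightarrow> real" where
  "dens P S = len (periodize P S \<inter> {0..<P}) / P"

lemma periodize_borel [simp]: assumes "S \<in> sets borel" shows "periodize P S \<in> sets borel"
proof -
  have "periodize P S = (\<Union>n::int. shift (- (of_int n * P)) S)"
    by (auto simp: periodize_def)
  then show ?thesis using assms by auto
qed

lemma periodize_add [simp]: "y + of_int n * P \<in> periodize P S \<longleftrightarrow> y \<in> periodize P S"
proof
  assume "y + of_int n * P \<in> periodize P S"
  then obtain m :: int where "y + of_int n * P + of_int m * P \<in> S" by (auto simp: periodize_def)
  then have "y + of_int (n + m) * P \<in> S" by (simp add: algebra_simps)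
  then show "y \<in> periodize P S" unfolding periodize_def by blast
next
  assume "y \<in> periodize P S"
  then obtain m :: int where "y + of_int m * P \<in> S" by (auto simp: periodize_def)
  then have "y + of_int n * P + of_int (m - n) * P \<in> S" by (simp add: algebra_simps)
  then show "y + of_int n * P \<in> periodize P S" unfolding periodize_def by blast
qed

lemma shift_periodize: "shift (of_int n * P) (periodize P S) = periodize P S"
  using periodize_add[of _ "-n" P S] by (auto simp: shift_def)

text \<open>Moving by a multiple of \<open>P\<close> makes the window start at a phase
  \<open>r\<close> with 0 \<le> r < P; the piece beyond \<open>P\<close> then wraps around onto
  \<open>{0..<r}\<close>.\<close>

lemma len_periodize_window:
  assumes P: "P > 0" and S: "S \<in> sets borel"
  shows "len (periodize P S \<inter> {a..<a+P}) = dens P S * P"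
proof -
  define n where "n = \<lfloor>a / P\<rfloor>"
  define r where "r = a - of_int n * P"
  have r: "0 \<le> r" "r < P"
    using mult_right_mono[OF of_int_floor_le[of "a / P"], of P]
      mult_strict_right_mono[OF real_of_int_floor_add_one_gt[of "a / P"], of P] P
    unfolding r_def n_def by (simp_all add: algebra_simps)
  have "periodize P S \<inter> {a..<a+P} = shift (of_int n * P) (periodize P S \<inter> {r..<r+P})"
    using shift_periodize[of n P S] unfolding shift_Int by (auto simp: r_def algebra_simps)
  then have 1: "len (periodize P S \<inter> {a..<a+P}) = len (periodize P S \<inter> {r..<r+P})"
    using S by (simp add: sets.Int)
  have "len (periodize P S \<inter> {r..<r+P}) = len (periodize P S \<inter> {r..<P} \<union> periodize P S \<inter> {P..<P+r})"
    using r by (intro arg_cong[where f=len]) auto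
  also have "\<dots> = len (periodize P S \<inter> {r..<P}) + len (periodize P S \<inter> {P..<P+r})"
    using S by (subst len_disjoint) (auto intro!: bounded_borel_Int2)
  also have "periodize P S \<inter> {P..<P+r} = shift (of_int 1 * P) (periodize P S \<inter> {0..<r})"
    using shift_periodize[of 1 P S] unfolding shift_Int by (auto simp: algebra_simps)
  also have "len \<dots> = len (periodize P S \<inter> {0..<r})"
    using S by (intro len_shift) auto
  also have "len (periodize P S \<inter> {r..<P}) + len (periodize P S \<inter> {0..<r}) = len (periodize P S \<inter> {r..<P} \<union> periodize P S \<inter> {0..<r})"
    using S by (subst len_disjoint) (auto intro!: bounded_borel_Int2)
  also have "periodize P S \<inter> {r..<P} \<union> periodize P S \<inter> {0..<r} = periodize P S \<inter> {0..<P}"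
    using r by auto
  finally show ?thesis using 1 P by (simp add: dens_def)
qed

lemma dens_nonneg: "P > 0 \<Longrightarrow> 0 \<le> dens P S"
  by (simp add: dens_def)

lemma dens_le_1: assumes "P > 0" "S \<in> sets borel" shows "dens P S \<le> 1"
proof -
  have "len (periodize P S \<inter> {0..<P}) \<le> len {0..<P}"
    using assms by (intro len_mono) auto
  then show ?thesis using assms by (simp add: dens_def)
qed

lemma periodize_shift: "periodize P (shift c S) = shift c (periodize P S)"
  by (auto simp: periodize_def algebra_simps)

lemma dens_shift [simp]:
  assumes "P > 0" "S \<in> sets borel" shows "dens P (shift c S) = dens P S"
proof -
  have "periodize P (shift c S) \<inter> {0..<P} = shift c (periodize P S \<inter> {-c..<-c+P})"
    by (auto simp: periodize_shift)
  then have "len (periodize P (shift c S) \<inter> {0..<P}) = dens P S * P"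
    using assms len_periodize_window[OF assms, of "-c"] len_shift[of "periodize P S \<inter> {-c..<-c+P}" c]
    by (simp add: sets.Int)
  then show ?thesis using assms by (simp add: dens_def)
qed

lemma len_periodize_windows:
  assumes P: "P > 0" and S: "S \<in> sets borel"
  shows "len (periodize P S \<inter> {a..<a + real m * P}) = real m * dens P S * P"
proof (induction m)
  case (Suc m)
  have "periodize P S \<inter> {a..<a + real (Suc m) * P} =
     periodize P S \<inter> {a..<a + real m * P} \<union> periodize P S \<inter> {a + real m * P..<a + real m * P + P}"
    using P by (auto simp: algebra_simps not_le) (smt (verit) mult_nonneg_nonneg of_nat_0_le_iff)
  also have "len \<dots> = real m * dens P S * P + dens P S * P"
    using Suc len_periodize_window[OF P S, of "a + real m * P"] S
    by (subst len_disjoint) (auto intro!: bounded_borel_Int2)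
  finally show ?case by (simp add: algebra_simps)
qed simp

lemma len_periodize_upper:
  assumes P: "P > 0" and S: "S \<in> sets borel" and ab: "a \<le> b"
  shows "len (periodize P S \<inter> {a..b}) \<le> dens P S * (b - a) + P"
proof -
  define m where "m = nat \<lfloor>(b - a) / P\<rfloor>"
  have m: "real m \<le> (b - a) / P" "(b - a) / P < real m + 1"
    using P ab unfolding m_def by (auto simp: floor_less_iff)
  have "len (periodize P S \<inter> {a..b}) \<le> len (periodize P S \<inter> {a..<a + real (Suc m) * P})"
    using m P S by (intro len_mono) (auto intro!: bounded_borel_Int2 simp: field_simps)
  also have "\<dots> = (real m * P) * dens P S + dens P S * P"
    by (subst len_periodize_windows[OF P S]) (simp add: algebra_simps)
  also have "\<dots> \<le> (b - a) * dens P S + 1 * P"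
    using m P dens_nonneg[OF P] dens_le_1[OF P S]
    by (intro add_mono mult_right_mono) (auto simp: field_simps)
  finally show ?thesis by (simp add: mult.commute)
qed

lemma len_periodize_lower:
  assumes P: "P > 0" and S: "S \<in> sets borel"
  shows "dens P S * (b - a) - P \<le> len (periodize P S \<inter> {a..b})"
proof (cases "a \<le> b")
  case ab: True
  define m where "m = nat \<lfloor>(b - a) / P\<rfloor>"
  have m: "real m \<le> (b - a) / P" "(b - a) / P < real m + 1"
    using P ab unfolding m_def by (auto simp: floor_less_iff)
  have "(b - a) * dens P S - P \<le> (b - a) * dens P S - dens P S * P"
    using dens_le_1[OF P S] P by simp
  also have "\<dots> = (b - a - P) * dens P S" by (simp add: algebra_simps)
  also have "\<dots> \<le> (real m * P) * dens P S"
    using m P dens_nonneg[OF P] by (intro mult_right_mono) (auto simp: field_simps)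
  also have "\<dots> = len (periodize P S \<inter> {a..<a + real m * P})"
    by (subst len_periodize_windows[OF P S]) (simp add: algebra_simps)
  also have "\<dots> \<le> len (periodize P S \<inter> {a..b})"
    using m P S by (intro len_mono) (auto intro!: bounded_borel_Int2 simp: field_simps)
  finally show ?thesis by (simp add: mult.commute)
next
  case False
  then have "dens P S * (b - a) \<le> 0"
    using dens_nonneg[OF P] by (simp add: mult_nonneg_nonpos)
  then show ?thesis using P measure_nonneg[of lborel "periodize P S \<inter> {a..b}"] by linarith
qed

text \<open>\<open>S\<close> meets only three periods, so three translated pieces of it cover one
  period of the periodization, and these pieces are disjoint inside \<open>S\<close>.\<close>

lemma dens_le_len:
  assumes P: "P > 0" and S: "bounded_borel S" and sub: "S \<subseteq> {-P..<2*P}"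
  shows "dens P S * P \<le> len S"
proof -
  have Sb: "S \<in> sets borel" using S by (rule bounded_borel_borel)
  define S1 S2 S3 where "S1 = S \<inter> {-P..<0}" and "S2 = S \<inter> {0..<P}" and "S3 = S \<inter> {P..<2*P}"
  have bbs: "bounded_borel S1" "bounded_borel S2" "bounded_borel S3"
    using S by (auto simp: S1_def S2_def S3_def intro!: bounded_borel_Int1)
  have "periodize P S \<inter> {0..<P} \<subseteq> shift P S1 \<union> S2 \<union> shift (-P) S3"
  proof
    fix y assume y: "y \<in> periodize P S \<inter> {0..<P}"
    then obtain n :: int where n: "y + of_int n * P \<in> S" by (auto simp: periodize_def)
    then have "-P \<le> y + of_int n * P" "y + of_int n * P < 2 * P" using sub by auto
    moreover have "0 \<le> y" "y < P" using y by auto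
    ultimately have "(-2) * P < of_int n * P" "of_int n * P < 2 * P" by linarith+
    then have "(-2::real) < of_int n" "of_int n < (2::real)"
      using mult_less_cancel_right_pos[OF P] by blast+
    then have "-2 < n" "n < 2" by linarith+
    then consider "n = -1" | "n = 0" | "n = 1" by linarith
    then show "y \<in> shift P S1 \<union> S2 \<union> shift (-P) S3"
      by cases (use n y in \<open>auto simp: S1_def S2_def S3_def\<close>)
  qed
  then have "len (periodize P S \<inter> {0..<P}) \<le> len (shift P S1 \<union> S2 \<union> shift (-P) S3)"
    using bbs Sb by (intro len_mono) (auto intro!: bounded_borel_Un bounded_borel_shift)
  also have "\<dots> \<le> len (shift P S1 \<union> S2) + len (shift (-P) S3)"
    using bbs by (intro len_Un_le bounded_borel_Un bounded_borel_shift)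
  also have "\<dots> \<le> len (shift P S1) + len S2 + len (shift (-P) S3)"
    using bbs by (intro add_right_mono len_Un_le bounded_borel_Un bounded_borel_shift)
  also have "\<dots> = len S1 + len S2 + len S3"
    using bbs by (simp add: bounded_borel_borel)
  also have "\<dots> = len (S1 \<union> S2) + len S3"
    using bbs by (subst len_disjoint) (auto simp: S1_def S2_def)
  also have "\<dots> = len (S1 \<union> S2 \<union> S3)"
    using bbs by (subst (2) len_disjoint) (auto simp: S1_def S2_def S3_def intro!: bounded_borel_Un)
  also have "\<dots> \<le> len S"
    using S bbs by (intro len_mono sets.Un) (auto simp: S1_def S2_def S3_def bounded_borel_borel)
  finally show ?thesis using P by (simp add: dens_def)
qed

subsection \<open>Blocks\<close>

text \<open>A bounded substitute for the periodization: it agrees with \<open>periodize P S\<close>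
  except near its two ends, see \<open>rep_subset_periodize\<close> and
  \<open>periodize_subset_rep\<close>.\<close>

definition rep :: "real \<Rightarrow> nat \<Rightarrow> real set \<Rightarrow> real set" where
  "rep P m S = (\<Union>i<m. shift (real i * P) S)"

lemma bounded_borel_rep: "bounded_borel S \<Longrightarrow> bounded_borel (rep P m S)"
  using bounded_borel_shift[of S] by (auto simp: rep_def bounded_borel_def)

lemma rep_subset_periodize: "rep P m S \<subseteq> periodize P S"
proof
  fix y assume "y \<in> rep P m S"
  then obtain i where "y - real i * P \<in> S" by (auto simp: rep_def)
  then have "y + of_int (- int i) * P \<in> S" by simp
  then show "y \<in> periodize P S" unfolding periodize_def by blast
qed

lemma rep_subset:
  assumes "P > 0" "S \<subseteq> {-P..<2*P}" "real m * P \<le> D"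
  shows "rep P m S \<subseteq> {-P..<D+P}"
proof
  fix y assume "y \<in> rep P m S"
  then obtain i where i: "i < m" "y - real i * P \<in> S" by (auto simp: rep_def)
  then have "real i + 1 \<le> real m" by linarith
  then have "(real i + 1) * P \<le> real m * P" using assms by (intro mult_right_mono) auto
  moreover have "0 \<le> real i * P" using assms by simp
  moreover have "-P \<le> y - real i * P" "y - real i * P < 2 * P" using i assms(2) by auto
  ultimately show "y \<in> {-P..<D+P}"
    using assms(3) unfolding atLeastLessThan_iff distrib_right by linarith
qed

lemma periodize_subset_rep:
  assumes P: "P > 0" and S: "S \<subseteq> {-P..<2*P}" and m: "D < (real m + 1) * P"
  shows "periodize P S \<inter> {2*P..D-2*P} \<subseteq> rep P m S"
proof
  fix y assume y: "y \<in> periodize P S \<inter> {2*P..D-2*P}"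
  then obtain n :: int where n: "y + of_int n * P \<in> S" by (auto simp: periodize_def)
  then have b: "-P \<le> y + of_int n * P" "y + of_int n * P < 2 * P" using S by auto
  with y have "of_int n * P < 0 * P" by simp
  with P have n0: "n < 0" by (simp only: mult_less_cancel_right) auto
  from b y have "- of_int n * P \<le> D - P" by simp
  also have "\<dots> < real m * P" using m by (simp add: algebra_simps)
  finally have "- of_int n < real m"
    using mult_less_cancel_right_pos[OF P, of "- of_int n" "real m"] by simp
  then have "nat (-n) < m" using n0 by linarith
  moreover have "y - real (nat (-n)) * P \<in> S" using n n0 by simp
  ultimately show "y \<in> rep P m S" unfolding rep_def by auto
qed

text \<open>The inequalities for \<open>m\<close> say that it is the floor of \<open>D / P\<close>.
  The set \<open>S\<close> may stick out of its period by one period on either side;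
  \<open>union_subset\<close> shows that this allowance survives the recursion.\<close>

locale block =
  fixes P D :: real and m :: nat and S :: "real set"
  assumes P: "P > 0" and S: "bounded_borel S" "S \<subseteq> {-P..<2*P}"
    and m: "real m * P \<le> D" "D < (real m + 1) * P"
begin

abbreviation "X \<equiv> rep P m S"
abbreviation "d \<equiv> dens P S"

lemma D: "D \<ge> 0" using m P by (smt (verit) mult_nonneg_nonneg of_nat_0_le_iff)

lemma d01: "0 \<le> d" "d \<le> 1"
  using P S dens_nonneg dens_le_1 bounded_borel_borel by auto

lemma X: "bounded_borel X" using S bounded_borel_rep by auto

lemma len_X_upper: assumes "a \<le> b" shows "len (X \<inter> {a..b}) \<le> d * (b - a) + P"
proof -
  have "len (X \<inter> {a..b}) \<le> len (periodize P S \<inter> {a..b})"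
    using rep_subset_periodize X S by (intro len_mono) (auto simp: bounded_borel_borel intro!: bounded_borel_Int2)
  also have "\<dots> \<le> d * (b - a) + P" using P S assms by (intro len_periodize_upper) (auto simp: bounded_borel_borel)
  finally show ?thesis .
qed

lemma len_X_lower: assumes "0 \<le> a" "b \<le> D" shows "d * (b - a) - 5 * P \<le> len (X \<inter> {a..b})"
proof -
  \<comment> \<open>Each end of the block costs at most \<open>2 * P\<close>, and counting whole
    periods costs one more \<open>P\<close>; together \<open>5 * P\<close>.\<close>
  define a' b' where "a' = max a (2 * P)" and "b' = min b (D - 2 * P)"
  have "b - a - 4 * P \<le> b' - a'" unfolding a'_def b'_def using assms P by auto
  then have "d * (b - a - 4 * P) \<le> d * (b' - a')" using d01(1) by (rule mult_left_mono)
  moreover have "d * (4 * P) \<le> 1 * (4 * P)" using d01 P by (intro mult_right_mono) auto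
  ultimately have "d * (b - a) - 5 * P \<le> d * (b' - a') - P" by (simp add: algebra_simps)
  also have "\<dots> \<le> len (periodize P S \<inter> {a'..b'})" using P S by (intro len_periodize_lower) (auto simp: bounded_borel_borel)
  also have "\<dots> \<le> len (X \<inter> {a..b})"
    using periodize_subset_rep[OF P S(2) m(2)] X S
    by (intro len_mono) (auto simp: a'_def b'_def bounded_borel_borel intro!: bounded_borel_Int1)
  finally show ?thesis .
qed

lemma X_subset: "X \<subseteq> {-P..<D+P}"
  using rep_subset[OF P S(2) m(1)] .

lemma len_X_le: "len X \<le> d * D + 3 * P"
proof -
  have "len X = len (X \<inter> {-P..D+P})" using X_subset by (intro arg_cong[where f=len]) auto
  also have "\<dots> \<le> d * (D + 2 * P) + P" using len_X_upper[of "-P" "D+P"] D P by (simp add: algebra_simps)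
  also have "\<dots> \<le> d * D + 3 * P" using d01 P by (simp add: algebra_simps)
  finally show ?thesis .
qed

text \<open>A window of exactly one period sees the density wherever it stands. Averaging a phase
  over a full period produces such windows, which is why the two blocks become independent with
  errors only from their ends.\<close>

lemma len_window_upper: "len (X \<inter> {z-P..z}) \<le> d * P"
proof -
  have Sb: "S \<in> sets borel" using S by (simp add: bounded_borel_borel)
  have "len (X \<inter> {z-P..z}) \<le> len (periodize P S \<inter> {z-P..<z-P+P} \<union> {z..z})"
    using rep_subset_periodize[of P m S] X Sb
    by (intro len_mono bounded_borel_Un bounded_borel_Int2 bounded_borel_interval) (auto simp: bounded_borel_borel sets.Int)
  also have "\<dots> \<le> len (periodize P S \<inter> {z-P..<z-P+P}) + len {z..z}"
    using Sb by (intro len_Un_le) (auto intro!: bounded_borel_Int2)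
  finally show ?thesis using len_periodize_window[OF P Sb, of "z-P"] by simp
qed

lemma len_window_lower: assumes "3 * P \<le> z" "z \<le> D - 2 * P"
  shows "d * P \<le> len (X \<inter> {z-P..z})"
proof -
  have Sb: "S \<in> sets borel" using S by (simp add: bounded_borel_borel)
  have "d * P = len (periodize P S \<inter> {z-P..<z-P+P})" using len_periodize_window[OF P Sb, of "z-P"] by simp
  also have "\<dots> \<le> len (X \<inter> {z-P..z})"
    using periodize_subset_rep[OF P S(2) m(2)] X Sb assms
    by (intro len_mono) (auto simp: bounded_borel_borel intro!: bounded_borel_Int1)
  finally show ?thesis .
qed

lemma window_outside: "z < -P \<or> D + 2 * P \<le> z \<Longrightarrow> X \<inter> {z-P..z} = {}"
  using X_subset P by fastforce

end

subsection \<open>Averaging the overlap over translations\<close>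

text \<open>Measures how fast a set leaves itself under translation; for a finite union of intervals
  their number is a valid constant. However large it is, a fine enough grid of phases replaces the
  continuous average, so that the probability space stays finite.\<close>

definition shift_lipschitz :: "real \<Rightarrow> real set \<Rightarrow> bool" where
  "shift_lipschitz n Y \<longleftrightarrow> bounded_borel Y \<and> (\<forall>s t. len (shift s Y - shift t Y) \<le> n * \<bar>s - t\<bar>)"

lemma bounded_borel_Diff: "bounded_borel S \<Longrightarrow> bounded_borel T \<Longrightarrow> bounded_borel (S - T)"
  unfolding bounded_borel_def by (auto intro: bounded_subset)

lemma shift_lipschitz_interval: "shift_lipschitz 1 {a..b}"
  unfolding shift_lipschitz_def
proof (intro conjI allI)
  fix s t :: real
  have "shift s {a..b} - shift t {a..b} \<subseteq> (if s \<le> t then {a+s..<a+t} else {b+t..b+s})"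
    by auto
  then have "len (shift s {a..b} - shift t {a..b}) \<le> len (if s \<le> t then {a+s..<a+t} else {b+t..b+s})"
    by (intro len_mono sets.Diff shift_borel) auto
  also have "\<dots> = \<bar>s - t\<bar>" by auto
  finally show "len (shift s {a..b} - shift t {a..b}) \<le> 1 * \<bar>s - t\<bar>" by simp
qed simp

lemma shift_lipschitz_Un: assumes "shift_lipschitz n Y" "shift_lipschitz m Z" shows "shift_lipschitz (n + m) (Y \<union> Z)"
  unfolding shift_lipschitz_def
proof (intro conjI allI)
  show "bounded_borel (Y \<union> Z)" using assms by (auto simp: shift_lipschitz_def bounded_borel_Un)
  fix s t :: real
  let ?A = "shift s Y - shift t Y" and ?B = "shift s Z - shift t Z"
  have bbs: "bounded_borel ?A" "bounded_borel ?B" using assms by (auto simp: shift_lipschitz_def intro!: bounded_borel_Diff bounded_borel_shift)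
  have "len (shift s (Y \<union> Z) - shift t (Y \<union> Z)) \<le> len (?A \<union> ?B)"
    using assms bbs by (intro len_mono) (auto simp: shift_lipschitz_def bounded_borel_Un bounded_borel_borel)
  also have "\<dots> \<le> len ?A + len ?B" using bbs by (rule len_Un_le)
  also have "\<dots> \<le> n * \<bar>s - t\<bar> + m * \<bar>s - t\<bar>" using assms by (intro add_mono) (auto simp: shift_lipschitz_def)
  finally show "len (shift s (Y \<union> Z) - shift t (Y \<union> Z)) \<le> (n + m) * \<bar>s - t\<bar>"
    by (simp add: algebra_simps)
qed

lemma shift_lipschitz_empty: "shift_lipschitz 0 {}"
  unfolding shift_lipschitz_def by (auto simp: shift_def)

lemma shift_lipschitz_shift: assumes "shift_lipschitz n Y" shows "shift_lipschitz n (shift c Y)"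
  unfolding shift_lipschitz_def
proof (intro conjI allI)
  show "bounded_borel (shift c Y)" using assms by (auto simp: shift_lipschitz_def bounded_borel_shift)
  fix s t
  have "len (shift (s + c) Y - shift (t + c) Y) \<le> n * \<bar>(s + c) - (t + c)\<bar>"
    using assms unfolding shift_lipschitz_def by blast
  then show "len (shift s (shift c Y) - shift t (shift c Y)) \<le> n * \<bar>s - t\<bar>"
    by simp
qed

lemma shift_lipschitz_UN: "finite I \<Longrightarrow> (\<And>i. i \<in> I \<Longrightarrow> shift_lipschitz n (Y i)) \<Longrightarrow> shift_lipschitz (real (card I) * n) (\<Union>i\<in>I. Y i)"
proof (induction I rule: finite_induct)
  case (insert i I)
  then have "shift_lipschitz (n + real (card I) * n) (Y i \<union> (\<Union>i\<in>I. Y i))"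
    by (intro shift_lipschitz_Un) auto
  then show ?case using insert by (simp add: algebra_simps)
qed (simp add: shift_lipschitz_empty)

lemma shift_lipschitz_rep: "shift_lipschitz n Y \<Longrightarrow> shift_lipschitz (real m * n) (rep P m Y)"
  unfolding rep_def using shift_lipschitz_UN[of "{..<m}" n "\<lambda>i. shift (real i * P) Y"] shift_lipschitz_shift by auto

lemma overlap_lipschitz:
  assumes Y: "shift_lipschitz n Y" and X: "bounded_borel X"
  shows "\<bar>len (X \<inter> shift s Y) - len (X \<inter> shift t Y)\<bar> \<le> n * \<bar>s - t\<bar>"
proof -
  have *: "len (X \<inter> shift s Y) \<le> len (X \<inter> shift t Y) + n * \<bar>s - t\<bar>" for s t
  proof -
    have Yb: "bounded_borel Y" using Y by (simp add: shift_lipschitz_def)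
    have bbs: "bounded_borel (X \<inter> shift t Y)" "bounded_borel (shift s Y - shift t Y)" "bounded_borel (X \<inter> shift s Y)"
      using X Yb by (auto intro!: bounded_borel_Diff bounded_borel_shift bounded_borel_Int1 bounded_borel_borel)
    have "len (X \<inter> shift s Y) \<le> len ((X \<inter> shift t Y) \<union> (shift s Y - shift t Y))"
      by (intro len_mono bounded_borel_Un bounded_borel_borel bbs) auto
    also have "\<dots> \<le> len (X \<inter> shift t Y) + len (shift s Y - shift t Y)"
      by (intro len_Un_le bbs)
    also have "len (shift s Y - shift t Y) \<le> n * \<bar>s - t\<bar>" using Y by (simp add: shift_lipschitz_def)
    finally show ?thesis by simp
  qed
  show ?thesis using *[of s t] *[of t s] by (simp add: abs_minus_commute)
qed

lemma riemann_lipschitz: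
  fixes g :: "real \<Rightarrow> real"
  assumes lip: "\<And>s t. \<bar>g s - g t\<bar> \<le> L * \<bar>s - t\<bar>" and h: "h > 0"
  shows "\<bar>integral {0..real M * h} g - (\<Sum>r<M. h * g (real r * h))\<bar> \<le> real M * (L * h * h)"
proof (induction M)
  case (Suc M)
  have L: "L \<ge> 0" using lip[of 1 0] by simp
  have cont: "continuous_on S g" for S
    by (rule lipschitz_on_continuous_on[of L]) (use L lip in \<open>auto simp: lipschitz_on_def dist_real_def\<close>)
  have int: "g integrable_on {a..b}" for a b by (intro integrable_continuous_real cont)
  let ?a = "real M * h" and ?b = "real (Suc M) * h"
  have ab: "0 \<le> ?a" "?a \<le> ?b" "?b - ?a = h" using h by (auto simp: algebra_simps)
  have split: "integral {0..?b} g = integral {0..?a} g + integral {?a..?b} g"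
    using ab int by (intro Henstock_Kurzweil_Integration.integral_combine[symmetric]) auto
  have "integral {?a..?b} (\<lambda>x. g x - g ?a) = integral {?a..?b} g - h * g ?a"
    using ab h int by (subst Henstock_Kurzweil_Integration.integral_diff) (auto simp: algebra_simps)
  moreover have "norm (integral {?a..?b} (\<lambda>x. g x - g ?a)) \<le> L * h * (?b - ?a)"
  proof (rule integral_bound)
    show "?a \<le> ?b" by (rule ab)
    show "continuous_on {?a..?b} (\<lambda>x. g x - g ?a)" by (intro continuous_intros cont)
    fix x assume x: "x \<in> {?a..?b}"
    then have "\<bar>x - ?a\<bar> \<le> h" using ab by auto
    then have "L * \<bar>x - ?a\<bar> \<le> L * h" using L by (rule mult_left_mono)
    then show "norm (g x - g ?a) \<le> L * h" using lip[of x ?a] by simp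
  qed
  ultimately have "\<bar>integral {?a..?b} g - h * g ?a\<bar> \<le> L * h * h" using ab by simp
  then show ?case using Suc split by (simp add: algebra_simps)
qed simp

text \<open>Fubini: for fixed \<open>y\<close> in \<open>X\<close>, the phases that bring a point of
  \<open>Y\<close> onto \<open>y\<close> correspond, by the reflection sending \<theta> to
  \<open>y - w - \<theta>\<close>, to the part of \<open>Y\<close> in a window of length
  \<open>q\<close> ending at \<open>y - w\<close>.\<close>

lemma nn_integral_overlap:
  assumes X: "bounded_borel X" and Y: "bounded_borel Y"
  shows "(\<integral>\<^sup>+\<theta>. ennreal (len (X \<inter> shift (w + \<theta>) Y)) * indicator {0..q} \<theta> \<partial>lborel)
    = (\<integral>\<^sup>+y. ennreal (len (Y \<inter> {y - w - q..y - w})) * indicator X y \<partial>lborel)"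
proof -
  have [measurable]: "X \<in> sets borel" "Y \<in> sets borel" using X Y by (auto simp: bounded_borel_borel)
  have em: "emeasure lborel S = ennreal (len S)" if "bounded_borel S" for S
    using that bounded_borel_fmeasurable by (simp add: emeasure_eq_measure2)
  have "(\<integral>\<^sup>+\<theta>. ennreal (len (X \<inter> shift (w + \<theta>) Y)) * indicator {0..q} \<theta> \<partial>lborel)
     = (\<integral>\<^sup>+\<theta>. (\<integral>\<^sup>+y. indicator X y * indicator Y (y - (w + \<theta>)) * indicator {0..q} \<theta> \<partial>lborel) \<partial>lborel)"
  proof (intro nn_integral_cong)
    fix \<theta>
    have "ennreal (len (X \<inter> shift (w + \<theta>) Y)) = emeasure lborel (X \<inter> shift (w + \<theta>) Y)"
      using X Y by (subst em) (auto intro!: bounded_borel_Int1)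
    also have "\<dots> = (\<integral>\<^sup>+y. indicator (X \<inter> shift (w + \<theta>) Y) y \<partial>lborel)"
      by (subst nn_integral_indicator) auto
    also have "\<dots> = (\<integral>\<^sup>+y. indicator X y * indicator Y (y - (w + \<theta>)) \<partial>lborel)"
      by (intro nn_integral_cong) (auto split: split_indicator)
    finally show "ennreal (len (X \<inter> shift (w + \<theta>) Y)) * indicator {0..q} \<theta> =
      (\<integral>\<^sup>+y. indicator X y * indicator Y (y - (w + \<theta>)) * indicator {0..q} \<theta> \<partial>lborel)"
      by (subst nn_integral_multc) auto
  qed
  also have "\<dots> = (\<integral>\<^sup>+y. (\<integral>\<^sup>+\<theta>. indicator X y * indicator Y (y - (w + \<theta>)) * indicator {0..q} \<theta> \<partial>lborel) \<partial>lborel)"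
    by (rule lborel_pair.Fubini') simp
  also have "\<dots> = (\<integral>\<^sup>+y. ennreal (len (Y \<inter> {y - w - q..y - w})) * indicator X y \<partial>lborel)"
  proof (intro nn_integral_cong)
    fix y
    have "ennreal (len (Y \<inter> {y - w - q..y - w})) = emeasure lborel (Y \<inter> {y - w - q..y - w})"
      using Y by (subst em) (auto intro!: bounded_borel_Int1)
    also have "\<dots> = (\<integral>\<^sup>+z. indicator (Y \<inter> {y - w - q..y - w}) z \<partial>lborel)"
      by (subst nn_integral_indicator) auto
    also have "\<dots> = (\<integral>\<^sup>+\<theta>. indicator (Y \<inter> {y - w - q..y - w}) (y - w + (-1) * \<theta>) \<partial>lborel)"
      by (subst nn_integral_real_affine[where c="-1" and t="y - w"]) auto
    also have "\<dots> = (\<integral>\<^sup>+\<theta>. indicator Y (y - (w + \<theta>)) * indicator {0..q} \<theta> \<partial>lborel)"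
      by (intro nn_integral_cong) (auto split: split_indicator simp: algebra_simps)
    finally show "(\<integral>\<^sup>+\<theta>. indicator X y * indicator Y (y - (w + \<theta>)) * indicator {0..q} \<theta> \<partial>lborel) =
       ennreal (len (Y \<inter> {y - w - q..y - w})) * indicator X y"
      by (auto split: split_indicator)
  qed
  finally show ?thesis .
qed

lemma overlap_continuous:
  assumes X: "bounded_borel X" and Y: "shift_lipschitz n Y"
  shows "continuous_on S (\<lambda>\<theta>. len (X \<inter> shift (w + \<theta>) Y))" (is "continuous_on S ?g")
proof -
  have lp: "\<bar>?g s - ?g t\<bar> \<le> n * \<bar>s - t\<bar>" for s t
    using overlap_lipschitz[OF Y X, of "w + s" "w + t"] by simp
  show ?thesis
    by (rule lipschitz_on_continuous_on[of n])
       (use lp[of 1 0] lp in \<open>auto simp: lipschitz_on_def dist_real_def\<close>)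
qed

lemma overlap_mean_nonneg:
  assumes X: "bounded_borel X" and Y: "shift_lipschitz n Y"
  shows "0 \<le> integral {0..q} (\<lambda>\<theta>. len (X \<inter> shift (w + \<theta>) Y))"
  by (intro Henstock_Kurzweil_Integration.integral_nonneg integrable_continuous_real
       overlap_continuous[OF assms]) auto

lemma integral_overlap_nn:
  assumes X: "bounded_borel X" and Y: "shift_lipschitz n Y"
  shows "ennreal (integral {0..q} (\<lambda>\<theta>. len (X \<inter> shift (w + \<theta>) Y))) =
     (\<integral>\<^sup>+y. ennreal (len (Y \<inter> {y - w - q..y - w})) * indicator X y \<partial>lborel)"
proof -
  let ?g = "\<lambda>\<theta>. len (X \<inter> shift (w + \<theta>) Y)"
  have cont: "continuous_on {0..q} ?g" by (rule overlap_continuous[OF assms])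
  have "set_integrable lborel {0..q} ?g"
    unfolding set_integrable_def using cont by (intro borel_integrable_compact) auto
  then have "(LBINT \<theta>:{0..q}. ?g \<theta>) = integral {0..q} ?g"
    and "integrable lborel (\<lambda>\<theta>. indicator {0..q} \<theta> * ?g \<theta>)"
    by (auto simp: set_borel_integral_eq_integral set_integrable_def)
  then have "ennreal (integral {0..q} ?g) = (\<integral>\<^sup>+\<theta>. ennreal (indicator {0..q} \<theta> * ?g \<theta>) \<partial>lborel)"
    by (subst nn_integral_eq_integral) (auto simp: set_lebesgue_integral_def)
  also have "\<dots> = (\<integral>\<^sup>+\<theta>. ennreal (?g \<theta>) * indicator {0..q} \<theta> \<partial>lborel)"
    by (intro nn_integral_cong) (auto split: split_indicator)
  finally show ?thesis using nn_integral_overlap[OF X, of Y] Y by (simp add: shift_lipschitz_def)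
qed

text \<open>The set \<open>J\<close> localizes: for \<open>y\<close> in \<open>X\<close> outside
  \<open>J\<close> the window carries no mass of \<open>Y\<close>, so only the zone where the two
  blocks can meet contributes.\<close>

lemma overlap_mean_upper:
  assumes X: "bounded_borel X" and Y: "shift_lipschitz n Y" and c: "c \<ge> 0" "J \<in> sets borel"
    and up: "\<And>y. y \<in> X \<Longrightarrow> len (Y \<inter> {y - w - q..y - w}) \<le> c * indicator J y"
  shows "integral {0..q} (\<lambda>\<theta>. len (X \<inter> shift (w + \<theta>) Y)) \<le> c * len (X \<inter> J)"
proof -
  have XJ: "bounded_borel (X \<inter> J)" using X c by (intro bounded_borel_Int1)
  have "ennreal (integral {0..q} (\<lambda>\<theta>. len (X \<inter> shift (w + \<theta>) Y))) \<le>
     (\<integral>\<^sup>+y. ennreal c * indicator (X \<inter> J) y \<partial>lborel)"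
    unfolding integral_overlap_nn[OF X Y]
  proof (intro nn_integral_mono)
    fix y
    show "ennreal (len (Y \<inter> {y - w - q..y - w})) * indicator X y \<le> ennreal c * indicator (X \<inter> J) y"
      using up[of y] by (cases "y \<in> X"; cases "y \<in> J") (auto intro!: ennreal_leI simp: measure_le_0_iff)
  qed
  also have "\<dots> = ennreal c * emeasure lborel (X \<inter> J)"
    using XJ by (subst nn_integral_cmult_indicator) (auto simp: bounded_borel_borel)
  also have "\<dots> = ennreal (c * len (X \<inter> J))"
    using bounded_borel_fmeasurable[OF XJ] c by (simp add: emeasure_eq_measure2 ennreal_mult)
  finally show ?thesis using c by (simp add: ennreal_le_iff)
qed

lemma overlap_mean_lower:
  assumes X: "bounded_borel X" and Y: "shift_lipschitz n Y" and c: "c \<ge> 0" "J \<in> sets borel"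
    and low: "\<And>y. y \<in> X \<inter> J \<Longrightarrow> c \<le> len (Y \<inter> {y - w - q..y - w})"
  shows "c * len (X \<inter> J) \<le> integral {0..q} (\<lambda>\<theta>. len (X \<inter> shift (w + \<theta>) Y))"
proof -
  have XJ: "bounded_borel (X \<inter> J)" using X c by (intro bounded_borel_Int1)
  have "ennreal (c * len (X \<inter> J)) = ennreal c * emeasure lborel (X \<inter> J)"
    using bounded_borel_fmeasurable[OF XJ] c by (simp add: emeasure_eq_measure2 ennreal_mult)
  also have "\<dots> = (\<integral>\<^sup>+y. ennreal c * indicator (X \<inter> J) y \<partial>lborel)"
    using XJ by (subst nn_integral_cmult_indicator) (auto simp: bounded_borel_borel)
  also have "\<dots> \<le> ennreal (integral {0..q} (\<lambda>\<theta>. len (X \<inter> shift (w + \<theta>) Y)))"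
    unfolding integral_overlap_nn[OF X Y]
    using low by (intro nn_integral_mono) (auto split: split_indicator intro!: ennreal_leI)
  finally have "ennreal (c * len (X \<inter> J)) \<le> ennreal (integral {0..q} (\<lambda>\<theta>. len (X \<inter> shift (w + \<theta>) Y)))" .
  then show ?thesis
    using overlap_mean_nonneg[OF X Y] by (simp add: ennreal_le_iff)
qed


subsection \<open>One step of the recursion\<close>

text \<open>\<open>S\<close> and \<open>T\<close> stand for the slices, at one fixed abscissa, of
  the sets built for the two subtrees, each in the frame of its own reference slope. The Lipschitz
  constant concerns \<open>T\<close> because it is the second block that is translated.\<close>

locale two_blocks = A: block p D m S + B: block q D n T
  for p q D :: real and m n :: nat and S T :: "real set" +
  fixes \<epsilon> L :: real
  assumes small: "p \<le> \<epsilon> * D" "q \<le> \<epsilon> * D" "\<epsilon> \<le> 1/8"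
    and lipT: "shift_lipschitz L T"
begin

lemma D_pos: "D > 0"
proof -
  have "0 < \<epsilon> * D" using small A.P by linarith
  then show ?thesis using A.D by (metis less_eq_real_def mult_zero_right)
qed

lemma pq_le: "p \<le> D / 8" "q \<le> D / 8"
proof -
  have "\<epsilon> * D \<le> 1/8 * D" using small(3) D_pos by (intro mult_right_mono) auto
  then show "p \<le> D / 8" "q \<le> D / 8" using small by linarith+
qed

lemma lipB: "shift_lipschitz (real n * L) B.X" using shift_lipschitz_rep[OF lipT] .

text \<open>Blocks of length \<open>D\<close> displaced by at most \<open>D / 4\<close> share at
  least \<open>3/4 * D\<close>. The ends of the second block cost \<open>5 * q\<close> and those of
  the first \<open>5 * p\<close>, whence the \<open>10 * \<epsilon> * D\<close>.\<close>

lemma overlap_left: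
  assumes w: "\<bar>w\<bar> \<le> D / 4"
  shows "A.d * B.d * (3/4 * D) - 10 * \<epsilon> * D \<le> integral {0..q} (\<lambda>\<theta>. len (A.X \<inter> shift (w + \<theta>) B.X)) / q"
proof -
  let ?a = "max 0 (w + 3 * q)" and ?b = "min D (w + D - 2 * q)"
  have "D - D/4 - 5 * q \<le> ?b - ?a" using w B.P by auto
  then have "A.d * (D - D/4 - 5 * q) \<le> A.d * (?b - ?a)" using A.d01 by (intro mult_left_mono)
  moreover have "A.d * (5 * q) \<le> 1 * (5 * q)" using A.d01 B.P by (intro mult_right_mono) auto
  ultimately have "A.d * (3/4 * D) - 5 * p - 5 * q \<le> A.d * (?b - ?a) - 5 * p"
    by (simp add: algebra_simps)
  also have "\<dots> \<le> len (A.X \<inter> {?a..?b})" by (rule A.len_X_lower) auto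
  finally have 1: "B.d * (A.d * (3/4 * D) - 5 * p - 5 * q) \<le> B.d * len (A.X \<inter> {?a..?b})"
    using B.d01 by (intro mult_left_mono) auto
  have "B.d * (5 * p + 5 * q) \<le> 1 * (10 * \<epsilon> * D)"
    using B.d01 A.P B.P small by (intro mult_mono) auto
  with 1 have "A.d * B.d * (3/4 * D) - 10 * \<epsilon> * D \<le> B.d * len (A.X \<inter> {?a..?b})"
    by (simp add: algebra_simps)
  also have "\<dots> * q \<le> integral {0..q} (\<lambda>\<theta>. len (A.X \<inter> shift (w + \<theta>) B.X))"
  proof -
    have "(B.d * q) * len (A.X \<inter> {?a..?b}) \<le> integral {0..q} (\<lambda>\<theta>. len (A.X \<inter> shift (w + \<theta>) B.X))"
    proof (rule overlap_mean_lower[OF A.X lipB])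
      fix y assume "y \<in> A.X \<inter> {?a..?b}"
      then show "B.d * q \<le> len (B.X \<inter> {y - w - q..y - w})"
        by (intro B.len_window_lower) auto
    qed (use B.d01 B.P in auto)
    then show ?thesis by (simp add: algebra_simps)
  qed
  finally show ?thesis using B.P by (simp add: field_simps)
qed

text \<open>The shift \<open>D * (x - 1)\<close> is the displacement \<open>D * (1 + x)\<close>
  reduced by the new period \<open>2 * D\<close>: the second block runs into the next period and
  covers there a stretch of about \<open>D * x\<close> of the first block. Its ends enlarge that
  stretch by \<open>2 * q + p\<close>, and rounding adds another \<open>p\<close>.\<close>

lemma overlap_right:
  assumes x: "0 \<le> x" "x \<le> 1/2"
  shows "integral {0..q} (\<lambda>\<theta>. len (A.X \<inter> shift (D * (x - 1) + \<theta>) B.X)) / q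
    \<le> A.d * B.d * (D * x) + 4 * \<epsilon> * D"
proof -
  let ?w = "D * (x - 1)"
  let ?J = "{-p..D * x + 2 * q}"
  have Dx: "0 \<le> D * x" using D_pos x by simp
  have "integral {0..q} (\<lambda>\<theta>. len (A.X \<inter> shift (?w + \<theta>) B.X)) \<le> (B.d * q) * len (A.X \<inter> ?J)"
  proof (rule overlap_mean_upper[OF A.X lipB])
    fix y assume y: "y \<in> A.X"
    show "len (B.X \<inter> {y - ?w - q..y - ?w}) \<le> B.d * q * indicator ?J y"
    proof (cases "y \<in> ?J")
      case True then show ?thesis using B.len_window_upper by simp
    next
      case False
      then have "D + 2 * q \<le> y - ?w" using y A.X_subset by (auto simp: algebra_simps)
      then have "B.X \<inter> {y - ?w - q..y - ?w} = {}" using B.window_outside by blast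
      then show ?thesis using False by simp
    qed
  qed (use B.d01 B.P in auto)
  then have "integral {0..q} (\<lambda>\<theta>. len (A.X \<inter> shift (?w + \<theta>) B.X)) / q \<le> B.d * len (A.X \<inter> ?J)"
    using B.P by (simp add: field_simps)
  also have "\<dots> \<le> B.d * (A.d * (D * x + 2 * q + p) + p)"
    using A.len_X_upper[of "-p" "D * x + 2 * q"] Dx A.P B.P B.d01 by (intro mult_left_mono) auto
  also have "\<dots> = A.d * B.d * (D * x) + B.d * (A.d * (2 * q + p) + p)" by (simp add: algebra_simps)
  also have "B.d * (A.d * (2 * q + p) + p) \<le> 1 * (1 * (2 * q + p) + p)"
    using A.d01 B.d01 A.P B.P by (intro mult_mono add_right_mono) auto
  also have "\<dots> \<le> 4 * \<epsilon> * D" using small by simp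
  finally show ?thesis by simp
qed

lemma bbs: "bounded_borel A.X" "bounded_borel (shift c B.X)"
  using A.X B.X bounded_borel_shift by auto

lemma union_left:
  "len (A.X \<union> shift c B.X) \<le> D * (A.d + B.d) + 6 * \<epsilon> * D - len (A.X \<inter> shift c B.X)"
proof -
  have "len (A.X \<union> shift c B.X) = len A.X + len B.X - len (A.X \<inter> shift c B.X)"
    using len_Un[OF bbs(1) bbs(2)[of c]] B.X by (simp add: bounded_borel_borel)
  then show ?thesis using A.len_X_le B.len_X_le small by (simp add: algebra_simps)
qed

text \<open>Cutting at multiples of \<open>D\<close> leaves the first block in
  \<open>{0..<D}\<close>, a part of the second in \<open>{D..<2*D}\<close>, and an overhang in
  \<open>{2*D..<3*D}\<close> which wraps around onto \<open>{0..<D}\<close>. Only the overhang can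
  collide with the first block, so inclusion and exclusion loses at most that overlap.\<close>

lemma dens_right:
  assumes x: "0 \<le> x" "x \<le> 1/2" and \<theta>: "0 \<le> \<theta>" "\<theta> \<le> q"
  shows "D * (A.d + B.d) - 10 * \<epsilon> * D - len (A.X \<inter> shift (D * (x - 1) + \<theta>) B.X)
    \<le> dens (2 * D) (A.X \<union> shift (D * (1 + x) + \<theta>) B.X) * (2 * D)"
proof -
  define Z where "Z = shift (D * (1 + x) + \<theta>) B.X"
  have Dx: "0 \<le> D * x" "D * x \<le> D / 2" using D_pos x by auto
  note c = D_pos pq_le A.P B.P \<theta> Dx
  define X1 Z1 Z2 where "X1 = A.X \<inter> {0..<D}" and "Z1 = Z \<inter> {D..<2*D}" and "Z2 = Z \<inter> {2*D..<3*D}"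
  have bb: "bounded_borel Z" "bounded_borel X1" "bounded_borel Z1" "bounded_borel Z2" unfolding X1_def Z1_def Z2_def Z_def
    by (auto intro!: bounded_borel_Int1 bbs)
  have X1: "A.d * D - 5 * p \<le> len X1"
  proof -
    have "A.d * D - 5 * p \<le> len (A.X \<inter> {0..D})" using A.len_X_lower[of 0 D] by simp
    also have "\<dots> \<le> len (X1 \<union> {D})"
      using bb bbs(1) by (intro len_mono bounded_borel_Un) (auto simp: X1_def bounded_borel_borel)
    also have "\<dots> \<le> len X1 + len {D}" using bb by (intro len_Un_le) auto
    finally show ?thesis by simp
  qed
  have Z12: "B.d * D - 5 * q \<le> len Z1 + len Z2"
  proof -
    have "B.d * D - 5 * q \<le> len (B.X \<inter> {0..D})" using B.len_X_lower[of 0 D] by simp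
    also have "\<dots> = len (shift (D * (1 + x) + \<theta>) (B.X \<inter> {0..D}))"
      using B.X by (subst len_shift) (auto simp: bounded_borel_borel)
    also have "\<dots> \<le> len (Z1 \<union> Z2)"
    proof (intro len_mono bounded_borel_Un bb)
      show "shift (D * (1 + x) + \<theta>) (B.X \<inter> {0..D}) \<subseteq> Z1 \<union> Z2"
      proof
        fix y assume y: "y \<in> shift (D * (1 + x) + \<theta>) (B.X \<inter> {0..D})"
        then have "D * (1 + x) + \<theta> \<le> y" "y \<le> D * (1 + x) + \<theta> + D" by auto
        moreover have "D * (1 + x) = D + D * x" by (simp add: algebra_simps)
        ultimately have "D \<le> y" "y < 3 * D" using c by linarith+
        then show "y \<in> Z1 \<union> Z2" using y by (auto simp: Z1_def Z2_def Z_def)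
      qed
      show "shift (D * (1 + x) + \<theta>) (B.X \<inter> {0..D}) \<in> sets borel"
        using B.X by (intro shift_borel sets.Int) (auto simp: bounded_borel_borel)
    qed
    also have "\<dots> \<le> len Z1 + len Z2" by (intro len_Un_le bb)
    finally show ?thesis .
  qed
  have bW: "bounded_borel (shift (-2 * D) Z2)" by (intro bounded_borel_shift bb)
  have "len (X1 \<inter> shift (-2 * D) Z2) \<le> len (A.X \<inter> shift (D * (x - 1) + \<theta>) B.X)"
    using bb bW bbs by (intro len_mono bounded_borel_Int1) 
      (auto simp: bounded_borel_borel X1_def Z2_def Z_def algebra_simps)
  then have "len X1 + len Z2 - len (A.X \<inter> shift (D * (x - 1) + \<theta>) B.X) \<le> len (X1 \<union> shift (-2 * D) Z2)"
    using bb by (subst len_Un) (auto simp: bounded_borel_borel intro!: bounded_borel_shift)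
  moreover have "len (X1 \<union> shift (-2 * D) Z2) + len Z1 = len (X1 \<union> shift (-2 * D) Z2 \<union> Z1)"
  proof -
    have "(X1 \<union> shift (-2 * D) Z2) \<inter> Z1 = {}" by (auto simp: X1_def Z2_def Z1_def)
    then show ?thesis using bb bW by (subst (2) len_Un) (auto intro!: bounded_borel_Un)
  qed
  moreover have "len (X1 \<union> shift (-2 * D) Z2 \<union> Z1) \<le> len (periodize (2 * D) (A.X \<union> Z) \<inter> {0..<2*D})"
  proof (intro len_mono)
    show "X1 \<union> shift (-2 * D) Z2 \<union> Z1 \<subseteq> periodize (2 * D) (A.X \<union> Z) \<inter> {0..<2*D}"
    proof
      fix y assume y: "y \<in> X1 \<union> shift (-2 * D) Z2 \<union> Z1"
      then have "y + of_int 0 * (2 * D) \<in> A.X \<union> Z \<or> y + of_int 1 * (2 * D) \<in> A.X \<union> Z"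
        by (auto simp: X1_def Z2_def Z1_def)
      then have "y \<in> periodize (2 * D) (A.X \<union> Z)" unfolding periodize_def by blast
      moreover have "y \<in> {0..<2*D}" using y D_pos by (auto simp: X1_def Z2_def Z1_def)
      ultimately show "y \<in> periodize (2 * D) (A.X \<union> Z) \<inter> {0..<2*D}" by blast
    qed
  qed (use bb bW bbs in \<open>auto simp: bounded_borel_borel intro!: bounded_borel_Int2 periodize_borel sets.Un\<close>)
  moreover have "len (periodize (2 * D) (A.X \<union> Z) \<inter> {0..<2*D}) = dens (2 * D) (A.X \<union> Z) * (2 * D)"
    using D_pos by (simp add: dens_def)
  moreover have "5 * p + 5 * q \<le> 10 * \<epsilon> * D" using small by simp
  ultimately show ?thesis using X1 Z12 unfolding Z_def by (simp add: algebra_simps)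
qed

text \<open>The bounds on \<open>w\<close> are those of \<open>D * (1 + x)\<close> for x between
  -5/4 and 1/2. With \<open>2 * D\<close> as the new period, the union again exceeds its period by
  at most one period on either side.\<close>

lemma union_subset:
  assumes w: "-D/4 \<le> w" "w \<le> 3/2 * D" and \<theta>: "0 \<le> \<theta>" "\<theta> \<le> q"
  shows "A.X \<union> shift (w + \<theta>) B.X \<subseteq> {-(2*D)..<2*(2*D)}"
proof -
  note c = D_pos pq_le A.P B.P \<theta> w
  have "A.X \<subseteq> {-(2*D)..<2*(2*D)}" using A.X_subset c by fastforce
  moreover have "shift (w + \<theta>) B.X \<subseteq> {-(2*D)..<2*(2*D)}"
  proof
    fix y assume "y \<in> shift (w + \<theta>) B.X"
    then have "-q \<le> y - (w + \<theta>)" "y - (w + \<theta>) < D + q" using B.X_subset by auto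
    then show "y \<in> {-(2*D)..<2*(2*D)}" using c by auto
  qed
  ultimately show ?thesis by blast
qed

lemma grid_error:
  assumes X: "bounded_borel X" and N: "0 < N" "q * L * real n \<le> \<epsilon> * D * real N"
  shows "\<bar>integral {0..q} (\<lambda>\<theta>. len (X \<inter> shift (w + \<theta>) B.X)) / q
     - (\<Sum>r<N. len (X \<inter> shift (w + real r * (q / real N)) B.X)) / real N\<bar> \<le> \<epsilon> * D"
proof -
  let ?g = "\<lambda>\<theta>. len (X \<inter> shift (w + \<theta>) B.X)" and ?h = "q / real N"
  have h: "?h > 0" "real N * ?h = q" using N B.P by auto
  have "\<bar>integral {0..real N * ?h} ?g - (\<Sum>r<N. ?h * ?g (real r * ?h))\<bar> \<le> real N * (real n * L * ?h * ?h)"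
  proof (intro riemann_lipschitz h)
    fix s t
    show "\<bar>?g s - ?g t\<bar> \<le> real n * L * \<bar>s - t\<bar>"
      using overlap_lipschitz[OF lipB X, of "w + s" "w + t"] by simp
  qed
  also have "\<dots> = (real n * L * q / real N) * q" using N by (simp add: field_simps)
  also have "\<dots> \<le> (\<epsilon> * D) * q" using N B.P by (intro mult_right_mono) (auto simp: field_simps)
  finally have "\<bar>integral {0..q} ?g - ?h * (\<Sum>r<N. ?g (real r * ?h))\<bar> \<le> \<epsilon> * D * q"
    using h by (simp add: sum_distrib_left)
  then have "\<bar>(integral {0..q} ?g / q - (\<Sum>r<N. ?g (real r * ?h)) / real N) * q\<bar> \<le> \<epsilon> * D * q"
    using B.P by (simp add: algebra_simps)
  then show ?thesis using B.P by (simp add: abs_mult)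
qed

end

subsection \<open>Configurations of tubes\<close>

text \<open>The triple \<open>(a, s, t)\<close> stands for the tube \<open>a + s x \<le> y \<le> a + s x + t\<close>.\<close>

type_synonym config = "(real \<times> real \<times> real) set"

definition slice :: "config \<Rightarrow> real \<Rightarrow> real set" where
  "slice C x = (\<Union>(a, s, t)\<in>C. {a + s * x..a + s * x + t})"

definition move :: "real \<Rightarrow> config \<Rightarrow> config" where
  "move c C = (\<lambda>(a, s, t). (a + c, s, t)) ` C"

definition combine :: "real \<Rightarrow> nat \<Rightarrow> config \<Rightarrow> real \<Rightarrow> nat \<Rightarrow> config \<Rightarrow> real \<Rightarrow> config" where
  "combine p m \<alpha> q n \<beta> c = (\<Union>i<m. move (real i * p) \<alpha>) \<union> (\<Union>j<n. move (c + real j * q) \<beta>)"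

lemma slice_move: "slice (move c C) x = shift c (slice C x)"
  by (rule set_eqI) (simp add: slice_def move_def split_beta le_diff_eq diff_le_eq algebra_simps)

lemma slice_Un: "slice (C \<union> C') x = slice C x \<union> slice C' x"
  by (auto simp: slice_def)

lemma slice_UN: "slice (\<Union>i\<in>I. C i) x = (\<Union>i\<in>I. slice (C i) x)"
  by (auto simp: slice_def)

lemma shift_rep: "shift c (rep p m S) = rep p m (shift c S)"
  by (auto simp: rep_def algebra_simps)

lemma slice_combine:
  "slice (combine p m \<alpha> q n \<beta> c) x = rep p m (slice \<alpha> x) \<union> shift c (rep q n (slice \<beta> x))"
  by (auto simp: combine_def slice_Un slice_UN slice_move rep_def algebra_simps)

text \<open>Seen along the slope \<open>sA\<close>, the second block moves with relative slope
  \<open>D\<close>. Its offset \<open>D\<close> at abscissa 0 sets the blocks side by side there and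
  on top of each other at abscissa -1.\<close>

lemma slice_combine_frame:
  assumes "D = sB - sA"
  shows "shift (- (sA * x)) (slice (combine p m \<alpha> q n \<beta> (D + \<theta>)) x) =
    rep p m (shift (- (sA * x)) (slice \<alpha> x)) \<union>
    shift (D * (1 + x) + \<theta>) (rep q n (shift (- (sB * x)) (slice \<beta> x)))"
proof -
  have "- (sA * x) + (D + \<theta>) = (D * (1 + x) + \<theta>) + - (sB * x)"
    unfolding assms by (simp add: algebra_simps)
  then show ?thesis
    by (simp only: slice_combine shift_Un shift_rep[symmetric] shift_shift)
qed

lemma shift_lipschitz_slice: "finite C \<Longrightarrow> shift_lipschitz (real (card C)) (slice C x)"
  unfolding slice_def
  using shift_lipschitz_UN[of C 1 "\<lambda>(a, s, t). {a + s * x..a + s * x + t}"] shift_lipschitz_interval by auto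

lemma bounded_borel_slice: "finite C \<Longrightarrow> bounded_borel (slice C x)"
  using shift_lipschitz_slice unfolding shift_lipschitz_def by blast

lemma combine_finite: "finite \<alpha> \<Longrightarrow> finite \<beta> \<Longrightarrow> finite (combine p m \<alpha> q n \<beta> c)"
  by (auto simp: combine_def move_def)

lemma combine_mem: "(a, s, t) \<in> combine p m \<alpha> q n \<beta> c \<Longrightarrow> \<exists>b. (b, s, t) \<in> \<alpha> \<union> \<beta>"
  by (auto simp: combine_def move_def)

lemma shift_lipschitz_mono: "shift_lipschitz n Y \<Longrightarrow> n \<le> m \<Longrightarrow> shift_lipschitz m Y"
  unfolding shift_lipschitz_def by (meson abs_ge_zero mult_right_mono order_trans)

subsection \<open>Finite averages\<close>

text \<open>Lists instead of sets, so that configurations which happen to coincide keep their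
  multiplicity and independent draws have product weights.\<close>

definition avg :: "'a list \<Rightarrow> ('a \<Rightarrow> real) \<Rightarrow> real" where
  "avg \<Omega> F = (\<Sum>\<omega>\<leftarrow>\<Omega>. F \<omega>) / real (length \<Omega>)"

lemma avg_mono: "(\<And>\<omega>. \<omega> \<in> set \<Omega> \<Longrightarrow> F \<omega> \<le> G \<omega>) \<Longrightarrow> avg \<Omega> F \<le> avg \<Omega> G"
  unfolding avg_def by (intro divide_right_mono sum_list_mono) auto

lemma avg_cong: "(\<And>\<omega>. \<omega> \<in> set \<Omega> \<Longrightarrow> F \<omega> = G \<omega>) \<Longrightarrow> avg \<Omega> F = avg \<Omega> G"
  by (intro antisym avg_mono) auto

lemma avg_add: "avg \<Omega> (\<lambda>\<omega>. F \<omega> + G \<omega>) = avg \<Omega> F + avg \<Omega> G"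
  by (simp add: avg_def sum_list_addf add_divide_distrib)

lemma avg_diff: "avg \<Omega> (\<lambda>\<omega>. F \<omega> - G \<omega>) = avg \<Omega> F - avg \<Omega> G"
  by (simp add: avg_def sum_list_subtractf diff_divide_distrib)

lemma avg_cmult: "avg \<Omega> (\<lambda>\<omega>. c * F \<omega>) = c * avg \<Omega> F"
  by (simp add: avg_def sum_list_const_mult)

lemma avg_multc: "avg \<Omega> (\<lambda>\<omega>. F \<omega> * c) = avg \<Omega> F * c"
  by (simp add: avg_def sum_list_mult_const)

lemma avg_const: "\<Omega> \<noteq> [] \<Longrightarrow> avg \<Omega> (\<lambda>_. c) = c"
  by (simp add: avg_def sum_list_triv)

text \<open>The tower rule: with equal lengths, all outcomes of the two-stage draw have the same
  weight.\<close>

lemma avg_concat_map: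
  assumes "\<And>\<omega>. \<omega> \<in> set \<Omega> \<Longrightarrow> length (f \<omega>) = l" "l > 0"
  shows "avg (concat (map f \<Omega>)) F = avg \<Omega> (\<lambda>\<omega>. avg (f \<omega>) F)"
proof -
  have len: "length (concat (map f \<Omega>)) = length \<Omega> * l" using assms by (induction \<Omega>) auto
  have "(\<Sum>\<omega>\<leftarrow>\<Omega>. avg (f \<omega>) F) = (\<Sum>\<omega>\<leftarrow>\<Omega>. sum_list (map F (f \<omega>)) / real l)"
    using assms by (intro arg_cong[where f=sum_list] map_cong) (auto simp: avg_def)
  also have "\<dots> = (\<Sum>\<omega>\<leftarrow>\<Omega>. sum_list (map F (f \<omega>))) / real l"
    by (induction \<Omega>) (auto simp: add_divide_distrib)
  also have "(\<Sum>\<omega>\<leftarrow>\<Omega>. sum_list (map F (f \<omega>))) = sum_list (map F (concat (map f \<Omega>)))"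
    by (induction \<Omega>) auto
  finally show ?thesis by (simp add: avg_def len)
qed

lemma set_concat_map: "C \<in> set (concat (map f \<Omega>)) \<longleftrightarrow> (\<exists>\<omega>\<in>set \<Omega>. C \<in> set (f \<omega>))"
  by auto

lemma avg_grid: "avg (map f [0..<N]) F = (\<Sum>r<N. F (f r)) / real N"
  by (simp add: avg_def comp_def interv_sum_list_conv_sum_set_nat atLeast0LessThan)

subsection \<open>The recursion\<close>

text \<open>
  In \<open>stree \<epsilon> G k s P\<close> the number \<open>s\<close> is a reference slope (that of the leftmost leaf), and \<open>P\<close> is the
  period with which the set built for the tree is repeated; at a leaf \<open>P\<close> is the width of the tube.
\<close>

inductive stree :: "real \<Rightarrow> (real \<Rightarrow> real \<Rightarrow> bool) \<Rightarrow> nat \<Rightarrow> real \<Rightarrow> real \<Rightarrow> bool"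
  for \<epsilon> :: real and G :: "real \<Rightarrow> real \<Rightarrow> bool" where
  leaf: "G s P \<Longrightarrow> 0 < P \<Longrightarrow> stree \<epsilon> G 0 s P"
| node: "stree \<epsilon> G k sA p \<Longrightarrow> stree \<epsilon> G k sB q \<Longrightarrow> D = sB - sA \<Longrightarrow>
    p \<le> \<epsilon> * D \<Longrightarrow> q \<le> \<epsilon> * D \<Longrightarrow> stree \<epsilon> G (Suc k) sA (2 * D)"

text \<open>The expression increases in both variables on the unit square, so the worst case is the
  diagonal at the larger of \<open>a\<close> and \<open>b\<close>. There t - 3/8 t^2 has slope
  between 0 and 1, so the error \<open>e\<close> passes through unamplified. The bound
  \<open>4 / (k + 4)\<close> is a supersolution of this iteration that starts at 1; 3/8 is half the
  overlapping fraction 3/4.\<close>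

lemma step_left_arith:
  fixes a b e \<epsilon> :: real
  assumes "0 \<le> a" "a \<le> 1" "0 \<le> b" "b \<le> 1" and e: "e \<ge> 0" "\<epsilon> \<ge> 0"
    and "a \<le> 4 / (real k + 4) + e" "b \<le> 4 / (real k + 4) + e"
  shows "(a + b) / 2 - 3/8 * a * b \<le> 4 / (real (Suc k) + 4) + e"
proof -
  define u where "u = 4 / (real k + 4)"
  define h where "h = (\<lambda>t::real. t - 3/8 * t * t)"
  define t where "t = max a b"
  have u: "0 < u" "u \<le> 1" by (auto simp: u_def field_simps)
  have t: "0 \<le> t" "t \<le> 1" "t \<le> u + e" using assms unfolding t_def u_def by auto
  have "(a + b) / 2 - 3/8 * a * b \<le> h t"
  proof -
    have "(a + b) / 2 - 3/8 * a * b \<le> h b" if "a \<le> b" "b \<le> 1" for a b :: real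
    proof -
      have "0 \<le> (b - a) * (1/2 - 3/8 * b)" using that by (intro mult_nonneg_nonneg) auto
      also have "\<dots> = h b - ((a + b) / 2 - 3/8 * a * b)" by (simp add: h_def field_simps)
      finally show ?thesis by simp
    qed
    from this[of a b] this[of b a] show ?thesis
      using assms unfolding t_def by (cases "a \<le> b") (auto simp: max_def algebra_simps)
  qed
  also have "h t \<le> h u + e"
  proof (cases "t \<le> u")
    case True
    have "0 \<le> (u - t) * (1 - 3/8 * (u + t))" using True t u by (intro mult_nonneg_nonneg) auto
    also have "\<dots> = h u - h t" by (simp add: h_def field_simps)
    finally show ?thesis using e by simp
  next
    case False
    then have "u * u \<le> t * t" using u by (intro mult_mono) auto
    then show ?thesis using t by (simp add: h_def)
  qed
  also have "h u \<le> 4 / (real (Suc k) + 4)"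
  proof -
    define T where "T = real k + 4"
    have T: "T \<ge> 4" by (simp add: T_def)
    have "h u = 4 / T - 6 / (T * T)" using T by (simp add: h_def u_def T_def[symmetric])
    also have "\<dots> \<le> 4 / (T + 1)" using T by (simp add: field_simps)
    finally show ?thesis by (simp add: T_def algebra_simps)
  qed
  finally show ?thesis by simp
qed

text \<open>Monotonicity now reduces to the smaller of \<open>a\<close> and \<open>b\<close>. With T
  = 1 + k x, the bound 1/T drops by x / (T (T + x)) in one step, which is at least the loss x / (2
  T^2) because x \<le> T; so it is a subsolution.\<close>

lemma step_right_arith:
  fixes a b e x :: real
  assumes "0 \<le> a" "a \<le> 1" "0 \<le> b" "b \<le> 1" and e: "e \<ge> 0" and x: "0 \<le> x" "x \<le> 1/2"
    and "1 / (1 + real k * x) - e \<le> a" "1 / (1 + real k * x) - e \<le> b"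
  shows "1 / (1 + real (Suc k) * x) - e \<le> (a + b) / 2 - x / 2 * a * b"
proof -
  define u where "u = 1 / (1 + real k * x)"
  define h where "h = (\<lambda>t::real. t - x / 2 * t * t)"
  define t where "t = min a b"
  have kx: "0 \<le> real k * x" using x by simp
  have u: "0 < u" "u \<le> 1" using kx by (auto simp: u_def field_simps)
  have t: "0 \<le> t" "t \<le> 1" "u - e \<le> t" using assms unfolding t_def u_def by auto
  have xb: "x * b \<le> 1/2" if "b \<le> 1" "0 \<le> b" for b using mult_mono[of x "1/2" b 1] x that by simp
  have "h t \<le> (a + b) / 2 - x / 2 * a * b"
  proof -
    have "h a \<le> (a + b) / 2 - x / 2 * a * b" if "a \<le> b" "a \<le> 1" "0 \<le> a" for a b :: real
    proof -
      have "0 \<le> (b - a) * (1/2 - x * a / 2)" using that xb[of a] by (intro mult_nonneg_nonneg) auto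
      also have "\<dots> = (a + b) / 2 - x / 2 * a * b - h a" by (simp add: h_def field_simps)
      finally show ?thesis by simp
    qed
    from this[of a b] this[of b a] show ?thesis
      using assms unfolding t_def by (cases "a \<le> b") (auto simp: min_def algebra_simps)
  qed
  moreover have "h u - e \<le> h t"
  proof (cases "u \<le> t")
    case True
    have "0 \<le> (t - u) * (1 - (x * u + x * t) / 2)" using True t u xb[of u] xb[of t] by (intro mult_nonneg_nonneg) auto
    also have "\<dots> = h t - h u" by (simp add: h_def field_simps)
    finally show ?thesis using e by simp
  next
    case False
    then have "t * t \<le> u * u" using t by (intro mult_mono) auto
    then have "x / 2 * (t * t) \<le> x / 2 * (u * u)" using x by (intro mult_left_mono) auto
    then show ?thesis using t by (simp add: h_def algebra_simps)
  qed
  moreover have "1 / (1 + real (Suc k) * x) \<le> h u"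
  proof -
    define T where "T = 1 + real k * x"
    have T: "T \<ge> 1" using kx by (simp add: T_def)
    have "1 / T - 1 / (T + x) = x / (T * (T + x))" using T x by (simp add: field_simps)
    also have "\<dots> \<ge> x / (T * (T + T))" using T x by (intro divide_left_mono mult_left_mono mult_pos_pos) auto
    then have "x / (T * (T + x)) \<ge> x / 2 * (1/T) * (1/T)" by (simp add: field_simps)
    finally have "1 / (T + x) \<le> 1 / T - x / 2 * (1/T) * (1/T)" by simp
    moreover have "T + x = 1 + real (Suc k) * x" by (simp add: T_def algebra_simps)
    ultimately show ?thesis unfolding h_def u_def T_def[symmetric] by metis
  qed
  ultimately show ?thesis by linarith
qed

text \<open>The list \<open>\<Omega>\<close> serves as a finite probability space of random configurations.\<close>

definition family :: "real \<Rightarrow> (real \<Rightarrow> real \<Rightarrow> bool) \<Rightarrow> nat \<Rightarrow> real \<Rightarrow> real \<Rightarrow> config list \<Rightarrow> bool" where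
  "family \<epsilon> G k s P \<Omega> \<longleftrightarrow> \<Omega> \<noteq> [] \<and>
     (\<forall>C\<in>set \<Omega>. finite C \<and> (\<forall>(a, \<sigma>, t)\<in>C. G \<sigma> t) \<and>
        (\<forall>x\<in>{-5/4..1/2}. shift (- (s * x)) (slice C x) \<subseteq> {-P..<2*P})) \<and>
     (\<forall>x\<in>{-5/4..-3/4}. avg \<Omega> (\<lambda>C. len (slice C x)) \<le> (4 / (real k + 4) + 9 * real k * \<epsilon>) * P) \<and>
     (\<forall>x\<in>{0..1/2}. 1 / (1 + real k * x) - 9 * real k * \<epsilon> \<le> avg \<Omega> (\<lambda>C. dens P (slice C x)))"

lemma familyD:
  assumes "family \<epsilon> G k s P \<Omega>"
  shows "\<Omega> \<noteq> []"
    and "C \<in> set \<Omega> \<Longrightarrow> finite C"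
    and "C \<in> set \<Omega> \<Longrightarrow> (a, \<sigma>, t) \<in> C \<Longrightarrow> G \<sigma> t"
    and "C \<in> set \<Omega> \<Longrightarrow> x \<in> {-5/4..1/2} \<Longrightarrow> shift (- (s * x)) (slice C x) \<subseteq> {-P..<2*P}"
    and "x \<in> {-5/4..-3/4} \<Longrightarrow> avg \<Omega> (\<lambda>C. len (slice C x)) \<le> (4 / (real k + 4) + 9 * real k * \<epsilon>) * P"
    and "x \<in> {0..1/2} \<Longrightarrow> 1 / (1 + real k * x) - 9 * real k * \<epsilon> \<le> avg \<Omega> (\<lambda>C. dens P (slice C x))"
  using assms unfolding family_def by (simp_all add: Ball_def split_beta del: atLeastAtMost_iff)

lemma dens_interval: assumes "P > 0" shows "dens P {a..a + P} = 1"
proof -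
  have "{0..<P} \<subseteq> periodize P {a..a + P}"
  proof
    fix y assume "y \<in> {0..<P}"
    define n where "n = \<lceil>(a - y) / P\<rceil>"
    have "(a - y) / P \<le> of_int n" "of_int n < (a - y) / P + 1"
      unfolding n_def by linarith+
    then have "a \<le> y + of_int n * P" "y + of_int n * P \<le> a + P"
      using assms by (auto simp: field_simps)
    then have "y + of_int n * P \<in> {a..a + P}" by simp
    then show "y \<in> periodize P {a..a + P}" unfolding periodize_def by blast
  qed
  then have "periodize P {a..a + P} \<inter> {0..<P} = {0..<P}" by blast
  then show ?thesis using assms by (simp add: dens_def)
qed

text \<open>The period of a leaf is the width of its tube, so the copies tile the line; both bounds
  in \<open>family\<close> equal full density at \<open>k = 0\<close>.\<close>

lemma family_leaf: assumes "G s P" "0 < P" shows "family \<epsilon> G 0 s P [{(0, s, P)}]"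
proof -
  have "slice {(0, s, P)} x = {s * x..s * x + P}" for x by (simp add: slice_def)
  then show ?thesis using assms dens_interval[of P] by (auto simp: family_def avg_def)
qed

text \<open>Triples of a configuration \<alpha>, a configuration \<beta> and a phase are drawn
  uniformly. Around x = -1 the errors are 6 (lengths of the blocks), 10 (overlap) and 1 (grid) times
  \<open>\<epsilon> * D\<close>; for x \<ge> 0 they are 10, 4 and 1. Divided by the new period
  \<open>2 * D\<close>, the sums 17 and 15 stay below the \<open>9 * \<epsilon>\<close> allowed per
  generation.\<close>

lemma family_node:
  assumes A: "family \<epsilon> G k sA p \<Omega>A" and B: "family \<epsilon> G k sB q \<Omega>B"
    and D: "D = sB - sA" and small: "p \<le> \<epsilon> * D" "q \<le> \<epsilon> * D" "\<epsilon> \<le> 1/8" "0 < p" "0 < q" "0 \<le> \<epsilon>"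
  shows "\<exists>\<Omega>. family \<epsilon> G (Suc k) sA (2 * D) \<Omega>"
proof -
  have eD: "0 < \<epsilon> * D" using small by linarith
  then have Dpos: "0 < D" using small zero_less_mult_pos[of \<epsilon> D] by (cases "\<epsilon> = 0") auto
  define m n where "m = nat \<lfloor>D / p\<rfloor>" and "n = nat \<lfloor>D / q\<rfloor>"
  \<comment> \<open>The largest number of tubes serves as one Lipschitz constant for the whole
    second family.\<close>
  define L where "L = real (Max (card ` set \<Omega>B))"
  have finB: "finite C" if "C \<in> set \<Omega>B" for C using familyD(2)[OF B that] .
  have finA: "finite C" if "C \<in> set \<Omega>A" for C using familyD(2)[OF A that] .
  have ne: "\<Omega>A \<noteq> []" "\<Omega>B \<noteq> []" using familyD(1) A B by blast+
  have mn: "real m * p \<le> D" "D < (real m + 1) * p" "real n * q \<le> D" "D < (real n + 1) * q"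
  proof -
    have "real m \<le> D / p" "D / p < real m + 1" "real n \<le> D / q" "D / q < real n + 1"
      using small Dpos unfolding m_def n_def by (auto simp: floor_less_iff)
    then show "real m * p \<le> D" "D < (real m + 1) * p" "real n * q \<le> D" "D < (real n + 1) * q"
      using small by (auto simp: field_simps)
  qed
  \<comment> \<open>So many phases that the quadrature error in \<open>grid_error\<close> is at most
    \<open>\<epsilon> * D\<close>.\<close>
  obtain N :: nat where N0: "q * L * real n / (\<epsilon> * D) < real N" using reals_Archimedean2 by blast
  have L0: "L \<ge> 0" by (simp add: L_def)
  have N: "0 < N" "q * L * real n \<le> \<epsilon> * D * real N"
  proof -
    have "0 \<le> q * L * real n / (\<epsilon> * D)" using L0 small eD by (intro divide_nonneg_pos mult_nonneg_nonneg) auto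
    then show "0 < N" using N0 by simp
    show "q * L * real n \<le> \<epsilon> * D * real N" using N0 eD by (simp add: field_simps)
  qed
  define \<theta> where "\<theta> r = real r * (q / real N)" for r
  have \<theta>: "0 \<le> \<theta> r" "\<theta> r \<le> q" if "r < N" for r
    using that N small by (auto simp: \<theta>_def field_simps)
  define c where "c \<alpha> \<beta> r = combine p m \<alpha> q n \<beta> (D + \<theta> r)" for \<alpha> \<beta> r
  define \<Omega> where "\<Omega> = concat (map (\<lambda>\<alpha>. concat (map (\<lambda>\<beta>. map (c \<alpha> \<beta>) [0..<N]) \<Omega>B)) \<Omega>A)"
  have avg_\<Omega>: "avg \<Omega> F = avg \<Omega>A (\<lambda>\<alpha>. avg \<Omega>B (\<lambda>\<beta>. (\<Sum>r<N. F (c \<alpha> \<beta> r)) / real N))" for F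
  proof -
    have l: "length (concat (map (\<lambda>\<beta>. map (c \<alpha> \<beta>) [0..<N]) \<Omega>B)) = length \<Omega>B * N" for \<alpha>
      by (induction \<Omega>B) auto
    have "avg \<Omega> F = avg \<Omega>A (\<lambda>\<alpha>. avg (concat (map (\<lambda>\<beta>. map (c \<alpha> \<beta>) [0..<N]) \<Omega>B)) F)"
      unfolding \<Omega>_def using l ne N by (intro avg_concat_map[of _ _ "length \<Omega>B * N"]) auto
    also have "\<dots> = avg \<Omega>A (\<lambda>\<alpha>. avg \<Omega>B (\<lambda>\<beta>. avg (map (c \<alpha> \<beta>) [0..<N]) F))"
      using N by (subst avg_concat_map[of _ _ N]) auto
    finally show ?thesis by (simp add: avg_grid)
  qed
  have set_\<Omega>: "\<exists>\<alpha>\<in>set \<Omega>A. \<exists>\<beta>\<in>set \<Omega>B. \<exists>r<N. C = c \<alpha> \<beta> r" if "C \<in> set \<Omega>" for C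
  proof -
    from that obtain \<alpha> where \<alpha>: "\<alpha> \<in> set \<Omega>A"
      and "C \<in> set (concat (map (\<lambda>\<beta>. map (c \<alpha> \<beta>) [0..<N]) \<Omega>B))"
      unfolding \<Omega>_def set_concat_map by (rule bexE)
    from this(2) obtain \<beta> where \<beta>: "\<beta> \<in> set \<Omega>B" and "C \<in> set (map (c \<alpha> \<beta>) [0..<N])"
      unfolding set_concat_map by (rule bexE)
    then obtain r where "r < N" "C = c \<alpha> \<beta> r" by auto
    with \<alpha> \<beta> show ?thesis by (intro bexI exI conjI)
  qed
  define SA where "SA \<alpha> x = shift (- (sA * x)) (slice \<alpha> x)" for \<alpha> x
  define SB where "SB \<beta> x = shift (- (sB * x)) (slice \<beta> x)" for \<beta> x
  have sl: "shift (- (sA * x)) (slice (c \<alpha> \<beta> r) x) =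
     rep p m (SA \<alpha> x) \<union> shift (D * (1 + x) + \<theta> r) (rep q n (SB \<beta> x))" for \<alpha> \<beta> r x
    unfolding c_def SA_def SB_def by (rule slice_combine_frame[OF D])
  have two: "two_blocks p q D m n (SA \<alpha> x) (SB \<beta> x) \<epsilon> L"
    if "\<alpha> \<in> set \<Omega>A" "\<beta> \<in> set \<Omega>B" "x \<in> {-5/4..1/2}" for \<alpha> \<beta> x
  proof unfold_locales
    show "bounded_borel (SA \<alpha> x)" "bounded_borel (SB \<beta> x)"
      using finA finB that by (auto simp: SA_def SB_def intro!: bounded_borel_shift bounded_borel_slice)
    show "SA \<alpha> x \<subseteq> {-p..<2*p}" "SB \<beta> x \<subseteq> {-q..<2*q}"
      using familyD(4)[OF A that(1,3)] familyD(4)[OF B that(2,3)] unfolding SA_def SB_def by simp_all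
    have "real (card \<beta>) \<le> L" using that unfolding L_def by simp
    then show "shift_lipschitz L (SB \<beta> x)" unfolding SB_def
      by (intro shift_lipschitz_shift shift_lipschitz_mono[OF shift_lipschitz_slice]) (use finB that in auto)
  qed (use small mn in auto)
  have fin: "finite (c \<alpha> \<beta> r)" if "\<alpha> \<in> set \<Omega>A" "\<beta> \<in> set \<Omega>B" for \<alpha> \<beta> r
    unfolding c_def using finA finB that by (intro combine_finite)
  have len_c: "len (slice (c \<alpha> \<beta> r) x) = len (shift (- (sA * x)) (slice (c \<alpha> \<beta> r) x))"
    and dens_c: "dens (2*D) (slice (c \<alpha> \<beta> r) x) = dens (2*D) (shift (- (sA * x)) (slice (c \<alpha> \<beta> r) x))"
    if "\<alpha> \<in> set \<Omega>A" "\<beta> \<in> set \<Omega>B" for \<alpha> \<beta> r x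
    using bounded_borel_slice[OF fin[OF that]] Dpos by (auto simp: bounded_borel_borel)
  have dA: "dens p (SA \<alpha> x) = dens p (slice \<alpha> x)" if "\<alpha> \<in> set \<Omega>A" for \<alpha> x
    using bounded_borel_slice[OF finA[OF that]] small by (auto simp: bounded_borel_borel SA_def)
  have dB: "dens q (SB \<beta> x) = dens q (slice \<beta> x)" if "\<beta> \<in> set \<Omega>B" for \<beta> x
    using bounded_borel_slice[OF finB[OF that]] small by (auto simp: bounded_borel_borel SB_def)
  define a b where "a x = avg \<Omega>A (\<lambda>\<alpha>. dens p (slice \<alpha> x))" and "b x = avg \<Omega>B (\<lambda>\<beta>. dens q (slice \<beta> x))" for x
  have ab01: "0 \<le> a x" "a x \<le> 1" "0 \<le> b x" "b x \<le> 1" for x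
  proof -
    have "avg \<Omega>A (\<lambda>_. 0) \<le> a x" "a x \<le> avg \<Omega>A (\<lambda>_. 1)" "avg \<Omega>B (\<lambda>_. 0) \<le> b x" "b x \<le> avg \<Omega>B (\<lambda>_. 1)"
      unfolding a_def b_def using small finA finB
      by (auto intro!: avg_mono dens_nonneg dens_le_1 bounded_borel_borel bounded_borel_slice)
    then show "0 \<le> a x" "a x \<le> 1" "0 \<le> b x" "b x \<le> 1" using ne by (auto simp: avg_const)
  qed
  \<comment> \<open>Independence of \<alpha> and \<beta>: the mean of the product of their densities
    is the product of the means.\<close>
  have split: "avg \<Omega>A (\<lambda>\<alpha>. avg \<Omega>B (\<lambda>\<beta>. D * (dens p (slice \<alpha> x) + dens q (slice \<beta> x)) + e
      - dens p (slice \<alpha> x) * dens q (slice \<beta> x) * u))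
    = D * (a x + b x) + e - a x * b x * u" for x e u
    using ne by (simp add: avg_add avg_diff avg_cmult avg_multc avg_const a_def b_def distrib_left)
  let ?e = "9 * real k * \<epsilon>"
  have e0: "0 \<le> ?e" using small by simp
  show ?thesis
  proof (intro exI[of _ \<Omega>], unfold family_def, intro conjI ballI)
    show "\<Omega> \<noteq> []" using ne N unfolding \<Omega>_def by (cases \<Omega>A; cases \<Omega>B) auto
  next
    fix C assume "C \<in> set \<Omega>"
    then obtain \<alpha> \<beta> r where C: "\<alpha> \<in> set \<Omega>A" "\<beta> \<in> set \<Omega>B" "r < N" "C = c \<alpha> \<beta> r" using set_\<Omega> by blast
    show "finite C" using fin C by simp
    { fix z assume "z \<in> C"
      then obtain a \<sigma> t b where "z = (a, \<sigma>, t)" "(b, \<sigma>, t) \<in> \<alpha> \<union> \<beta>"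
        using combine_mem unfolding C(4) c_def by (metis prod_cases3)
      then show "case z of (a, \<sigma>, t) \<Rightarrow> G \<sigma> t"
        using familyD(3)[OF A C(1)] familyD(3)[OF B C(2)] by auto }
    { fix x :: real assume x: "x \<in> {-5/4..1/2}"
      interpret two_blocks p q D m n "SA \<alpha> x" "SB \<beta> x" \<epsilon> L using two C x by blast
      have "D * (-1/4) \<le> D * (1 + x)" "D * (1 + x) \<le> D * (3/2)"
        using x Dpos by (intro mult_left_mono; simp)+
      then show "shift (- (sA * x)) (slice C x) \<subseteq> {- (2 * D)..<2 * (2 * D)}"
        unfolding C(4) sl using C \<theta> by (intro union_subset) auto }
  next
    fix x :: real assume x: "x \<in> {-5/4..-3/4}"
    have "avg \<Omega> (\<lambda>C. len (slice C x)) \<le> avg \<Omega>A (\<lambda>\<alpha>. avg \<Omega>B (\<lambda>\<beta>. D * (dens p (slice \<alpha> x) + dens q (slice \<beta> x)) + 17 * \<epsilon> * D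
       - dens p (slice \<alpha> x) * dens q (slice \<beta> x) * (3/4 * D)))"
      unfolding avg_\<Omega>
    proof (intro avg_mono)
      fix \<alpha> \<beta> assume ab: "\<alpha> \<in> set \<Omega>A" "\<beta> \<in> set \<Omega>B"
      interpret two_blocks p q D m n "SA \<alpha> x" "SB \<beta> x" \<epsilon> L using two ab x by auto
      let ?w = "D * (1 + x)"
      let ?o = "\<lambda>r. len (A.X \<inter> shift (?w + \<theta> r) B.X)"
      have "\<bar>1 + x\<bar> \<le> 1/4" using x unfolding atLeastAtMost_iff by linarith
      then have "D * \<bar>1 + x\<bar> \<le> D * (1/4)" using Dpos by (intro mult_left_mono) auto
      moreover have "\<bar>?w\<bar> = D * \<bar>1 + x\<bar>" using Dpos by (simp add: abs_mult)
      ultimately have w: "\<bar>?w\<bar> \<le> D / 4" by simp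
      have "(\<Sum>r<N. len (slice (c \<alpha> \<beta> r) x)) \<le> (\<Sum>r<N. (D * (A.d + B.d) + 6 * \<epsilon> * D) - ?o r)"
        unfolding len_c[OF ab] sl by (intro sum_mono union_left)
      also have "\<dots> = real N * (D * (A.d + B.d) + 6 * \<epsilon> * D) - (\<Sum>r<N. ?o r)"
        by (simp add: sum_subtractf)
      finally have "(\<Sum>r<N. len (slice (c \<alpha> \<beta> r) x)) / real N \<le> D * (A.d + B.d) + 6 * \<epsilon> * D - (\<Sum>r<N. ?o r) / real N"
        using N by (simp add: field_simps)
      moreover have "A.d * B.d * (3/4 * D) - 10 * \<epsilon> * D - \<epsilon> * D \<le> (\<Sum>r<N. ?o r) / real N"
        using overlap_left[OF w] grid_error[OF A.X N, of ?w] unfolding \<theta>_def by linarith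
      ultimately show "(\<Sum>r<N. len (slice (c \<alpha> \<beta> r) x)) / real N \<le>
        D * (dens p (slice \<alpha> x) + dens q (slice \<beta> x)) + 17 * \<epsilon> * D - dens p (slice \<alpha> x) * dens q (slice \<beta> x) * (3/4 * D)"
        unfolding dA[OF ab(1)] dB[OF ab(2)] by linarith
    qed
    also have "\<dots> = D * (a x + b x) + 17 * \<epsilon> * D - a x * b x * (3/4 * D)" by (rule split)
    also have "\<dots> = ((a x + b x) / 2 - 3/8 * a x * b x + 17/2 * \<epsilon>) * (2 * D)"
      by (simp add: algebra_simps)
    also have "\<dots> \<le> (4 / (real (Suc k) + 4) + 9 * real (Suc k) * \<epsilon>) * (2 * D)"
    proof (intro mult_right_mono)
      \<comment> \<open>The hypothesis on the subtree bounds mean lengths while the recursion runs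
        on densities; \<open>dens_le_len\<close> bridges the two after passing to the frame of the
        slope.\<close>
      have "a x \<le> 4 / (real k + 4) + ?e"
      proof -
        have "a x * p = avg \<Omega>A (\<lambda>\<alpha>. dens p (SA \<alpha> x) * p)"
          unfolding a_def avg_multc[symmetric] using dA by (intro avg_cong) simp
        also have "\<dots> \<le> avg \<Omega>A (\<lambda>\<alpha>. len (SA \<alpha> x))"
        proof (intro avg_mono dens_le_len small)
          fix \<alpha> assume al: "\<alpha> \<in> set \<Omega>A"
          obtain \<beta> where be: "\<beta> \<in> set \<Omega>B" using ne by (cases \<Omega>B) auto
          interpret two_blocks p q D m n "SA \<alpha> x" "SB \<beta> x" \<epsilon> L using two al be x by auto
          show "bounded_borel (SA \<alpha> x)" "SA \<alpha> x \<subseteq> {-p..<2*p}" by (rule A.S)+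
        qed
        also have "\<dots> \<le> avg \<Omega>A (\<lambda>\<alpha>. len (slice \<alpha> x))"
          unfolding SA_def using bounded_borel_slice finA by (intro avg_mono) (auto simp: bounded_borel_borel)
        also have "\<dots> \<le> (4 / (real k + 4) + ?e) * p" by (rule familyD(5)[OF A x])
        finally show ?thesis using small by simp
      qed
      moreover have "b x \<le> 4 / (real k + 4) + ?e"
      proof -
        have "b x * q = avg \<Omega>B (\<lambda>\<beta>. dens q (SB \<beta> x) * q)"
          unfolding b_def avg_multc[symmetric] using dB by (intro avg_cong) simp
        also have "\<dots> \<le> avg \<Omega>B (\<lambda>\<beta>. len (SB \<beta> x))"
        proof (intro avg_mono dens_le_len small)
          fix \<beta> assume be: "\<beta> \<in> set \<Omega>B"
          obtain \<alpha> where al: "\<alpha> \<in> set \<Omega>A" using ne by (cases \<Omega>A) auto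
          interpret two_blocks p q D m n "SA \<alpha> x" "SB \<beta> x" \<epsilon> L using two al be x by auto
          show "bounded_borel (SB \<beta> x)" "SB \<beta> x \<subseteq> {-q..<2*q}" by (rule B.S)+
        qed
        also have "\<dots> \<le> avg \<Omega>B (\<lambda>\<beta>. len (slice \<beta> x))"
          unfolding SB_def using bounded_borel_slice finB by (intro avg_mono) (auto simp: bounded_borel_borel)
        also have "\<dots> \<le> (4 / (real k + 4) + ?e) * q" by (rule familyD(5)[OF B x])
        finally show ?thesis using small by simp
      qed
      ultimately have "(a x + b x) / 2 - 3/8 * a x * b x \<le> 4 / (real (Suc k) + 4) + ?e"
        using ab01 e0 small by (intro step_left_arith[where \<epsilon>=\<epsilon>]) auto
      moreover have "9 * real (Suc k) * \<epsilon> = ?e + 9 * \<epsilon>" by (simp add: algebra_simps)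
      ultimately show "(a x + b x) / 2 - 3/8 * a x * b x + 17/2 * \<epsilon> \<le> 4 / (real (Suc k) + 4) + 9 * real (Suc k) * \<epsilon>"
        using small(6) by linarith
    qed (use Dpos in auto)
    finally show "avg \<Omega> (\<lambda>C. len (slice C x)) \<le> (4 / (real (Suc k) + 4) + 9 * real (Suc k) * \<epsilon>) * (2 * D)" .
  next
    fix x :: real assume x: "x \<in> {0..1/2}"
    have "1 / (1 + real k * x) - ?e \<le> a x" "1 / (1 + real k * x) - ?e \<le> b x"
      using familyD(6)[OF A x] familyD(6)[OF B x] unfolding a_def b_def by simp_all
    then have "1 / (1 + real (Suc k) * x) - ?e \<le> (a x + b x) / 2 - x / 2 * a x * b x"
      using ab01 e0 x by (intro step_right_arith) auto
    then have "1 / (1 + real (Suc k) * x) - 9 * real (Suc k) * \<epsilon> \<le> (a x + b x) / 2 - x / 2 * a x * b x - 15/2 * \<epsilon>"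
      using small by (simp add: algebra_simps)
    then have "(1 / (1 + real (Suc k) * x) - 9 * real (Suc k) * \<epsilon>) * (2 * D) \<le> ((a x + b x) / 2 - x / 2 * a x * b x - 15/2 * \<epsilon>) * (2 * D)"
      using Dpos by (intro mult_right_mono) auto
    also have "\<dots> = D * (a x + b x) + (- 15 * \<epsilon> * D) - a x * b x * (D * x)"
      by (simp add: algebra_simps)
    also have "\<dots> = avg \<Omega>A (\<lambda>\<alpha>. avg \<Omega>B (\<lambda>\<beta>. D * (dens p (slice \<alpha> x) + dens q (slice \<beta> x)) + (- 15 * \<epsilon> * D)
       - dens p (slice \<alpha> x) * dens q (slice \<beta> x) * (D * x)))" by (rule split[symmetric])
    also have "\<dots> \<le> avg \<Omega> (\<lambda>C. dens (2*D) (slice C x) * (2 * D))"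
      unfolding avg_\<Omega>
    proof (intro avg_mono)
      fix \<alpha> \<beta> assume ab: "\<alpha> \<in> set \<Omega>A" "\<beta> \<in> set \<Omega>B"
      interpret two_blocks p q D m n "SA \<alpha> x" "SB \<beta> x" \<epsilon> L using two ab x by auto
      let ?o = "\<lambda>r. len (A.X \<inter> shift (D * (x - 1) + \<theta> r) B.X)"
      have "real N * (D * (A.d + B.d) - 10 * \<epsilon> * D) - (\<Sum>r<N. ?o r) = (\<Sum>r<N. (D * (A.d + B.d) - 10 * \<epsilon> * D) - ?o r)"
        by (simp add: sum_subtractf)
      also have "\<dots> \<le> (\<Sum>r<N. dens (2*D) (slice (c \<alpha> \<beta> r) x) * (2 * D))"
        unfolding dens_c[OF ab] sl using x \<theta> by (intro sum_mono dens_right) auto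
      finally have "(real N * (D * (A.d + B.d) - 10 * \<epsilon> * D) - (\<Sum>r<N. ?o r)) / real N \<le> (\<Sum>r<N. dens (2*D) (slice (c \<alpha> \<beta> r) x) * (2 * D)) / real N"
        by (rule divide_right_mono) simp
      then have "D * (A.d + B.d) - 10 * \<epsilon> * D - (\<Sum>r<N. ?o r) / real N \<le> (\<Sum>r<N. dens (2*D) (slice (c \<alpha> \<beta> r) x) * (2 * D)) / real N"
        using N by (simp add: diff_divide_distrib)
      moreover have "0 \<le> x" "x \<le> 1/2" using x by auto
      then have "(\<Sum>r<N. ?o r) / real N \<le> A.d * B.d * (D * x) + 4 * \<epsilon> * D + \<epsilon> * D"
        using overlap_right[of x] grid_error[OF A.X N, of "D * (x - 1)"] unfolding \<theta>_def by linarith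
      ultimately show "D * (dens p (slice \<alpha> x) + dens q (slice \<beta> x)) + (- 15 * \<epsilon> * D) - dens p (slice \<alpha> x) * dens q (slice \<beta> x) * (D * x)
        \<le> (\<Sum>r<N. dens (2*D) (slice (c \<alpha> \<beta> r) x) * (2 * D)) / real N"
        unfolding dA[OF ab(1)] dB[OF ab(2)] by linarith
    qed
    also have "\<dots> = avg \<Omega> (\<lambda>C. dens (2*D) (slice C x)) * (2 * D)" by (rule avg_multc)
    finally show "1 / (1 + real (Suc k) * x) - 9 * real (Suc k) * \<epsilon> \<le> avg \<Omega> (\<lambda>C. dens (2*D) (slice C x))"
      using Dpos by simp
  qed
qed

lemma stree_pos: "stree \<epsilon> G k s P \<Longrightarrow> 0 \<le> \<epsilon> \<Longrightarrow> 0 < P"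
proof (induction rule: stree.induct)
  case (node k sA p sB q D)
  then have "0 < \<epsilon> * D" by linarith
  then show ?case using node.prems by (metis mult_pos_pos zero_less_mult_pos zero_less_numeral order_le_less mult_zero_left less_irrefl)
qed

lemma stree_family:
  "stree \<epsilon> G k s P \<Longrightarrow> 0 \<le> \<epsilon> \<Longrightarrow> \<epsilon> \<le> 1/8 \<Longrightarrow> \<exists>\<Omega>. family \<epsilon> G k s P \<Omega>"
proof (induction rule: stree.induct)
  case (leaf s P)
  then show ?case using family_leaf by blast
next
  case (node k sA p sB q D)
  then obtain \<Omega>A \<Omega>B where \<Omega>: "family \<epsilon> G k sA p \<Omega>A" "family \<epsilon> G k sB q \<Omega>B" by blast
  have pos: "0 < p" "0 < q" using node.hyps(1,2) node.prems(1) by (auto intro: stree_pos)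
  show ?case
    by (rule family_node[OF \<Omega> node.hyps(3-5) node.prems(2) pos node.prems(1)])
qed

subsection \<open>The planar sets and the maximal operator\<close>

text \<open>The right side is an intersection of half-planes containing the four vertices.
  Conversely, a point of it lies on the segment joining the points that divide the two vertical
  sides in the same ratio \<open>l\<close>.\<close>

lemma para_eq:
  "para n k = {(x, y). 0 \<le> x \<and> x \<le> 1 \<and> real k / 2 ^ n * x \<le> y \<and> y \<le> real k / 2 ^ n * x + 1 / 2 ^ n}"
  (is "_ = ?S")
proof
  define s d :: real where "s = real k / 2 ^ n" and "d = 1 / 2 ^ n"
  have d: "d > 0" by (simp add: d_def)
  have S: "?S = {(x, y). 0 \<le> x \<and> x \<le> 1 \<and> s * x \<le> y \<and> y \<le> s * x + d}"
    by (simp add: s_def d_def)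
  have para: "para n k = convex hull {(0, 0), (0, d), (1, s), (1, s + d)}"
    by (simp add: para_def s_def d_def add_divide_distrib)
  have "convex ?S"
  proof -
    have "?S = {z. (-1, 0) \<bullet> z \<le> 0} \<inter> {z. (1, 0) \<bullet> z \<le> 1} \<inter> {z. (s, -1) \<bullet> z \<le> 0} \<inter> {z. (-s, 1) \<bullet> z \<le> d}"
      unfolding S by (auto simp: inner_prod_def)
    then show ?thesis by (simp only:) (intro convex_Int convex_halfspace_le)
  qed
  then show "para n k \<subseteq> ?S"
    unfolding para S using d by (intro hull_minimal) auto
  show "?S \<subseteq> para n k"
  proof
    fix z assume "z \<in> ?S"
    then obtain x y where z: "z = (x, y)" and x: "0 \<le> x" "x \<le> 1" and y: "s * x \<le> y" "y \<le> s * x + d"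
      unfolding S by auto
    define l where "l = (y - s * x) / d"
    have l: "0 \<le> l" "l \<le> 1" using d y by (auto simp: l_def field_simps)
    have ld: "l * d = y - s * x" using d by (simp add: l_def)
    let ?H = "convex hull {(0, 0), (0, d), (1, s), (1, s + d)}"
    have mem: "v \<in> {(0, 0), (0, d), (1, s), (1, s + d)} \<Longrightarrow> v \<in> ?H" for v by (rule hull_inc)
    have "(1 - l) *\<^sub>R (0, 0) + l *\<^sub>R (0, d) \<in> ?H"
      by (rule convexD_alt[OF convex_convex_hull mem mem l]) auto
    moreover have "(1 - l) *\<^sub>R (1, s) + l *\<^sub>R (1, s + d) \<in> ?H"
      by (rule convexD_alt[OF convex_convex_hull mem mem l]) auto
    ultimately have "(1 - x) *\<^sub>R ((1 - l) *\<^sub>R (0, 0) + l *\<^sub>R (0, d)) + x *\<^sub>R ((1 - l) *\<^sub>R (1, s) + l *\<^sub>R (1, s + d)) \<in> ?H"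
      by (rule convexD_alt[OF convex_convex_hull _ _ x])
    also have "(1 - x) *\<^sub>R ((1 - l) *\<^sub>R (0, 0) + l *\<^sub>R (0, d)) + x *\<^sub>R ((1 - l) *\<^sub>R (1, s) + l *\<^sub>R (1, s + d))
      = (x, s * x + l * d)"
      by (simp add: algebra_simps)
    finally show "z \<in> para n k" unfolding para z ld by simp
  qed
qed

definition region :: "config \<Rightarrow> real set \<Rightarrow> plane set" where
  "region C I = {(x, y). x \<in> I \<and> y \<in> slice C x}"

lemma mem_region:
  "(x, y) \<in> region C I \<longleftrightarrow> x \<in> I \<and> (\<exists>a s t. (a, s, t) \<in> C \<and> a + s * x \<le> y \<and> y \<le> a + s * x + t)"
  by (fastforce simp: region_def slice_def)

lemma region_mono: "C \<subseteq> C' \<Longrightarrow> I \<subseteq> I' \<Longrightarrow> region C I \<subseteq> region C' I'"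
  by (auto simp: region_def slice_def)

lemma closed_region: assumes "finite C" "closed I" shows "closed (region C I)"
proof -
  have "region C I = (\<Union>(a, s, t)\<in>C. (fst -` I) \<inter> {z. a + s * fst z \<le> snd z} \<inter> {z. snd z \<le> a + s * fst z + t})"
    by (fastforce simp: region_def slice_def)
  moreover have "closed \<dots>"
    using assms by (intro closed_UN) (auto intro!: closed_Int closed_vimage_fst closed_Collect_le continuous_intros)
  ultimately show ?thesis by simp
qed

lemma borel_region: "finite C \<Longrightarrow> region C {u..v} \<in> sets borel"
  using closed_region[of C "{u..v}"] by (intro borel_closed) auto

lemma bounded_region: assumes "finite C" shows "bounded (region C {u..v})"
proof -
  have "region C {u..v} \<subseteq> (\<Union>(a, s, t)\<in>C. (\<lambda>(x, r). (x, a + s * x + r)) ` ({u..v} \<times> {0..t}))"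
  proof
    fix z assume "z \<in> region C {u..v}"
    then obtain x y a s t where "z = (x, y)" "x \<in> {u..v}" "(a, s, t) \<in> C" "a + s * x \<le> y" "y \<le> a + s * x + t"
      by (auto simp: region_def slice_def)
    then show "z \<in> (\<Union>(a, s, t)\<in>C. (\<lambda>(x, r). (x, a + s * x + r)) ` ({u..v} \<times> {0..t}))"
      by (intro UN_I[of "(a, s, t)"]) (auto intro!: image_eqI[of _ _ "(x, y - (a + s * x))"])
  qed
  moreover have "bounded (\<Union>(a, s, t)\<in>C. (\<lambda>(x, r). (x, a + s * x + r)) ` ({u..v} \<times> {0..t}))"
    using assms by (intro bounded_UN)
      (auto simp: split_beta intro!: compact_imp_bounded compact_continuous_image continuous_intros compact_Times)
  ultimately show ?thesis by (rule bounded_subset[rotated])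
qed

lemma emeasure_region:
  assumes "finite C"
  shows "emeasure lebesgue (region C {u..v}) = (\<integral>\<^sup>+x. ennreal (indicator {u..v} x * len (slice C x)) \<partial>lborel)"
proof -
  have b: "region C {u..v} \<in> sets borel" using assms by (rule borel_region)
  have "emeasure lebesgue (region C {u..v}) = emeasure (lborel :: plane measure) (region C {u..v})"
    using b by simp
  also have "\<dots> = emeasure (lborel \<Otimes>\<^sub>M lborel) (region C {u..v})"
    by (simp add: lborel_prod)
  also have "\<dots> = (\<integral>\<^sup>+x. emeasure lborel (Pair x -` region C {u..v}) \<partial>lborel)"
    using b by (intro lborel.emeasure_pair_measure_alt) (simp only: lborel_prod sets_lborel)
  also have "\<dots> = (\<integral>\<^sup>+x. ennreal (indicator {u..v} x * len (slice C x)) \<partial>lborel)"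
  proof (intro nn_integral_cong)
    fix x
    have "Pair x -` region C {u..v} = (if x \<in> {u..v} then slice C x else {})" by (auto simp: region_def)
    then show "emeasure lborel (Pair x -` region C {u..v}) = ennreal (indicator {u..v} x * len (slice C x))"
      using bounded_borel_fmeasurable[OF bounded_borel_slice[OF assms]] by (simp add: emeasure_eq_measure2)
  qed
  finally show ?thesis .
qed

lemma region_fmeasurable: "finite C \<Longrightarrow> region C {u..v} \<in> fmeasurable lebesgue"
  using bounded_region borel_region by (intro bounded_set_imp_lmeasurable) auto

lemma area_region:
  assumes "finite C"
  shows "integrable lborel (\<lambda>x. indicator {u..v} x * len (slice C x))"
    and "area (region C {u..v}) = (\<integral>x. indicator {u..v} x * len (slice C x) \<partial>lborel)"
proof -
  let ?f = "\<lambda>x. indicator {u..v} x * len (slice C x)"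
  have fin: "emeasure lebesgue (region C {u..v}) < \<infinity>"
    using region_fmeasurable[OF assms] by (simp only: fmeasurable_def mem_Collect_eq)
  have m: "?f \<in> borel_measurable lborel"
  proof -
    have "(\<lambda>x. emeasure lborel (Pair x -` region C {u..v})) \<in> borel_measurable lborel"
      by (intro lborel.measurable_emeasure_Pair) (simp only: lborel_prod sets_lborel borel_region assms)
    then have "(\<lambda>x. enn2real (emeasure lborel (Pair x -` region C {u..v}))) \<in> borel_measurable lborel"
      by measurable
    moreover have "enn2real (emeasure lborel (Pair x -` region C {u..v})) = ?f x" for x
    proof -
      have "Pair x -` region C {u..v} = (if x \<in> {u..v} then slice C x else {})" by (auto simp: region_def)
      then show ?thesis by (simp add: measure_def)
    qed
    ultimately show ?thesis by simp
  qed
  show i: "integrable lborel ?f"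
    using m fin unfolding emeasure_region[OF assms] by (intro integrableI_nonneg) auto
  have "ennreal (area (region C {u..v})) = emeasure lebesgue (region C {u..v})"
    using region_fmeasurable[OF assms] by (simp add: emeasure_eq_measure2)
  also have "\<dots> = ennreal (\<integral>x. ?f x \<partial>lborel)"
    unfolding emeasure_region[OF assms] using i by (intro nn_integral_eq_integral) auto
  finally show "area (region C {u..v}) = (\<integral>x. ?f x \<partial>lborel)" by simp
qed

lemma area_tube: assumes "u \<le> v" "0 \<le> t" shows "area (region {(a, s, t)} {u..v}) = (v - u) * t"
  using assms by (subst area_region(2)) (auto simp: slice_def)

section \<open>Powers on the extended half-line and the test of the maximal operator\<close>

lemma ennreal_rpow_mono: "0 < q \<Longrightarrow> a \<le> b \<Longrightarrow> ennreal_rpow a q \<le> ennreal_rpow b q"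
  unfolding ennreal_rpow_def
  by (auto simp: top_unique intro!: ennreal_leI powr_mono2 enn2real_mono simp: less_top)

lemma ennreal_rpow_ennreal: "0 \<le> x \<Longrightarrow> ennreal_rpow (ennreal x) q = ennreal (x powr q)"
  by (simp add: ennreal_rpow_def)

lemma ennreal_rpow_inverse: "0 < q \<Longrightarrow> ennreal_rpow (ennreal_rpow a (1 / q)) q = a"
  by (cases a) (auto simp: ennreal_rpow_def powr_powr)

text \<open>The factor 2 is the dilation that makes a parallelogram reach from \<open>x = -5/4\<close> to \<open>x = 1/2\<close>.\<close>

definition tube_ok :: "plane set set \<Rightarrow> real \<Rightarrow> real \<Rightarrow> bool" where
  "tube_ok B s t \<longleftrightarrow> 0 < t \<and> (\<exists>n k. para n k \<in> B \<and> s = real k / 2 ^ n \<and> 2 / 2 ^ n \<le> t)"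

lemma dilated_para:
  assumes "s = real k / 2 ^ n"
  shows "(\<lambda>y. (u, b + s * u) + 2 *\<^sub>R y) ` para n k = region {(b, s, 2 / 2 ^ n)} {u..u + 2}"
proof (intro set_eqI iffI)
  fix z assume "z \<in> (\<lambda>y. (u, b + s * u) + 2 *\<^sub>R y) ` para n k"
  then obtain x y where "z = (u + 2 * x, b + s * u + 2 * y)" "0 \<le> x" "x \<le> 1" "s * x \<le> y" "y \<le> s * x + 1 / 2 ^ n"
    unfolding para_eq assms[symmetric] by auto
  then show "z \<in> region {(b, s, 2 / 2 ^ n)} {u..u + 2}"
    by (auto simp: region_def slice_def algebra_simps)
next
  fix z assume "z \<in> region {(b, s, 2 / 2 ^ n)} {u..u + 2}"
  then obtain x y where z: "z = (x, y)" "u \<le> x" "x \<le> u + 2" "b + s * x \<le> y" "y \<le> b + s * x + 2 / 2 ^ n"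
    by (auto simp: region_def slice_def)
  show "z \<in> (\<lambda>y. (u, b + s * u) + 2 *\<^sub>R y) ` para n k"
  proof (rule image_eqI)
    show "z = (u, b + s * u) + 2 *\<^sub>R ((x - u) / 2, (y - b - s * u) / 2)" using z by (simp add: field_simps)
    show "((x - u) / 2, (y - b - s * u) / 2) \<in> para n k"
      unfolding para_eq assms[symmetric] using z by (auto simp: field_simps)
  qed
qed

text \<open>Inside a tube through \<open>z\<close>, prolonged to the left, lies a dilated
  parallelogram over the abscissae from -5/4 to 3/4 that contains \<open>z\<close>. Its part over
  \<open>{-5/4..-3/4}\<close> lies in the support of the test function and has a quarter of its
  area, so the average over it is at least \<open>c / 4\<close>.\<close>

lemma maximal_function_lower:
  assumes C: "finite C" "\<And>a s t. (a, s, t) \<in> C \<Longrightarrow> tube_ok B s t" and c: "0 \<le> c"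
    and z: "z \<in> region C {0..1/2}"
  shows "ennreal (c / 4) \<le> maximal_function B (\<lambda>x. c * indicator (region C {-5/4..-3/4}) x) z"
proof -
  define K where "K = region C {-5/4..-3/4}"
  obtain x0 y0 a s t where z0: "z = (x0, y0)" "0 \<le> x0" "x0 \<le> 1/2" "(a, s, t) \<in> C" "a + s * x0 \<le> y0" "y0 \<le> a + s * x0 + t"
    using z by (auto simp: region_def slice_def)
  obtain n k where nk: "para n k \<in> B" "s = real k / 2 ^ n" "2 / 2 ^ n \<le> t"
    using C(2)[OF z0(4)] by (auto simp: tube_ok_def)
  define w :: real where "w = 2 / 2 ^ n"
  have w: "0 < w" "w \<le> t" using nk by (auto simp: w_def)
  \<comment> \<open>The lowest position of a strip of width \<open>w\<close> inside the tube whose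
    upper edge still reaches \<open>z\<close>; the parallelogram may be thinner than the
    tube.\<close>
  define b where "b = max a (y0 - s * x0 - w)"
  have b: "a \<le> b" "b + w \<le> a + t" "b + s * x0 \<le> y0" "y0 \<le> b + s * x0 + w"
    using w z0 by (auto simp: b_def)
  define r where "r = region {(b, s, w)} {-5/4..-5/4 + 2}"
  define r' where "r' = region {(b, s, w)} {-5/4..-3/4}"
  have r: "r \<in> {r \<in> dilates B. z \<in> r}"
  proof -
    have "r = (\<lambda>y. (-5/4, b + s * (-5/4)) + 2 *\<^sub>R y) ` para n k"
      unfolding dilated_para[OF nk(2)] r_def w_def ..
    then have "r \<in> dilates B" unfolding dilates_def using nk(1) by force
    moreover have "z \<in> r" using z0 b unfolding r_def by (auto simp: region_def slice_def)
    ultimately show ?thesis by simp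
  qed
  have "r' \<subseteq> K"
  proof
    fix v assume "v \<in> r'"
    then obtain x y where v: "v = (x, y)" "x \<in> {-5/4..-3/4}" "b + s * x \<le> y" "y \<le> b + s * x + w"
      unfolding r'_def by (cases v) (auto simp: mem_region)
    then have "a + s * x \<le> y" "y \<le> a + s * x + t" using b by auto
    with v z0(4) show "v \<in> K" unfolding K_def by (auto simp: mem_region)
  qed
  then have sub: "r' \<subseteq> K \<inter> r"
    unfolding r'_def r_def using region_mono[of "{(b, s, w)}" "{(b, s, w)}" "{-5/4..-3/4}" "{-5/4..-5/4+2}"] by auto
  have em: "emeasure lebesgue r = ennreal (2 * w)" "emeasure lebesgue r' = ennreal (w / 2)"
    using region_fmeasurable[of "{(b, s, w)}"] w area_tube[of _ _ w b s]
    unfolding r_def r'_def by (auto simp: emeasure_eq_measure2)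
  have "ennreal c * emeasure lebesgue r' = (\<integral>\<^sup>+y. ennreal c * indicator r' y \<partial>lebesgue)"
    using region_fmeasurable[of "{(b, s, w)}"] unfolding r'_def
    by (subst nn_integral_cmult_indicator) (auto simp: fmeasurable_def)
  also have "\<dots> \<le> (\<integral>\<^sup>+y\<in>r. ennreal \<bar>c * indicator K y\<bar> \<partial>lebesgue)"
    using sub c by (intro nn_integral_mono) (auto split: split_indicator)
  finally have int: "ennreal c * ennreal (w / 2) \<le> (\<integral>\<^sup>+y\<in>r. ennreal \<bar>c * indicator K y\<bar> \<partial>lebesgue)"
    by (simp add: em)
  have "ennreal (c / 4) = ennreal c * ennreal (w / 2) / ennreal (2 * w)"
    using w c by (simp add: ennreal_mult[symmetric] divide_ennreal)
  also have "\<dots> \<le> (\<integral>\<^sup>+y\<in>r. ennreal \<bar>c * indicator K y\<bar> \<partial>lebesgue) / emeasure lebesgue r"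
    unfolding em by (intro divide_right_mono_ennreal int)
  also have "\<dots> \<le> maximal_function B (\<lambda>x. c * indicator K x) z"
    unfolding maximal_function_def using r by (rule SUP_upper)
  finally show ?thesis unfolding K_def .
qed

text \<open>The test function is the indicator of the left region \<open>K\<close>, scaled by
  \<open>c\<close> with \<open>c powr p * area K = 1\<close>. As the maximal function is at least
  \<open>c / 4\<close> on the right region \<open>E\<close>, the p-th power of the norm is at least
  \<open>(1/4) powr p * area E / area K\<close>.\<close>

lemma maximal_norm_lower:
  assumes C: "finite C" "C \<noteq> {}" "\<And>a s t. (a, s, t) \<in> C \<Longrightarrow> tube_ok B s t" and p: "1 < p"
    and l: "0 \<le> l" "l * area (region C {-5/4..-3/4}) \<le> area (region C {0..1/2})"
  shows "ennreal ((1/4) powr p * l) \<le> ennreal_rpow (maximal_norm p B) p"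
proof -
  define K E where "K = region C {-5/4..-3/4}" and "E = region C {0..1/2}"
  have fm: "K \<in> fmeasurable lebesgue" "E \<in> fmeasurable lebesgue"
    unfolding K_def E_def using C by (auto intro: region_fmeasurable)
  obtain a s t where ast: "(a, s, t) \<in> C" using C(2) by (metis all_not_in_conv prod_cases3)
  have t: "0 < t" using C(3)[OF ast] by (simp add: tube_ok_def)
  have "area (region {(a, s, t)} {-5/4..-3/4}) \<le> area K"
    using ast by (intro measure_mono_fmeasurable fm fmeasurableD region_fmeasurable)
      (simp_all add: K_def region_mono)
  then have K: "0 < area K" using t by (simp add: area_tube)
  define c where "c = area K powr (- (1 / p))"
  have "c powr p = area K powr (-1)" using p by (simp add: c_def powr_powr)
  then have c: "0 < c" "c powr p * area K = 1"
    using K by (simp_all add: c_def powr_minus)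
  define f where "f = (\<lambda>x. c * indicator K x :: real)"
  have fK: "f \<in> borel_measurable lebesgue" unfolding f_def using fm by (auto simp: fmeasurable_def)
  have "(\<integral>\<^sup>+x. ennreal_rpow (ennreal \<bar>f x\<bar>) p \<partial>lebesgue) = (\<integral>\<^sup>+x. ennreal (c powr p) * indicator K x \<partial>lebesgue)"
    using c p by (intro nn_integral_cong) (auto simp: f_def ennreal_rpow_ennreal split: split_indicator)
  also have "\<dots> = ennreal (c powr p) * emeasure lebesgue K"
    using fm by (subst nn_integral_cmult_indicator) (auto simp: fmeasurable_def)
  also have "\<dots> = 1" using c fm by (simp add: emeasure_eq_measure2 ennreal_mult[symmetric])
  finally have norm: "Lp_norm p (\<lambda>x. ennreal \<bar>f x\<bar>) = 1"
    unfolding Lp_norm_def using ennreal_rpow_ennreal[of 1 "1 / p"] by simp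
  have "ennreal ((c / 4) powr p) * emeasure lebesgue E = (\<integral>\<^sup>+x. ennreal ((c / 4) powr p) * indicator E x \<partial>lebesgue)"
    using fm by (subst nn_integral_cmult_indicator) (auto simp: fmeasurable_def)
  also have "\<dots> \<le> (\<integral>\<^sup>+x. ennreal_rpow (maximal_function B f x) p \<partial>lebesgue)"
  proof (intro nn_integral_mono)
    fix x
    have "ennreal_rpow (ennreal (c / 4)) p \<le> ennreal_rpow (maximal_function B f x) p" if "x \<in> E"
      unfolding f_def K_def
      by (intro ennreal_rpow_mono maximal_function_lower) (use C c p that in \<open>auto simp: E_def\<close>)
    then show "ennreal ((c / 4) powr p) * indicator E x \<le> ennreal_rpow (maximal_function B f x) p"
      using c by (auto simp: ennreal_rpow_ennreal split: split_indicator)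
  qed
  also have "\<dots> = ennreal_rpow (Lp_norm p (maximal_function B f)) p"
    unfolding Lp_norm_def using p by (subst ennreal_rpow_inverse) auto
  also have "\<dots> \<le> ennreal_rpow (maximal_norm p B) p"
    unfolding maximal_norm_def using fK norm p by (intro ennreal_rpow_mono SUP_upper) auto
  finally have "ennreal ((c / 4) powr p * area E) \<le> ennreal_rpow (maximal_norm p B) p"
    using fm by (simp add: emeasure_eq_measure2 ennreal_mult[symmetric])
  moreover have "(1/4) powr p * l \<le> (c / 4) powr p * area E"
  proof -
    have "(1/4) powr p * l = (1/4) powr p * c powr p * (l * area K)" using c by (simp add: algebra_simps)
    also have "\<dots> \<le> (1/4) powr p * c powr p * area E"
      using l unfolding K_def E_def by (intro mult_left_mono) auto
    also have "(1/4) powr p * c powr p = (c / 4) powr p" using c by (simp add: powr_mult[symmetric])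
    finally show ?thesis .
  qed
  ultimately show ?thesis by (meson ennreal_leI order_trans)
qed

subsection \<open>Choosing a configuration\<close>

lemma avg_area:
  assumes "\<And>C. C \<in> set \<Omega> \<Longrightarrow> finite C"
  shows "integrable lborel (\<lambda>x. indicator {u..v} x * avg \<Omega> (\<lambda>C. len (slice C x)))"
    and "avg \<Omega> (\<lambda>C. area (region C {u..v})) = (\<integral>x. indicator {u..v} x * avg \<Omega> (\<lambda>C. len (slice C x)) \<partial>lborel)"
proof -
  let ?I = "\<lambda>C x. indicator {u..v} x * len (slice C x)"
  have *: "integrable lborel (\<lambda>x. \<Sum>C\<leftarrow>\<Omega>. ?I C x) \<and> (\<Sum>C\<leftarrow>\<Omega>. area (region C {u..v})) = (\<integral>x. (\<Sum>C\<leftarrow>\<Omega>. ?I C x) \<partial>lborel)"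
    using assms
  proof (induction \<Omega>)
    case (Cons C \<Omega>)
    then show ?case using area_region[of C u v] by simp
  qed simp
  have eq: "indicator {u..v} x * avg \<Omega> (\<lambda>C. len (slice C x)) = (\<Sum>C\<leftarrow>\<Omega>. ?I C x) / real (length \<Omega>)" for x
    by (simp add: avg_def sum_list_const_mult)
  show "integrable lborel (\<lambda>x. indicator {u..v} x * avg \<Omega> (\<lambda>C. len (slice C x)))"
    unfolding eq using * by (intro integrable_divide) auto
  show "avg \<Omega> (\<lambda>C. area (region C {u..v})) = (\<integral>x. indicator {u..v} x * avg \<Omega> (\<lambda>C. len (slice C x)) \<partial>lborel)"
    unfolding eq using * by (simp add: avg_def)
qed

text \<open>First moments: with l = ln (1 + k/2), the mean left area is at most 9/4 P/k and the mean
  right area at least 3/4 l P/k. Since l/5 times 9/4 is only 9/20 l, the right area minus l/5 times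
  the left one has positive mean, and some configuration attains a positive value. Taking a
  difference avoids the mean of a quotient.\<close>

lemma family_good_config:
  assumes fam: "family \<epsilon> G k s P \<Omega>" and k: "4 \<le> k" and P: "0 < P" and \<epsilon>: "0 \<le> \<epsilon>" "18 * real k * real k * \<epsilon> \<le> 1"
  shows "\<exists>C. finite C \<and> C \<noteq> {} \<and> (\<forall>a \<sigma> t. (a, \<sigma>, t) \<in> C \<longrightarrow> G \<sigma> t) \<and>
    ln (1 + real k / 2) / 5 * area (region C {-5/4..-3/4}) \<le> area (region C {0..1/2})"
proof -
  define e where "e = 9 * real k * \<epsilon>"
  define l where "l = ln (1 + real k / 2)"
  have ke: "0 \<le> e" "real k * e \<le> 1/2" using \<epsilon> by (auto simp: e_def algebra_simps)
  \<comment> \<open>This is where \<open>4 \<le> k\<close> enters: 1 + k/2 \<ge> 3 exceeds Euler's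
    number. With \<open>l\<close> at least 1, the error \<open>e / 2\<close> is absorbed by a
    quarter of the main term.\<close>
  have l1: "1 \<le> l"
  proof -
    have "exp 1 \<le> (3::real)" by (rule exp_le)
    also have "\<dots> \<le> 1 + real k / 2" using k by simp
    finally show ?thesis unfolding l_def using k by (subst ln_ge_iff) auto
  qed
  have k0: "0 < real k" using k by simp
  note fin = familyD(2)[OF fam]
  have ind: "integrable lborel (indicator {-5/4..-3/4::real} :: real \<Rightarrow> real)"
    using borel_integrable_compact[of "{-5/4..-3/4::real}" "\<lambda>_. 1::real"] by simp
  have left: "avg \<Omega> (\<lambda>C. area (region C {-5/4..-3/4})) \<le> 9/4 * P / real k"
  proof -
    have "avg \<Omega> (\<lambda>C. area (region C {-5/4..-3/4})) = (\<integral>x. indicator {-5/4..-3/4} x * avg \<Omega> (\<lambda>C. len (slice C x)) \<partial>lborel)"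
      using fin by (rule avg_area(2))
    also have "\<dots> \<le> (\<integral>x. ((4 / (real k + 4) + e) * P) * indicator {-5/4..-3/4::real} x \<partial>lborel)"
      using familyD(5)[OF fam] unfolding e_def
      by (intro integral_mono avg_area(1) fin integrable_mult_right ind) (auto split: split_indicator)
    also have "\<dots> = (4 / (real k + 4) + e) * P / 2" by simp
    also have "\<dots> \<le> (9/2 / real k) * P / 2"
    proof -
      have "4 / (real k + 4) \<le> 4 / real k" using k0 by (intro divide_left_mono) auto
      moreover have "e \<le> 1/2 / real k" using ke k0 by (simp add: field_simps)
      ultimately have "4 / (real k + 4) + e \<le> 9/2 / real k" by (simp add: add_divide_distrib[symmetric])
      then show ?thesis using P by (intro divide_right_mono mult_right_mono) auto
    qed
    finally show ?thesis by simp
  qed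
  have right: "(l / real k - e / 2) * P \<le> avg \<Omega> (\<lambda>C. area (region C {0..1/2}))"
  proof -
    define g where "g = (\<lambda>x. (1 / (1 + real k * x) - e) * P)"
    define F where "F = (\<lambda>x. (ln (1 + real k * x) / real k - e * x) * P)"
    have F: "(F has_vector_derivative g x) (at x within {0..1/2})" if "x \<in> {0..1/2}" for x
    proof -
      have "0 < 1 + real k * x" using that k0 by (simp add: add_pos_nonneg)
      then have "(F has_real_derivative ((1 / (1 + real k * x) * real k) / real k - e) * P) (at x within {0..1/2})"
        unfolding F_def using k0 by (auto intro!: derivative_eq_intros)
      then have "(F has_real_derivative g x) (at x within {0..1/2})"
        using k0 by (simp add: g_def)
      then show ?thesis by (simp add: has_real_derivative_iff_has_vector_derivative)
    qed
    have contg: "continuous_on {0..1/2} g"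
    proof -
      have "1 + real k * x \<noteq> 0" if "x \<in> {0..1/2}" for x
        using that k0 by (smt (verit) atLeastAtMost_iff mult_nonneg_nonneg)
      then show ?thesis unfolding g_def by (intro continuous_intros) auto
    qed
    have gi: "integrable lborel (\<lambda>x. indicator {0..1/2} x * g x)"
      using borel_integrable_compact[OF _ contg] by simp
    have "(\<integral>x. indicator {0..1/2} x * g x \<partial>lborel) = F (1/2) - F 0"
      using integral_FTC_atLeastAtMost[of 0 "1/2" F g] F contg by simp
    then have "(l / real k - e / 2) * P = (\<integral>x. indicator {0..1/2} x * g x \<partial>lborel)"
      by (simp add: F_def l_def)
    also have "\<dots> \<le> (\<integral>x. indicator {0..1/2} x * avg \<Omega> (\<lambda>C. len (slice C x)) \<partial>lborel)"
    proof (intro integral_mono gi avg_area(1) fin)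
      fix x :: real
      have "g x \<le> avg \<Omega> (\<lambda>C. len (slice C x))" if x: "x \<in> {0..1/2}"
      proof -
        have "g x \<le> avg \<Omega> (\<lambda>C. dens P (slice C x)) * P"
          unfolding g_def e_def using familyD(6)[OF fam x] P by (intro mult_right_mono) auto
        also have "\<dots> = avg \<Omega> (\<lambda>C. dens P (slice C x) * P)" by (rule avg_multc[symmetric])
        also have "\<dots> \<le> avg \<Omega> (\<lambda>C. len (slice C x))"
        proof (rule avg_mono)
          fix C assume C: "C \<in> set \<Omega>"
          have b: "bounded_borel (slice C x)" using fin C by (intro bounded_borel_slice)
          have "dens P (shift (- (s * x)) (slice C x)) * P \<le> len (shift (- (s * x)) (slice C x))"
            using familyD(4)[OF fam C, of x] x b P by (intro dens_le_len bounded_borel_shift) auto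
          then show "dens P (slice C x) * P \<le> len (slice C x)" using b P by (simp add: bounded_borel_borel)
        qed
        finally show ?thesis .
      qed
      then show "indicator {0..1/2} x * g x \<le> indicator {0..1/2} x * avg \<Omega> (\<lambda>C. len (slice C x))"
        by (simp split: split_indicator)
    qed
    also have "\<dots> = avg \<Omega> (\<lambda>C. area (region C {0..1/2}))"
      using fin by (rule avg_area(2)[symmetric])
    finally show ?thesis .
  qed
  have "0 < (l / real k - e / 2) * P - l / 5 * (9/4 * P / real k)"
  proof -
    have "e / 2 \<le> 1/4 / real k" using ke k0 by (simp add: field_simps)
    also have "\<dots> \<le> l / 4 / real k" using l1 k0 by (intro divide_right_mono) auto
    finally have "l / real k * (3/4) \<le> l / real k - e / 2" by (simp add: field_simps)
    then have "l / real k * (3/4) * P \<le> (l / real k - e / 2) * P" using P by (intro mult_right_mono) auto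
    moreover have "l / 5 * (9/4 * P / real k) = l / real k * (9/20) * P" by simp
    moreover have "0 < l / real k * (3/10) * P" using l1 k0 P by simp
    ultimately show ?thesis by (simp add: algebra_simps)
  qed
  also have "\<dots> \<le> avg \<Omega> (\<lambda>C. area (region C {0..1/2})) - l / 5 * avg \<Omega> (\<lambda>C. area (region C {-5/4..-3/4}))"
    using left right l1 by (intro diff_mono mult_left_mono) auto
  also have "\<dots> = avg \<Omega> (\<lambda>C. area (region C {0..1/2}) - l / 5 * area (region C {-5/4..-3/4}))"
    by (simp only: avg_diff avg_cmult)
  finally have pos: "0 < avg \<Omega> (\<lambda>C. area (region C {0..1/2}) - l / 5 * area (region C {-5/4..-3/4}))" .
  have "\<exists>C\<in>set \<Omega>. 0 < area (region C {0..1/2}) - l / 5 * area (region C {-5/4..-3/4})"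
  proof (rule ccontr)
    assume "\<not> ?thesis"
    then have "avg \<Omega> (\<lambda>C. area (region C {0..1/2}) - l / 5 * area (region C {-5/4..-3/4})) \<le> avg \<Omega> (\<lambda>_. 0)"
      by (intro avg_mono) (auto simp: not_less)
    then show False using pos by (simp add: avg_def)
  qed
  then obtain C where C: "C \<in> set \<Omega>" "0 < area (region C {0..1/2}) - l / 5 * area (region C {-5/4..-3/4})" by blast
  have "C \<noteq> {}" using C(2) by (auto simp: region_def slice_def)
  then show ?thesis using C fin familyD(3)[OF fam C(1)] unfolding l_def by (intro exI[of _ C]) auto
qed

lemma stree_maximal_norm:
  assumes st: "stree \<epsilon> (tube_ok B) k s P" and k: "4 \<le> k" and \<epsilon>: "0 \<le> \<epsilon>" "18 * real k * real k * \<epsilon> \<le> 1" and p: "1 < p"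
  shows "ennreal ((1/4) powr p * (ln (1 + real k / 2) / 5)) \<le> ennreal_rpow (maximal_norm p B) p"
proof -
  have "18 * 4 * 4 * \<epsilon> \<le> 18 * real k * real k * \<epsilon>" using k \<epsilon> by (intro mult_right_mono mult_mono mult_nonneg_nonneg) auto
  then have "\<epsilon> \<le> 1/8" using \<epsilon> by linarith
  then obtain \<Omega> where "family \<epsilon> (tube_ok B) k s P \<Omega>" using stree_family[OF st \<epsilon>(1)] by blast
  then obtain C where C: "finite C" "C \<noteq> {}" "\<forall>a \<sigma> t. (a, \<sigma>, t) \<in> C \<longrightarrow> tube_ok B \<sigma> t"
    "ln (1 + real k / 2) / 5 * area (region C {-5/4..-3/4}) \<le> area (region C {0..1/2})"
    using family_good_config[OF _ k stree_pos[OF st \<epsilon>(1)] \<epsilon>] by metis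
  show ?thesis by (rule maximal_norm_lower) (use C p in auto)
qed

text \<open>A single tube has equal areas over the two ranges of abscissae, both of length 1/2. This
  settles the scales that are too small for the recursion.\<close>

lemma maximal_norm_lower_trivial:
  assumes B: "B \<noteq> {}" "B \<subseteq> paras" and p: "1 < p"
  shows "ennreal ((1/4) powr p) \<le> ennreal_rpow (maximal_norm p B) p"
proof -
  obtain u where u: "u \<in> B" "u \<in> paras" using B by blast
  then obtain n k where nk: "para n k \<in> B" unfolding paras_def by blast
  let ?C = "{(0, real k / 2 ^ n, 2 / 2 ^ n :: real)}"
  have "ennreal ((1/4) powr p * 1) \<le> ennreal_rpow (maximal_norm p B) p"
  proof (rule maximal_norm_lower)
    show "tube_ok B s t" if "(a, s, t) \<in> ?C" for a s t
      using that nk unfolding tube_ok_def by auto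
    show "1 * area (region ?C {-5/4..-3/4}) \<le> area (region ?C {0..1/2})" by (simp add: area_tube)
  qed (use p in auto)
  then show ?thesis by simp
qed

subsection \<open>The binary tree of parallelograms\<close>

lemma area_para: "area (para n k) = 1 / 2 ^ n"
proof -
  have "para n k = region {(0, real k / 2 ^ n, 1 / 2 ^ n)} {0..1}"
    unfolding para_eq by (auto simp: mem_region)
  then show ?thesis by (simp add: area_tube)
qed

lemma para_ends: "(1, real k / 2 ^ n) \<in> para n k" "(1, real k / 2 ^ n + 1 / 2 ^ n) \<in> para n k"
  "(0, 1 / 2 ^ n) \<in> para n k"
  by (auto simp: para_eq)

text \<open>Comparing the sides at abscissa 0 orders the levels; comparing those at abscissa 1 is
  inclusion of dyadic intervals. As both edges are affine, these two conditions imply inclusion in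
  between.\<close>

lemma para_subset_iff: "para n k \<subseteq> para m j \<longleftrightarrow> m \<le> n \<and> k div 2 ^ (n - m) = j"
proof
  assume sub: "para n k \<subseteq> para m j"
  have "(0, 1 / 2 ^ n) \<in> para m j" using sub para_ends by blast
  then have "(1::real) / 2 ^ n \<le> 1 / 2 ^ m" by (simp add: para_eq)
  then have mn: "m \<le> n" by (simp add: field_simps)
  define d where "d = n - m"
  have n: "n = m + d" using mn by (simp add: d_def)
  have "(1, real k / 2 ^ n) \<in> para m j" "(1, real k / 2 ^ n + 1 / 2 ^ n) \<in> para m j"
    using sub para_ends by blast+
  then have "real j / 2 ^ m \<le> real k / 2 ^ n" "real k / 2 ^ n + 1 / 2 ^ n \<le> real j / 2 ^ m + 1 / 2 ^ m"
    by (auto simp: para_eq)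
  then have "real j / 2 ^ m \<le> real k / (2 ^ m * 2 ^ d)" "(real k + 1) / (2 ^ m * 2 ^ d) \<le> (real j + 1) / 2 ^ m"
    unfolding n power_add by (simp_all add: add_divide_distrib)
  then have "real j * 2 ^ d \<le> real k" "real k + 1 \<le> (real j + 1) * 2 ^ d"
    by (simp_all add: pos_divide_le_eq pos_le_divide_eq)
  then have "real (j * 2 ^ d) \<le> real k" "real (k + 1) \<le> real ((j + 1) * 2 ^ d)"
    by (simp_all only: of_nat_add of_nat_mult of_nat_power of_nat_1 of_nat_numeral)
  then have "j * 2 ^ d \<le> k" "k + 1 \<le> (j + 1) * 2 ^ d" by (simp_all only: of_nat_le_iff)
  then have "k div 2 ^ d = j" by (intro div_nat_eqI) (auto simp: algebra_simps)
  then show "m \<le> n \<and> k div 2 ^ (n - m) = j" using mn by (simp add: d_def)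
next
  assume a: "m \<le> n \<and> k div 2 ^ (n - m) = j"
  define d where "d = n - m"
  have n: "n = m + d" using a by (simp add: d_def)
  have "j * 2 ^ d \<le> k" "k < (j + 1) * 2 ^ d"
    using a div_times_less_eq_dividend[of k "2 ^ d"] dividend_less_div_times[of "2 ^ d" k]
    by (auto simp: d_def algebra_simps)
  then have "real (j * 2 ^ d) \<le> real k" "real (k + 1) \<le> real ((j + 1) * 2 ^ d)"
    by (simp_all only: of_nat_le_iff)
  then have "real j * 2 ^ d \<le> real k" "real k + 1 \<le> (real j + 1) * 2 ^ d"
    by (simp_all only: of_nat_add of_nat_mult of_nat_power of_nat_1 of_nat_numeral)
  then have "real j / 2 ^ m \<le> real k / (2 ^ m * 2 ^ d)" "(real k + 1) / (2 ^ m * 2 ^ d) \<le> (real j + 1) / 2 ^ m"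
    by (simp_all add: pos_divide_le_eq pos_le_divide_eq)
  then have l: "real j / 2 ^ m \<le> real k / 2 ^ n" and r: "real k / 2 ^ n + 1 / 2 ^ n \<le> real j / 2 ^ m + 1 / 2 ^ m"
    unfolding n power_add by (simp_all add: add_divide_distrib)
  have p: "(1::real) / 2 ^ n \<le> 1 / 2 ^ m" using a by (simp add: field_simps)
  show "para n k \<subseteq> para m j"
  proof
    fix z assume "z \<in> para n k"
    then obtain x y where z: "z = (x, y)" "0 \<le> x" "x \<le> 1" "real k / 2 ^ n * x \<le> y" "y \<le> real k / 2 ^ n * x + 1 / 2 ^ n"
      by (auto simp: para_eq)
    have "real j / 2 ^ m * x \<le> real k / 2 ^ n * x" using l z by (intro mult_right_mono)
    moreover have "real k / 2 ^ n * x + 1 / 2 ^ n \<le> real j / 2 ^ m * x + 1 / 2 ^ m"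
    proof -
      have "(real k / 2 ^ n - real j / 2 ^ m) * x \<le> (1 / 2 ^ m - 1 / 2 ^ n) * x"
        using r z by (intro mult_right_mono) auto
      also have "\<dots> \<le> (1 / 2 ^ m - 1 / 2 ^ n) * 1" using p z by (intro mult_left_mono) auto
      finally show ?thesis by (simp add: algebra_simps)
    qed
    ultimately show "z \<in> para m j" using z by (auto simp: para_eq)
  qed
qed

lemma para_eq_iff [simp]: "para n k = para m j \<longleftrightarrow> n = m \<and> k = j"
proof
  assume "para n k = para m j"
  then have "para n k \<subseteq> para m j" "para m j \<subseteq> para n k" by auto
  then show "n = m \<and> k = j" unfolding para_subset_iff by auto
qed auto

text \<open>Coordinates in the binary tree, well defined on parallelograms by
  \<open>para_eq_iff\<close>. For \<open>m\<close> at most \<open>lev u\<close>,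
  \<open>up u m\<close> is the ancestor of \<open>u\<close> at level \<open>m\<close>.\<close>

definition lev :: "plane set \<Rightarrow> nat" where "lev u = (THE n. \<exists>k. u = para n k)"
definition pos :: "plane set \<Rightarrow> nat" where "pos u = (THE k. u = para (lev u) k)"
definition lo :: "plane set \<Rightarrow> plane set" where "lo u = para (Suc (lev u)) (2 * pos u)"
definition hi :: "plane set \<Rightarrow> plane set" where "hi u = para (Suc (lev u)) (2 * pos u + 1)"
definition up :: "plane set \<Rightarrow> nat \<Rightarrow> plane set" where "up u m = para m (pos u div 2 ^ (lev u - m))"

lemma lev_para [simp]: "lev (para n k) = n" by (auto simp: lev_def)
lemma pos_para [simp]: "pos (para n k) = k" by (auto simp: pos_def)

lemma mem_paras [simp]: "para n k \<in> paras \<longleftrightarrow> k < 2 ^ n"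
proof -
  have "(1::nat) \<le> 2 ^ n" by simp
  then have "k \<le> 2 ^ n - 1 \<longleftrightarrow> k < 2 ^ n" by linarith
  then show ?thesis unfolding paras_def mem_Collect_eq para_eq_iff by blast
qed

lemma parasE: assumes "u \<in> paras" obtains "u = para (lev u) (pos u)" "pos u < 2 ^ lev u"
proof -
  obtain n k where "u = para n k" using assms by (auto simp: paras_def)
  then show ?thesis using assms that by auto
qed

lemma paras_subset_iff:
  assumes "u \<in> paras" "v \<in> paras"
  shows "u \<subseteq> v \<longleftrightarrow> lev v \<le> lev u \<and> pos u div 2 ^ (lev u - lev v) = pos v"
proof -
  have "u = para (lev u) (pos u)" "v = para (lev v) (pos v)" using assms by (auto elim: parasE)
  then show ?thesis by (metis para_subset_iff)
qed

lemma paras_eqI: "u \<in> paras \<Longrightarrow> v \<in> paras \<Longrightarrow> lev u = lev v \<Longrightarrow> pos u = pos v \<Longrightarrow> u = v"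
  by (metis parasE)

lemma lev_mono: "u \<in> paras \<Longrightarrow> v \<in> paras \<Longrightarrow> u \<subseteq> v \<Longrightarrow> lev v \<le> lev u"
  by (simp add: paras_subset_iff)

lemma up_paras: assumes "u \<in> paras" "m \<le> lev u" shows "up u m \<in> paras" "lev (up u m) = m" "u \<subseteq> up u m"
proof -
  have k: "pos u < 2 ^ lev u" using assms by (auto elim: parasE)
  have "(2::nat) ^ lev u = 2 ^ m * 2 ^ (lev u - m)" using assms by (simp add: power_add[symmetric])
  then have "pos u div 2 ^ (lev u - m) < 2 ^ m" using k by (simp add: less_mult_imp_div_less)
  then show P: "up u m \<in> paras" "lev (up u m) = m" by (auto simp: up_def)
  show "u \<subseteq> up u m" using P assms by (subst paras_subset_iff) (auto simp: up_def)
qed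

lemma up_unique: assumes "u \<in> paras" "w \<in> paras" "u \<subseteq> w" shows "w = up u (lev w)"
proof (rule paras_eqI)
  have l: "lev w \<le> lev u" using assms by (intro lev_mono)
  show "up u (lev w) \<in> paras" "lev w = lev (up u (lev w))" using up_paras[OF assms(1) l] by auto
  show "pos w = pos (up u (lev w))" using assms by (simp add: paras_subset_iff up_def)
qed (use assms in auto)

text \<open>\<open>u\<close> has exactly one ancestor at each level, so its ancestors form a chain
  ordered by level.\<close>

lemma nested:
  assumes "u \<in> paras" "v \<in> paras" "w \<in> paras" "u \<subseteq> v" "u \<subseteq> w" "lev v \<le> lev w" shows "w \<subseteq> v"
proof -
  have l: "lev w \<le> lev u" "lev v \<le> lev u" using assms by (auto intro: lev_mono)
  have "w = para (lev w) (pos u div 2 ^ (lev u - lev w))" "v = para (lev v) (pos u div 2 ^ (lev u - lev v))"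
    using up_unique assms unfolding up_def by blast+
  moreover have "pos u div 2 ^ (lev u - lev w) div 2 ^ (lev w - lev v) = pos u div 2 ^ (lev u - lev v)"
    using l assms by (simp add: div_mult2_eq[symmetric] power_add[symmetric])
  ultimately show ?thesis using assms(6) para_subset_iff by metis
qed

lemma same_lev: "u \<in> paras \<Longrightarrow> v \<in> paras \<Longrightarrow> u \<subseteq> v \<Longrightarrow> lev u = lev v \<Longrightarrow> u = v"
  using nested[of u v u] nested[of u u v] by auto

lemma area_lev: "u \<in> paras \<Longrightarrow> area u = 1 / 2 ^ lev u"
  by (metis area_para parasE)

lemma half_area_iff: "u \<in> paras \<Longrightarrow> v \<in> paras \<Longrightarrow> 2 * area u = area v \<longleftrightarrow> lev u = Suc (lev v)"
proof -
  assume "u \<in> paras" "v \<in> paras"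
  then have "2 * area u = area v \<longleftrightarrow> (2::real) ^ lev u = 2 ^ Suc (lev v)"
    by (auto simp: area_lev field_simps)
  also have "\<dots> \<longleftrightarrow> lev u = Suc (lev v)" by (intro power_inject_exp) simp
  finally show ?thesis by auto
qed

lemma is_child_iff: "is_child u v \<longleftrightarrow> u \<in> paras \<and> v \<in> paras \<and> u \<subseteq> v \<and> lev u = Suc (lev v)"
  unfolding is_child_def using half_area_iff by blast

lemma lo_hi:
  assumes "v \<in> paras"
  shows "lo v \<in> paras" "hi v \<in> paras" "lev (lo v) = Suc (lev v)" "lev (hi v) = Suc (lev v)"
    "lo v \<subseteq> v" "hi v \<subseteq> v" "lo v \<noteq> hi v"
proof -
  have "pos v < 2 ^ lev v" using assms by (auto elim: parasE)
  then show P: "lo v \<in> paras" "hi v \<in> paras" by (auto simp: lo_def hi_def)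
  show "lev (lo v) = Suc (lev v)" "lev (hi v) = Suc (lev v)" "lo v \<noteq> hi v"
    by (auto simp: lo_def hi_def)
  show "lo v \<subseteq> v" "hi v \<subseteq> v" using P assms by (auto simp: paras_subset_iff lo_def hi_def)
qed

lemma child_cases: assumes "is_child u v" shows "u = lo v \<or> u = hi v"
proof -
  have u: "u \<in> paras" "v \<in> paras" "lev u = Suc (lev v)" "pos u div 2 = pos v"
    using assms by (auto simp: is_child_iff paras_subset_iff)
  then have "pos u = 2 * pos v \<or> pos u = 2 * pos v + 1" by linarith
  then show ?thesis
    using paras_eqI[OF u(1) lo_hi(1)[OF u(2)]] paras_eqI[OF u(1) lo_hi(2)[OF u(2)]] u(3)
    by (auto simp: lo_def hi_def)
qed

lemma proper_subset_child:
  assumes "u \<in> paras" "v \<in> paras" "u \<subseteq> v" "u \<noteq> v"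
  shows "u \<subseteq> lo v \<or> u \<subseteq> hi v"
proof -
  have "lev v < lev u" using assms same_lev lev_mono[of u v] by fastforce
  then have l: "Suc (lev v) \<le> lev u" by simp
  note w = up_paras[OF assms(1) l]
  have "up u (Suc (lev v)) \<subseteq> v" using nested[OF assms(1,2) w(1)] assms w by auto
  then have "is_child (up u (Suc (lev v))) v" using w assms by (simp add: is_child_iff)
  then show ?thesis using child_cases w(3) by metis
qed

lemma not_below_both: assumes "u \<in> paras" "v \<in> paras" "u \<subseteq> lo v" "u \<subseteq> hi v" shows False
proof -
  note c = lo_hi[OF assms(2)]
  have "hi v \<subseteq> lo v" using nested[of u "lo v" "hi v"] assms c by auto
  then show False using same_lev c by metis
qed

lemma lo_hi_is_child: "v \<in> paras \<Longrightarrow> is_child (lo v) v" "v \<in> paras \<Longrightarrow> is_child (hi v) v"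
  by (auto simp: is_child_iff lo_hi)

lemma child_parent_unique:
  assumes "is_child u v" "is_child u w" shows "v = w"
  using assms same_lev nested[of u v w] unfolding is_child_iff by auto

subsection \<open>Trees\<close>

text \<open>The order-theoretic content of \<open>is_tree\<close>: a top element, and closure under
  the elements between a member and the top. In this form the part below a vertex is visibly a tree
  again.\<close>

locale tree =
  fixes T :: "plane set set" and r :: "plane set"
  assumes sub: "T \<subseteq> paras" and root: "r \<in> T" "\<And>u. u \<in> T \<Longrightarrow> u \<subseteq> r"
    and upward: "\<And>u w. u \<in> T \<Longrightarrow> w \<in> paras \<Longrightarrow> u \<subseteq> w \<Longrightarrow> w \<subseteq> r \<Longrightarrow> w \<in> T"

text \<open>Minimal area means greatest level. The common ancestors of \<open>B\<close> form a chain
  whose levels are bounded by that of any member of \<open>B\<close>, so one of greatest level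
  exists and lies inside all the others.\<close>

lemma tree_root_props:
  assumes "B \<noteq> {}" "B \<subseteq> paras"
  shows "tree_root B \<in> paras" "\<And>u. u \<in> B \<Longrightarrow> u \<subseteq> tree_root B"
    "\<And>w. w \<in> paras \<Longrightarrow> (\<And>u. u \<in> B \<Longrightarrow> u \<subseteq> w) \<Longrightarrow> tree_root B \<subseteq> w"
proof -
  obtain b where b: "b \<in> B" "b \<in> paras" using assms by blast
  define A where "A = {w \<in> paras. \<forall>u\<in>B. u \<subseteq> w}"
  have A: "w \<in> A \<longleftrightarrow> w \<in> paras \<and> (\<forall>u\<in>B. u \<subseteq> w)" for w by (simp add: A_def)
  have top: "para 0 0 \<in> A"
  proof -
    have "u \<subseteq> para 0 0" if "u \<in> B" for u
    proof -
      have "u \<in> paras" using that assms by blast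
      then show ?thesis by (subst paras_subset_iff) (auto elim: parasE)
    qed
    then show ?thesis by (simp add: A)
  qed
  have lb: "\<forall>w. w \<in> A \<longrightarrow> lev w < Suc (lev b)" using lev_mono[OF b(2)] b(1) by (simp add: A less_Suc_eq_le)
  have "\<exists>r. r \<in> A \<and> (\<forall>w. w \<in> A \<longrightarrow> lev w \<le> lev r)"
    by (rule ex_has_greatest_nat[OF top lb])
  then obtain r where r: "r \<in> A" and max: "\<And>w. w \<in> A \<Longrightarrow> lev w \<le> lev r" by auto
  have least: "r \<subseteq> w" if "w \<in> A" for w
  proof (rule nested[OF b(2)])
    show "w \<in> paras" "r \<in> paras" "b \<subseteq> w" "b \<subseteq> r" using that r b by (simp_all add: A)
    show "lev w \<le> lev r" by (rule max[OF that])
  qed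
  have area_le: "area v \<le> area w \<longleftrightarrow> lev w \<le> lev v" if "v \<in> paras" "w \<in> paras" for v w
    using that by (simp add: area_lev field_simps)
  let ?Q = "\<lambda>r. r \<in> paras \<and> (\<forall>u\<in>B. u \<subseteq> r) \<and> (\<forall>w\<in>paras. (\<forall>u\<in>B. u \<subseteq> w) \<longrightarrow> area r \<le> area w)"
  have "?Q r" using r max area_le by (simp add: A)
  moreover have "s = r" if "?Q s" for s
  proof -
    have s: "s \<in> A" using that by (simp add: A)
    have p: "r \<in> paras" "s \<in> paras" using r s by (simp_all add: A)
    have "area s \<le> area r" using that r by (simp add: A)
    then have "lev r = lev s" using max[OF s] area_le[OF p(2,1)] by simp
    then show "s = r" using same_lev[OF p least[OF s]] by simp
  qed
  ultimately have "tree_root B = r" unfolding tree_root_def by (rule the_equality)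
  then show "tree_root B \<in> paras" "\<And>u. u \<in> B \<Longrightarrow> u \<subseteq> tree_root B"
    "\<And>w. w \<in> paras \<Longrightarrow> (\<And>u. u \<in> B \<Longrightarrow> u \<subseteq> w) \<Longrightarrow> tree_root B \<subseteq> w"
    using r least by (simp_all add: A)
qed

lemma tree_tree_of: assumes "B \<noteq> {}" "B \<subseteq> paras" shows "tree (tree_of B) (tree_root B)"
proof
  note R = tree_root_props[OF assms]
  show "tree_of B \<subseteq> paras" by (auto simp: tree_of_def)
  show "tree_root B \<in> tree_of B" using R assms by (auto simp: tree_of_def)
  show "u \<subseteq> tree_root B" if "u \<in> tree_of B" for u using that by (auto simp: tree_of_def)
  show "w \<in> tree_of B" if "u \<in> tree_of B" "w \<in> paras" "u \<subseteq> w" "w \<subseteq> tree_root B" for u w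
    using that unfolding tree_of_def by blast
qed

context tree
begin

lemma r_paras: "r \<in> paras" using root sub by blast

lemma is_tree: "is_tree T"
proof -
  have ne: "T \<noteq> {}" using root by blast
  note R = tree_root_props[OF ne sub]
  have "tree_root T = r" using R(2)[OF root(1)] R(3)[OF r_paras root(2)] by (intro equalityI)
  then have "T = tree_of T"
    unfolding tree_of_def
  proof (intro equalityI subsetI, goal_cases)
    case (1 u)
    then show ?case using sub root(2) by auto
  next
    case (2 u)
    then obtain v where "v \<in> T" "v \<subseteq> u" "u \<in> paras" "u \<subseteq> r" by auto
    then show ?case using upward by metis
  qed
  then show ?thesis unfolding is_tree_def using ne sub by blast
qed

definition "leaves = {l \<in> T. lo l \<notin> T \<and> hi l \<notin> T}"
definition "splits = {w \<in> T. lo w \<in> T \<and> hi w \<in> T}"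
definition "anc l = {w \<in> T. l \<subseteq> w}"

lemma child_in:
  assumes "l \<in> T" "v \<in> T" "l \<subseteq> v" "l \<noteq> v"
  shows "l \<subseteq> lo v \<and> lo v \<in> T \<or> l \<subseteq> hi v \<and> hi v \<in> T"
proof -
  have p: "l \<in> paras" "v \<in> paras" using assms sub by auto
  have "lo v \<subseteq> r" "hi v \<subseteq> r" using lo_hi[OF p(2)] root(2)[OF assms(2)] by auto
  then show ?thesis using proper_subset_child[OF p assms(3,4)] upward[OF assms(1)] lo_hi[OF p(2)] by blast
qed

lemma leaf_below: "l \<in> leaves \<Longrightarrow> u \<in> T \<Longrightarrow> u \<subseteq> l \<Longrightarrow> u = l"
  using child_in[of u l] unfolding leaves_def by blast

lemma leaves_T: "l \<in> leaves \<Longrightarrow> l \<in> T" by (simp add: leaves_def)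

lemma anc_path: assumes "l \<in> T" shows "is_path (anc l)"
proof -
  have l: "l \<in> paras" using assms sub by (rule subsetD[rotated])
  have l: "l \<in> paras" "lev r \<le> lev l" using l lev_mono[OF l r_paras root(2)[OF assms]] by auto
  define N where "N = lev l - lev r"
  define u where "u i = up l (lev r + i)" for i
  have u: "u i \<in> paras" "lev (u i) = lev r + i" "l \<subseteq> u i" if "i \<le> N" for i
    using up_paras[OF l(1), of "lev r + i"] that l by (auto simp: u_def N_def)
  have "anc l = u ` {..N}"
  proof (intro set_eqI iffI)
    fix w assume "w \<in> anc l"
    then have w: "w \<in> T" "w \<in> paras" "l \<subseteq> w" "lev r \<le> lev w" "lev w \<le> lev l"
      using sub root r_paras lev_mono l by (auto simp: anc_def)
    then have "w = u (lev w - lev r)" using up_unique[OF l(1) w(2,3)] by (simp add: u_def)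
    then show "w \<in> u ` {..N}" using w by (auto simp: N_def)
  next
    fix w assume "w \<in> u ` {..N}"
    then obtain i where i: "i \<le> N" "w = u i" by auto
    have "u i \<subseteq> r" using nested[OF l(1) r_paras u(1)] u i root(2)[OF assms] by auto
    then show "w \<in> anc l" unfolding anc_def using upward[OF assms] u i by auto
  qed
  moreover have "is_child (u (Suc i)) (u i)" if "i < N" for i
    using u[of i] u[of "Suc i"] nested[of l "u i" "u (Suc i)"] that l by (auto simp: is_child_iff)
  ultimately show ?thesis using sub unfolding is_path_def anc_def by blast
qed

end

section \<open>Paths, boundary and splitting numbers of a finite tree\<close>

lemma path_chain:
  assumes "\<And>i. i < N \<Longrightarrow> is_child (u (Suc i)) (u i)" "i \<le> j" "j \<le> N"
  shows "u j \<subseteq> u i \<and> lev (u j) = lev (u i) + (j - i)"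
  using assms(2,3)
proof (induction j rule: dec_induct)
  case (step j)
  then have "is_child (u (Suc j)) (u j)" using assms(1) by simp
  then show ?case using step by (auto simp: is_child_iff)
qed simp

lemma path_comparable:
  assumes "is_path P" "x \<in> P" "y \<in> P" shows "x \<subseteq> y \<or> y \<subseteq> x"
proof -
  obtain u i j N where u: "\<And>i. i < N \<Longrightarrow> is_child (u (Suc i)) (u i)" "x = u i" "y = u j" "i \<le> N" "j \<le> N"
  proof -
    from assms(1) consider (fin) u N where "P = u ` {..N}" "\<And>i. i < N \<Longrightarrow> is_child (u (Suc i)) (u i)"
      | (inf) u where "P = range u" "\<And>i. is_child (u (Suc i)) (u i)"
      unfolding is_path_def by blast
    then show thesis
    proof cases
      case fin then show ?thesis using that[of N u] assms(2,3) by auto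
    next
      case inf
      then obtain i j where "x = u i" "y = u j" using assms(2,3) by auto
      then show ?thesis using that[of "max i j" u i j] inf by auto
    qed
  qed
  then show ?thesis using path_chain[of N u i j] path_chain[of N u j i] by (cases "i \<le> j") auto
qed

lemma path_finite:
  assumes "is_path P" "P \<subseteq> F" "finite F"
  obtains z where "z \<in> P" "\<And>x. x \<in> P \<Longrightarrow> z \<subseteq> x"
proof -
  from assms(1) consider (fin) u N where "P = u ` {..N}" "\<And>i. i < N \<Longrightarrow> is_child (u (Suc i)) (u i)"
    | (inf) u where "P = range u" "\<And>i. is_child (u (Suc i)) (u i)"
    unfolding is_path_def by blast
  then show thesis
  proof cases
    case fin
    then show ?thesis using path_chain[of N u _ N] by (intro that[of "u N"]) auto
  next
    case inf
    have "lev (u i) = lev (u 0) + i" for i using path_chain[of i u 0 i] inf by auto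
    then have "inj u" by (intro injI) (metis add_left_cancel)
    then have "infinite P" using inf range_inj_infinite by blast
    then show ?thesis using assms finite_subset by blast
  qed
qed

locale finite_tree = tree +
  assumes fin: "finite T"
begin

lemma leaf_exists: assumes "v \<in> T" obtains l where "l \<in> leaves" "l \<subseteq> v"
proof -
  let ?S = "{u \<in> T. u \<subseteq> v}"
  have "finite ?S" "v \<in> ?S" using fin assms by auto
  then have "Max (lev ` ?S) \<in> lev ` ?S" by (intro Max_in) auto
  then obtain l where l: "l \<in> ?S" "lev l = Max (lev ` ?S)" by auto
  have max: "lev u \<le> lev l" if "u \<in> ?S" for u using that l \<open>finite ?S\<close> by simp
  have "l \<in> paras" using l sub by auto
  then have "l \<in> leaves"
    unfolding leaves_def using l max[of "lo l"] max[of "hi l"] lo_hi[of l] by auto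
  then show thesis using that l by auto
qed

text \<open>A path in a finite tree has a lowest element with a leaf \<open>l\<close> below it;
  maximality makes the path all of \<open>anc l\<close>. Conversely, every element of a path through
  a leaf is comparable with the leaf, hence an ancestor of it.\<close>

lemma boundary_eq: "boundary T = anc ` leaves"
proof (intro set_eqI iffI)
  fix P assume P: "P \<in> boundary T"
  then obtain z where z: "z \<in> P" "\<And>x. x \<in> P \<Longrightarrow> z \<subseteq> x"
    using path_finite[of P T] fin unfolding boundary_def by auto
  have "z \<in> T" using z P by (auto simp: boundary_def)
  then obtain l where l: "l \<in> leaves" "l \<subseteq> z" by (rule leaf_exists)
  have "P \<subseteq> anc l" using z l P unfolding anc_def boundary_def by blast
  moreover have "is_path (anc l)" "anc l \<subseteq> T" using l anc_path by (auto simp: leaves_def anc_def)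
  ultimately have "anc l = P" using P unfolding boundary_def by blast
  then show "P \<in> anc ` leaves" using l by blast
next
  fix P assume "P \<in> anc ` leaves"
  then obtain l where l: "l \<in> leaves" "P = anc l" by blast
  have "Q = P" if Q: "is_path Q" "Q \<subseteq> T" "P \<subseteq> Q" for Q
  proof -
    have "l \<in> Q" using l Q by (auto simp: anc_def leaves_def)
    have "q \<in> P" if "q \<in> Q" for q
    proof -
      have "q \<subseteq> l \<or> l \<subseteq> q" using path_comparable[OF Q(1)] that \<open>l \<in> Q\<close> by blast
      then show ?thesis using leaf_below[OF l(1), of q] that Q l by (auto simp: anc_def)
    qed
    then show ?thesis using Q by blast
  qed
  then show "P \<in> boundary T"
    unfolding boundary_def using l anc_path leaves_T by (auto simp: anc_def)
qed

lemma anc_inj: "inj_on anc leaves"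
proof (rule inj_onI)
  fix l l' assume "l \<in> leaves" "l' \<in> leaves" "anc l = anc l'"
  then have "l \<in> anc l'" "l \<in> T" "l' \<in> T" by (auto simp: anc_def leaves_def)
  then show "l = l'" using leaf_below[of l l'] \<open>l \<in> leaves\<close> by (auto simp: anc_def)
qed

text \<open>Each splitting vertex on the path corresponds to its child off the path; the map
  \<open>?f\<close> picks that child.\<close>

lemma splitting_number_anc:
  assumes l: "l \<in> leaves"
  shows "splitting_number (anc l) T = enat (card (anc l \<inter> splits))"
proof -
  let ?S = "{u \<in> T - anc l. \<exists>v\<in>anc l. u \<subseteq> v \<and> 2 * area u = area v}"
  let ?f = "\<lambda>w. if l \<subseteq> lo w then hi w else lo w"
  have lT: "l \<in> T" "l \<in> paras" using l sub by (auto simp: leaves_def)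
  have S: "?S = {u \<in> T - anc l. \<exists>v\<in>anc l. is_child u v}"
    using sub unfolding is_child_def anc_def by blast
  have wl: "w \<noteq> l" if "w \<in> splits" for w using that l by (auto simp: splits_def leaves_def)
  have "bij_betw ?f (anc l \<inter> splits) ?S"
    unfolding S
  proof (rule bij_betwI')
    fix w w' assume w: "w \<in> anc l \<inter> splits" "w' \<in> anc l \<inter> splits"
    then have p: "w \<in> paras" "w' \<in> paras" using sub by (auto simp: anc_def)
    then have "is_child (?f w) w" "is_child (?f w') w'" using lo_hi_is_child by auto
    then show "(?f w = ?f w') = (w = w')" using child_parent_unique by metis
  next
    fix w assume w: "w \<in> anc l \<inter> splits"
    then have p: "w \<in> paras" "w \<in> T" "l \<subseteq> w" using sub by (auto simp: anc_def)
    have "?f w \<in> T" using w by (auto simp: splits_def)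
    moreover have "\<not> l \<subseteq> ?f w" using not_below_both[OF lT(2) p(1)] by auto
    moreover have "is_child (?f w) w" using lo_hi_is_child p by auto
    moreover have "w \<in> anc l" using w by simp
    ultimately show "?f w \<in> {u \<in> T - anc l. \<exists>v\<in>anc l. is_child u v}"
      by (intro CollectI conjI DiffI) (simp_all add: anc_def, metis)
  next
    fix u assume "u \<in> {u \<in> T - anc l. \<exists>v\<in>anc l. is_child u v}"
    then obtain v where u: "u \<in> T" "\<not> l \<subseteq> u" and v: "v \<in> T" "l \<subseteq> v" and c: "is_child u v"
      by (auto simp: anc_def)
    have uv: "u = lo v \<or> u = hi v" using c by (rule child_cases)
    have "v \<noteq> l" using l u(1) uv by (auto simp: leaves_def)
    then have "l \<subseteq> lo v \<and> lo v \<in> T \<or> l \<subseteq> hi v \<and> hi v \<in> T" using child_in[OF lT(1) v] by blast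
    then have "v \<in> anc l \<inter> splits" "u = ?f v" using uv u v by (auto simp: anc_def splits_def)
    then show "\<exists>x\<in>anc l \<inter> splits. u = ?f x" by blast
  qed
  then have "card ?S = card (anc l \<inter> splits)" by (simp add: bij_betw_same_card)
  moreover have "finite ?S" using fin by simp
  ultimately show ?thesis unfolding splitting_number_def Let_def by simp
qed

end

text \<open>\<open>rich T n v\<close>: below \<open>v\<close> one finds \<open>n\<close> nested generations of splittings within \<open>T\<close>.\<close>

inductive rich :: "plane set set \<Rightarrow> nat \<Rightarrow> plane set \<Rightarrow> bool" for T where
  rich_0: "v \<in> T \<Longrightarrow> rich T 0 v"
| rich_Suc: "v \<in> paras \<Longrightarrow> w \<in> paras \<Longrightarrow> w \<subseteq> v \<Longrightarrow> rich T n (lo w) \<Longrightarrow> rich T n (hi w) \<Longrightarrow> rich T (Suc n) v"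

lemma rich_paras: "rich T n v \<Longrightarrow> T \<subseteq> paras \<Longrightarrow> v \<in> paras"
  by (induction rule: rich.induct) auto

lemma rich_mono: "rich T n v \<Longrightarrow> T \<subseteq> T' \<Longrightarrow> rich T' n v"
  by (induction rule: rich.induct) (auto intro: rich.intros)

lemma rich_up: "rich T n v \<Longrightarrow> v \<subseteq> v' \<Longrightarrow> v' \<in> T \<Longrightarrow> v' \<in> paras \<Longrightarrow> rich T n v'"
  by (cases rule: rich.cases) (auto intro: rich.intros)

lemma rich_Suc_obtain:
  assumes "rich T (Suc n) v"
  obtains w where "w \<in> paras" "w \<subseteq> v" "rich T n (lo w)" "rich T n (hi w)"
  using assms by (cases rule: rich.cases) auto

text \<open>Following the lower child at each of \<open>g\<close> successive splittings spends
  \<open>g\<close> generations and descends at least \<open>g\<close> levels.\<close>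

lemma rich_descend:
  assumes "T \<subseteq> paras"
  shows "rich T (n + g) v \<Longrightarrow> \<exists>v'. v' \<subseteq> v \<and> rich T n v' \<and> lev v + g \<le> lev v'"
proof (induction g arbitrary: v)
  case (Suc g)
  then have "rich T (Suc (n + g)) v" by simp
  then obtain w where w: "w \<in> paras" "w \<subseteq> v" "rich T (n + g) (lo w)" by (rule rich_Suc_obtain)
  have "v \<in> paras" using rich_paras Suc.prems assms by blast
  then have "lev v \<le> lev w" using w by (intro lev_mono)
  moreover obtain v' where "v' \<subseteq> lo w" "rich T n v'" "lev (lo w) + g \<le> lev v'"
    using Suc.IH[OF w(3)] by blast
  ultimately show ?case using lo_hi[OF w(1)] w(2) by (intro exI[of _ v']) auto
qed auto

context finite_tree
begin

text \<open>Induction on the size of the subtree below \<open>v\<close>. A leaf forces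
  \<open>m = 0\<close>, a vertex with one child passes everything on, and a splitting lowers the
  count by one on both sides, so the leaves double and one generation is gained.\<close>

lemma leaves_rich:
  assumes "v \<in> T" "\<And>l. l \<in> leaves \<Longrightarrow> l \<subseteq> v \<Longrightarrow> card (anc l \<inter> splits \<inter> {w. w \<subseteq> v}) = m"
  shows "card {l \<in> leaves. l \<subseteq> v} = 2 ^ m \<and> rich T m v"
  using assms
proof (induction "card {u \<in> T. u \<subseteq> v}" arbitrary: v m rule: less_induct)
  case less
  have vp: "v \<in> paras" using less.prems sub by blast
  note c = lo_hi[OF vp]
  have smaller: "card {u \<in> T. u \<subseteq> x} < card {u \<in> T. u \<subseteq> v}" if "is_child x v" for x
  proof (intro psubset_card_mono psubsetI)
    show "{u \<in> T. u \<subseteq> x} \<subseteq> {u \<in> T. u \<subseteq> v}" using that by (auto simp: is_child_iff)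
    have "\<not> v \<subseteq> x" using that lev_mono[of v x] by (auto simp: is_child_iff)
    then show "{u \<in> T. u \<subseteq> x} \<noteq> {u \<in> T. u \<subseteq> v}" using less.prems(1) by blast
  qed (use fin in simp)
  have disj: "\<not> l \<subseteq> hi v" if "l \<in> T" "l \<subseteq> lo v" for l
    using not_below_both vp that sub by blast
  have between: "w \<subseteq> x \<or> w = v" if "l \<in> T" "w \<in> T" "l \<subseteq> x" "l \<subseteq> w" "w \<subseteq> v" "is_child x v" for l w x
  proof (cases "lev x \<le> lev w")
    case True
    then show ?thesis using nested[of l x w] that sub by (auto simp: is_child_iff)
  next
    case False
    then have "lev w \<le> lev v" using that by (simp add: is_child_iff)
    then show ?thesis using same_lev[of w v] lev_mono[of w v] that sub vp by auto
  qed
  consider (leaf) "v \<in> leaves" | (split) "v \<in> splits"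
    | (one) x where "is_child x v" "x \<in> T" "v \<notin> splits" "\<And>u. is_child u v \<Longrightarrow> u \<in> T \<Longrightarrow> u = x" "v \<notin> leaves"
  proof -
    consider "lo v \<in> T" "hi v \<in> T" | "lo v \<notin> T" "hi v \<notin> T" | "lo v \<in> T" "hi v \<notin> T" | "lo v \<notin> T" "hi v \<in> T"
      by blast
    then show thesis
    proof cases
      case 3
      show ?thesis
      proof (rule that(3)[OF lo_hi_is_child(1)[OF vp] 3(1)])
        show "u = lo v" if "is_child u v" "u \<in> T" for u using child_cases[OF that(1)] that(2) 3 by metis
      qed (use 3 in \<open>auto simp: splits_def leaves_def\<close>)
    next
      case 4
      show ?thesis
      proof (rule that(3)[OF lo_hi_is_child(2)[OF vp] 4(2)])
        show "u = hi v" if "is_child u v" "u \<in> T" for u using child_cases[OF that(1)] that(2) 4 by metis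
      qed (use 4 in \<open>auto simp: splits_def leaves_def\<close>)
    qed (use that less.prems in \<open>auto simp: splits_def leaves_def\<close>)
  qed
  then show ?case
  proof cases
    case leaf
    have "{l \<in> leaves. l \<subseteq> v} = {v}" using leaf leaf_below[OF leaf] leaves_T by auto
    moreover have "anc v \<inter> splits \<inter> {w. w \<subseteq> v} = {}" using leaf by (auto simp: splits_def leaves_def anc_def)
    then have "m = 0" using less.prems(2)[OF leaf] by simp
    ultimately show ?thesis using less.prems(1) rich_0 by auto
  next
    case one
    have xv: "x \<subseteq> v" using one by (simp add: is_child_iff)
    have below: "l \<subseteq> x" if "l \<in> leaves" "l \<subseteq> v" for l
    proof -
      have "l \<noteq> v" using that one by blast
      then show ?thesis using child_in[OF leaves_T[OF that(1)] less.prems(1) that(2)] one(4) lo_hi_is_child[OF vp] by auto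
    qed
    have "card {l \<in> leaves. l \<subseteq> x} = 2 ^ m \<and> rich T m x"
    proof (rule less.hyps[OF smaller[OF one(1)] one(2)])
      fix l assume l: "l \<in> leaves" "l \<subseteq> x"
      have "anc l \<inter> splits \<inter> {w. w \<subseteq> x} = anc l \<inter> splits \<inter> {w. w \<subseteq> v}"
        using between[OF leaves_T[OF l(1)] _ l(2) _ _ one(1)] xv one(3) by (auto simp: anc_def)
      then show "card (anc l \<inter> splits \<inter> {w. w \<subseteq> x}) = m" using less.prems(2) l xv by auto
    qed
    moreover have "{l \<in> leaves. l \<subseteq> v} = {l \<in> leaves. l \<subseteq> x}" using below xv by auto
    ultimately show ?thesis using rich_up[OF _ xv less.prems(1) vp] by auto
  next
    case split
    have step: "card (anc l \<inter> splits \<inter> {w. w \<subseteq> v}) = Suc (card (anc l \<inter> splits \<inter> {w. w \<subseteq> x}))"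
      if x: "is_child x v" and l: "l \<in> leaves" "l \<subseteq> x" for l x
    proof -
      have xv: "x \<subseteq> v" "\<not> v \<subseteq> x" using x lev_mono[of v x] by (auto simp: is_child_iff)
      have "anc l \<inter> splits \<inter> {w. w \<subseteq> v} = insert v (anc l \<inter> splits \<inter> {w. w \<subseteq> x})"
        using between[OF leaves_T[OF l(1)] _ l(2) _ _ x] xv split l by (auto simp: anc_def splits_def)
      moreover have "finite (anc l)" using fin by (auto simp: anc_def)
      ultimately show ?thesis using xv by simp
    qed
    \<comment> \<open>Any leaf below \<open>lo v\<close> has \<open>v\<close> among its splittings,
      so \<open>m\<close> is positive.\<close>
    obtain l where l: "l \<in> leaves" "l \<subseteq> lo v" using split leaf_exists[of "lo v"] by (auto simp: splits_def)
    have "m = Suc (card (anc l \<inter> splits \<inter> {w. w \<subseteq> lo v}))"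
      using step[OF lo_hi_is_child(1)[OF vp] l] less.prems(2)[OF l(1)] l(2) c by auto
    then obtain m' where m: "m = Suc m'" by blast
    have ih: "card {l \<in> leaves. l \<subseteq> x} = 2 ^ m' \<and> rich T m' x" if x: "is_child x v" "x \<in> T" for x
    proof (rule less.hyps[OF smaller[OF x(1)] x(2)])
      fix l assume l: "l \<in> leaves" "l \<subseteq> x"
      have "l \<subseteq> v" using l x by (auto simp: is_child_iff)
      then show "card (anc l \<inter> splits \<inter> {w. w \<subseteq> x}) = m'"
        using step[OF x(1) l] less.prems(2)[OF l(1)] m by simp
    qed
    have T: "lo v \<in> T" "hi v \<in> T" using split by (auto simp: splits_def)
    note ih2 = ih[OF lo_hi_is_child(1)[OF vp] T(1)] ih[OF lo_hi_is_child(2)[OF vp] T(2)]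
    have "{l \<in> leaves. l \<subseteq> v} = {l \<in> leaves. l \<subseteq> lo v} \<union> {l \<in> leaves. l \<subseteq> hi v}"
    proof -
      have "l \<subseteq> lo v \<or> l \<subseteq> hi v" if "l \<in> leaves" "l \<subseteq> v" for l
      proof -
        have "l \<noteq> v" using that split by (auto simp: leaves_def splits_def)
        then show ?thesis using child_in[OF leaves_T[OF that(1)] less.prems(1) that(2)] by blast
      qed
      then show ?thesis using c by blast
    qed
    moreover have "{l \<in> leaves. l \<subseteq> lo v} \<inter> {l \<in> leaves. l \<subseteq> hi v} = {}"
      using disj leaves_T by blast
    moreover have "finite {l \<in> leaves. l \<subseteq> x}" for x using fin by (auto simp: leaves_def)
    ultimately have "card {l \<in> leaves. l \<subseteq> v} = 2 ^ m' + 2 ^ m'"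
      using ih2 by (simp only: card_Un_disjoint)
    then show ?thesis using ih2 vp m by (auto intro: rich_Suc[of v v])
  qed
qed

section \<open>Fig trees described by their leaves, and passage to smaller scales\<close>

lemma fig_tree_iff:
  "is_fig_tree T n h \<longleftrightarrow> (\<forall>l\<in>leaves. card (anc l \<inter> splits) = n \<and> card (anc l) = h)"
proof -
  have eq: "anc l \<inter> splits \<inter> {w. w \<subseteq> r} = anc l \<inter> splits" for l
    using root(2) by (auto simp: anc_def)
  have all: "{l \<in> leaves. l \<subseteq> r} = leaves" using root(2) leaves_T by auto
  have "card (boundary T) = card leaves" unfolding boundary_eq using anc_inj by (rule card_image)
  moreover have "card leaves = 2 ^ n" if "\<forall>l\<in>leaves. card (anc l \<inter> splits) = n"
    using leaves_rich[OF root(1), of n] that unfolding eq all by blast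
  ultimately show ?thesis
    unfolding is_fig_tree_def using is_tree fin splitting_number_anc by (auto simp: boundary_eq)
qed

lemma fig_tree_rich: assumes "is_fig_tree T n h" shows "rich T n r"
proof -
  have "anc l \<inter> splits \<inter> {w. w \<subseteq> r} = anc l \<inter> splits" for l
    using root(2) by (auto simp: anc_def)
  then show ?thesis using leaves_rich[OF root(1), of n] assms unfolding fig_tree_iff by simp
qed

lemma subtree: assumes "c \<in> T" shows "finite_tree {u \<in> T. u \<subseteq> c} c"
proof unfold_locales
  show "{u \<in> T. u \<subseteq> c} \<subseteq> paras" "finite {u \<in> T. u \<subseteq> c}" using sub fin by auto
  show "c \<in> {u \<in> T. u \<subseteq> c}" using assms by simp
  show "u \<subseteq> c" if "u \<in> {u \<in> T. u \<subseteq> c}" for u using that by simp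
  show "w \<in> {u \<in> T. u \<subseteq> c}" if "u \<in> {u \<in> T. u \<subseteq> c}" "w \<in> paras" "u \<subseteq> w" "w \<subseteq> c" for u w
    using upward[of u w] that order_trans[OF that(4) root(2)[OF assms]] by simp
qed

text \<open>Cutting at the highest splitting \<open>v\<close> and keeping the part below one child
  takes the same amount from every remaining path: the single splitting \<open>v\<close>, and the
  chain of vertices strictly above the child. Both counts therefore stay constant over the
  leaves.\<close>

lemma fig_tree_pred:
  assumes fig: "is_fig_tree T (Suc n) h"
  shows "\<exists>F h'. F \<subseteq> T \<and> is_fig_tree F n h'"
proof -
  have L: "\<And>l. l \<in> leaves \<Longrightarrow> card (anc l \<inter> splits) = Suc n \<and> card (anc l) = h"
    using fig unfolding fig_tree_iff by blast
  obtain l0 where "l0 \<in> leaves" using leaf_exists root(1) by blast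
  then have "splits \<noteq> {}" using L by force
  moreover have "finite splits" using fin by (auto simp: splits_def)
  ultimately have "Min (lev ` splits) \<in> lev ` splits" by (intro Min_in) auto
  then obtain v where v: "v \<in> splits" "lev v = Min (lev ` splits)" by auto
  have min: "lev v \<le> lev w" if "w \<in> splits" for w using that v \<open>finite splits\<close> by simp
  have vT: "v \<in> T" "v \<in> paras" using v sub by (auto simp: splits_def)
  define c where "c = lo v"
  have c: "c \<in> T" "c \<in> paras" "c \<subseteq> v" "lev c = Suc (lev v)" using v lo_hi[OF vT(2)] by (auto simp: c_def splits_def)
  interpret S: finite_tree "{u \<in> T. u \<subseteq> c}" c using c by (intro subtree)
  let ?above = "{w \<in> T. c \<subseteq> w \<and> \<not> w \<subseteq> c}"
  have chsub: "lo w \<subseteq> c" "hi w \<subseteq> c" if "w \<in> T" "w \<subseteq> c" for w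
    using that sub lo_hi[of w] by auto
  have Sl: "S.leaves = {l \<in> leaves. l \<subseteq> c}"
    using chsub by (auto simp: S.leaves_def leaves_def)
  have Ss: "S.splits = {w \<in> splits. w \<subseteq> c}"
    using chsub by (auto simp: S.splits_def splits_def)
  have Sa: "S.anc l = {w \<in> anc l. w \<subseteq> c}" for l by (auto simp: S.anc_def anc_def)
  have comp: "w \<subseteq> c \<or> c \<subseteq> w" if "w \<in> T" "l \<in> T" "l \<subseteq> w" "l \<subseteq> c" for w l
    using nested[of l w c] nested[of l c w] that sub c by (cases "lev w \<le> lev c") auto
  have "card (S.anc l \<inter> S.splits) = n \<and> card (S.anc l) = h - card ?above" if "l \<in> S.leaves" for l
  proof -
    have l: "l \<in> leaves" "l \<in> T" "l \<in> paras" "l \<subseteq> c" using that sub by (auto simp: Sl leaves_def)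
    have fa: "finite (anc l)" using fin by (auto simp: anc_def)
    have "anc l = S.anc l \<union> ?above" using comp l unfolding Sa by (auto simp: anc_def)
    then have card_anc: "card (anc l) = card (S.anc l) + card ?above"
      using fa fin by (subst card_Un_disjoint[symmetric]) (auto simp: Sa)
    have eq: "anc l \<inter> splits = insert v (S.anc l \<inter> S.splits)"
    proof (intro equalityI subsetI)
      fix w assume w: "w \<in> anc l \<inter> splits"
      then have wT: "w \<in> T" "l \<subseteq> w" "w \<in> paras" using sub by (auto simp: anc_def)
      show "w \<in> insert v (S.anc l \<inter> S.splits)"
      proof (cases "w \<subseteq> c")
        case True then show ?thesis using w by (auto simp: Sa Ss)
      next
        case False
        then have cw: "c \<subseteq> w" using comp[OF wT(1) l(2) wT(2) l(4)] by simp
        have "lev c \<noteq> lev w" using same_lev[OF c(2) wT(3) cw] False by auto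
        then have "lev w \<le> lev v" using lev_mono[OF c(2) wT(3) cw] c(4) by simp
        moreover have "lev v \<le> lev w" using w by (intro min) simp
        ultimately have "w = v"
          using same_lev[OF wT(3) vT(2) nested[OF c(2) vT(2) wT(3) c(3) cw]] by simp
        then show ?thesis by simp
      qed
    next
      fix w assume "w \<in> insert v (S.anc l \<inter> S.splits)"
      then show "w \<in> anc l \<inter> splits" using v vT l c by (auto simp: Sa Ss anc_def)
    qed
    have v': "v \<notin> S.anc l \<inter> S.splits" "finite (S.anc l \<inter> S.splits)"
    proof -
      have "\<not> v \<subseteq> c" using lev_mono[OF vT(2) c(2)] c(4) by linarith
      then show "v \<notin> S.anc l \<inter> S.splits" by (simp add: Sa)
      show "finite (S.anc l \<inter> S.splits)" using fa by (simp add: Sa)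
    qed
    have "card (anc l \<inter> splits) = Suc (card (S.anc l \<inter> S.splits))"
      unfolding eq using v'(2,1) by (rule card_insert_disjoint)
    then show ?thesis using L[OF l(1)] card_anc by linarith
  qed
  then have "is_fig_tree {u \<in> T. u \<subseteq> c} n (h - card ?above)"
    unfolding S.fig_tree_iff by (rule ballI)
  moreover have "{u \<in> T. u \<subseteq> c} \<subseteq> T" by (rule Collect_restrict)
  ultimately show ?thesis by (intro exI conjI)
qed

end

lemma fig_tree_finite_tree:
  assumes "is_fig_tree F n h" obtains r where "finite_tree F r"
proof -
  obtain B where "B \<noteq> {}" "B \<subseteq> paras" "F = tree_of B" "finite F"
    using assms unfolding is_fig_tree_def is_tree_def by blast
  then show thesis using tree_tree_of that by (auto simp: finite_tree_def finite_tree_axioms_def)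
qed

lemma contains_fig_tree_pred: assumes "contains_fig_tree T (Suc n)" shows "contains_fig_tree T n"
proof -
  obtain F h where F: "F \<subseteq> T" "is_fig_tree F (Suc n) h" using assms by (auto simp: contains_fig_tree_def)
  obtain r where "finite_tree F r" using fig_tree_finite_tree[OF F(2)] .
  then obtain F' h' where F': "F' \<subseteq> F" "is_fig_tree F' n h'"
    using finite_tree.fig_tree_pred[OF _ F(2)] by metis
  show ?thesis unfolding contains_fig_tree_def using order_trans[OF F'(1) F(1)] F'(2) by metis
qed

lemma contains_fig_tree_mono: "m \<le> n \<Longrightarrow> contains_fig_tree T n \<Longrightarrow> contains_fig_tree T m"
  by (induction n rule: dec_induct) (auto intro: contains_fig_tree_pred)

lemma contains_fig_tree_0: assumes "u \<in> T" "u \<in> paras" shows "contains_fig_tree T 0"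
proof -
  interpret S: finite_tree "{u}" u
    by unfold_locales (use assms in auto)
  have "\<not> lo u \<in> {u}" using lo_hi[OF assms(2)] by auto
  then have "S.splits = {}" by (auto simp: S.splits_def)
  moreover have "S.anc l = {u}" if "l \<in> S.leaves" for l
    using S.leaves_T[OF that] by (auto simp: S.anc_def)
  ultimately have "is_fig_tree {u} 0 1" unfolding S.fig_tree_iff by simp
  then show ?thesis using assms unfolding contains_fig_tree_def by blast
qed

lemma contains_fig_tree_rich: assumes "contains_fig_tree T n" shows "\<exists>v. rich T n v"
proof -
  obtain F h where F: "F \<subseteq> T" "is_fig_tree F n h" using assms by (auto simp: contains_fig_tree_def)
  obtain r where "finite_tree F r" using fig_tree_finite_tree[OF F(2)] .
  then have "rich F n r" using finite_tree.fig_tree_rich[OF _ F(2)] by metis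
  then show ?thesis using rich_mono[OF _ F(1)] by metis
qed

text \<open>The scales of the fig trees inside \<open>T\<close> are closed downwards and include 0.
  If they are bounded, the greatest one is therefore the unique scale whose successor is
  missing.\<close>

lemma analytic_split_cases:
  assumes "T \<noteq> {}" "T \<subseteq> paras"
  obtains (inf) "analytic_split T = \<infinity>" "\<And>n. contains_fig_tree T n"
    | (fin) n where "analytic_split T = enat n" "contains_fig_tree T n"
proof (cases "\<forall>N. \<exists>n\<ge>N. contains_fig_tree T n")
  case True
  then have "contains_fig_tree T n" for n using contains_fig_tree_mono by blast
  then show thesis using True inf by (simp add: analytic_split_def)
next
  case False
  then obtain N where N: "\<And>n. n \<ge> N \<Longrightarrow> \<not> contains_fig_tree T n" by blast
  obtain u where "u \<in> T" using assms by blast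
  then have z: "contains_fig_tree T 0" using contains_fig_tree_0 assms by blast
  obtain n where n: "contains_fig_tree T n" and max: "\<And>m. contains_fig_tree T m \<Longrightarrow> m \<le> n"
    using Greatest_le_nat[of "contains_fig_tree T"] GreatestI_nat[of "contains_fig_tree T" 0 N] z N
    by (metis linorder_not_less nless_le)
  have "(THE n. contains_fig_tree T n \<and> \<not> contains_fig_tree T (n + 1)) = n"
  proof (rule the_equality)
    show "contains_fig_tree T n \<and> \<not> contains_fig_tree T (n + 1)" using n max by fastforce
    fix m assume m: "contains_fig_tree T m \<and> \<not> contains_fig_tree T (m + 1)"
    show "m = n"
    proof (rule ccontr)
      assume "m \<noteq> n"
      then have "m + 1 \<le> n" using max m by fastforce
      then show False using contains_fig_tree_mono n m by blast
    qed
  qed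
  then show thesis using fin n False by (simp add: analytic_split_def)
qed

subsection \<open>From splittings to slopes\<close>

text \<open>The slope of \<open>u\<close> and also, with \<open>rgt u\<close>, an end of its side at
  abscissa 1. The slopes of the elements below \<open>u\<close> lie in this dyadic interval.\<close>

definition lft :: "plane set \<Rightarrow> real" where "lft u = real (pos u) / 2 ^ lev u"
definition rgt :: "plane set \<Rightarrow> real" where "rgt u = lft u + 1 / 2 ^ lev u"

lemma lft_rgt_mono:
  assumes "u \<in> paras" "v \<in> paras" "u \<subseteq> v" shows "lft v \<le> lft u" "rgt u \<le> rgt v"
proof -
  obtain n k where u: "u = para n k" using assms by (auto simp: paras_def)
  obtain m j where v: "v = para m j" using assms by (auto simp: paras_def)
  have "(1, real k / 2 ^ n) \<in> para m j" "(1, real k / 2 ^ n + 1 / 2 ^ n) \<in> para m j"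
    using para_ends[of k n] assms(3) unfolding u v by auto
  then have "real j / 2 ^ m \<le> real k / 2 ^ n" "real k / 2 ^ n + 1 / 2 ^ n \<le> real j / 2 ^ m + 1 / 2 ^ m"
    by (simp_all add: para_eq)
  then show "lft v \<le> lft u" "rgt u \<le> rgt v"
    by (simp_all add: u v lft_def rgt_def)
qed

lemma lft_rgt_children: "rgt (lo u) = lft u + 1 / 2 ^ Suc (lev u)" "lft (hi u) = lft u + 1 / 2 ^ Suc (lev u)"
  "rgt u = lft u + 2 * (1 / 2 ^ Suc (lev u))"
  by (auto simp: lft_def rgt_def lo_def hi_def field_simps)

text \<open>
  Slopes below the two children of \<open>w\<close> may be arbitrarily close.  Going left at the next splitting
  \<open>w0\<close> and right at the next splitting \<open>w1\<close> keeps them apart by the widths of half of \<open>w0\<close> and of \<open>w1\<close>;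
  \<open>g\<close> further splittings are then given up to shrink the two subtrees.
\<close>

lemma rich_stree:
  assumes T: "T \<subseteq> paras" "\<And>u. u \<in> T \<Longrightarrow> \<exists>b\<in>B. b \<subseteq> u" and B: "B \<subseteq> paras"
  shows "rich T (k * (g + 2)) v \<Longrightarrow> \<exists>s P. stree (2 * (1/2) ^ g) (tube_ok B) k s P \<and>
    P \<le> 2 / 2 ^ lev v \<and> lft v \<le> s \<and> s < rgt v"
proof (induction k arbitrary: v)
  case 0
  then have "v \<in> T" by (auto elim: rich.cases)
  then obtain b where b: "b \<in> B" "b \<subseteq> v" using T by blast
  have p: "b \<in> paras" "v \<in> paras" using b B \<open>v \<in> T\<close> T by auto
  have l: "lev v \<le> lev b" using lev_mono p b by blast
  then have le: "(2::real) / 2 ^ lev b \<le> 2 / 2 ^ lev v" by (simp add: field_simps)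
  have "b = para (lev b) (pos b)" using p by (auto elim: parasE)
  \<comment> \<open>The slope is taken from \<open>b\<close> but the width from \<open>v\<close>:
    \<open>b\<close> may lie far below \<open>v\<close>, and \<open>tube_ok\<close> admits tubes
    wider than the doubled parallelogram.\<close>
  then have "tube_ok B (lft b) (2 / 2 ^ lev v)"
    unfolding tube_ok_def lft_def using b le by (metis zero_less_divide_iff zero_less_numeral zero_less_power)
  then have "stree (2 * (1/2) ^ g) (tube_ok B) 0 (lft b) (2 / 2 ^ lev v)"
    by (intro stree.leaf) auto
  moreover have "lft v \<le> lft b" "lft b < rgt v"
    using lft_rgt_mono[OF p b(2)] by (auto simp: rgt_def[of b]) (smt (verit) divide_pos_pos zero_less_power)
  ultimately show ?case by (intro exI[of _ "lft b"] exI[of _ "2 / 2 ^ lev v"]) auto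
next
  case (Suc k)
  have vp: "v \<in> paras" using Suc.prems rich_paras T by blast
  \<comment> \<open>Of the \<open>g + 2\<close> generations spent per vertex, one yields
    \<open>w\<close>, one yields \<open>w0\<close> and \<open>w1\<close>, and \<open>g\<close> go
    into the descent.\<close>
  have "rich T (Suc (Suc (k * (g + 2) + g))) v" using Suc.prems by (simp add: algebra_simps)
  then obtain w where w: "w \<in> paras" "w \<subseteq> v" "rich T (Suc (k * (g + 2) + g)) (lo w)" "rich T (Suc (k * (g + 2) + g)) (hi w)"
    by (rule rich_Suc_obtain)
  obtain w0 where w0: "w0 \<in> paras" "w0 \<subseteq> lo w" "rich T (k * (g + 2) + g) (lo w0)" using w(3) by (rule rich_Suc_obtain)
  obtain w1 where w1: "w1 \<in> paras" "w1 \<subseteq> hi w" "rich T (k * (g + 2) + g) (hi w1)" using w(4) by (rule rich_Suc_obtain)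
  note c = lo_hi[OF w(1)] and c0 = lo_hi[OF w0(1)] and c1 = lo_hi[OF w1(1)]
  obtain vA where vA: "vA \<subseteq> lo w0" "rich T (k * (g + 2)) vA" "lev (lo w0) + g \<le> lev vA"
    using rich_descend[OF T(1) w0(3)] by blast
  obtain vB where vB: "vB \<subseteq> hi w1" "rich T (k * (g + 2)) vB" "lev (hi w1) + g \<le> lev vB"
    using rich_descend[OF T(1) w1(3)] by blast
  have pAB: "vA \<in> paras" "vB \<in> paras" using rich_paras vA(2) vB(2) T(1) by blast+
  obtain sA p where A: "stree (2 * (1/2) ^ g) (tube_ok B) k sA p" "p \<le> 2 / 2 ^ lev vA" "lft vA \<le> sA" "sA < rgt vA"
    using Suc.IH[OF vA(2)] by blast
  obtain sB q where B: "stree (2 * (1/2) ^ g) (tube_ok B) k sB q" "q \<le> 2 / 2 ^ lev vB" "lft vB \<le> sB" "sB < rgt vB"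
    using Suc.IH[OF vB(2)] by blast
  define D where "D = sB - sA"
  define d0 d1 :: real where "d0 = 1 / 2 ^ Suc (lev w0)" and "d1 = 1 / 2 ^ Suc (lev w1)"
  have dpos: "0 < d0" "0 < d1" by (auto simp: d0_def d1_def)
  have ends: "lft (lo w0) \<le> sA" "sA < rgt (lo w0)" "lft (hi w1) \<le> sB" "sB < rgt (hi w1)"
    using lft_rgt_mono[OF pAB(1) c0(1) vA(1)] lft_rgt_mono[OF pAB(2) c1(2) vB(1)] A B by auto
  \<comment> \<open>Measured from the common end point of \<open>lo w\<close> and
    \<open>hi w\<close>: \<open>sA\<close> lies at least \<open>d0\<close> to its left because
    \<open>hi w0\<close> is skipped, and \<open>sB\<close> at least \<open>d1\<close> to its right
    because \<open>lo w1\<close> is skipped.\<close>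
  have D: "d0 + d1 \<le> D"
    using ends lft_rgt_mono[OF w0(1) c(1) w0(2)] lft_rgt_mono[OF w1(1) c(2) w1(2)]
      lft_rgt_children[of w0] lft_rgt_children[of w1] lft_rgt_children[of w]
    unfolding D_def d0_def d1_def by linarith
  \<comment> \<open>Used with \<open>l\<close> the level of \<open>vA\<close> or \<open>vB\<close>
    and \<open>m\<close> that of \<open>w0\<close> or \<open>w1\<close>: the half width of
    \<open>w0\<close> or \<open>w1\<close> is at most \<open>D\<close>, and \<open>g\<close> further
    levels shrink it by 2^g.\<close>
  have small: "2 / 2 ^ l \<le> 2 * (1/2) ^ g * D" if "Suc m + g \<le> l" "1 / 2 ^ Suc m \<le> D" for l m
  proof -
    have "(2::real) ^ (Suc m + g) \<le> 2 ^ l" using that by (intro power_increasing) auto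
    then have "(2::real) / 2 ^ l \<le> 2 / 2 ^ (Suc m + g)" by (intro divide_left_mono) auto
    also have "\<dots> = 2 * (1/2) ^ g * (1 / 2 ^ Suc m)" by (simp add: power_add power_divide)
    also have "\<dots> \<le> 2 * (1/2) ^ g * D" using that by (intro mult_left_mono) auto
    finally show ?thesis .
  qed
  have dD: "d0 \<le> D" "d1 \<le> D" using D dpos by linarith+
  have "2 / 2 ^ lev vA \<le> 2 * (1/2) ^ g * D"
    using vA(3) c0(3) dD by (intro small[of "lev w0"]) (simp_all add: d0_def)
  moreover have "2 / 2 ^ lev vB \<le> 2 * (1/2) ^ g * D"
    using vB(3) c1(4) dD by (intro small[of "lev w1"]) (simp_all add: d1_def)
  ultimately have "p \<le> 2 * (1/2) ^ g * D" "q \<le> 2 * (1/2) ^ g * D"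
    using A(2) B(2) by linarith+
  then have "stree (2 * (1/2) ^ g) (tube_ok B) (Suc k) sA (2 * D)"
    by (intro stree.node[OF A(1) B(1) D_def])
  moreover have sub: "lo w0 \<subseteq> v" "hi w1 \<subseteq> v" using c0 c1 w0 w1 c w by auto
  have "lft v \<le> sA" "sA < rgt v" "lft v \<le> sB" "sB < rgt v"
    using lft_rgt_mono[OF c0(1) vp sub(1)] lft_rgt_mono[OF c1(2) vp sub(2)] ends by auto
  moreover then have "2 * D \<le> 2 / 2 ^ lev v" unfolding D_def rgt_def by simp
  ultimately show ?case by blast
qed

text \<open>Descending \<open>g = k + 1\<close> levels makes \<epsilon> equal to 2^-k, and 18 k^2
  \<le> 2^k holds from k = 13 on. The price is k (k + 3) generations, so \<open>k\<close> is about
  the square root of \<open>N\<close>. The constant 40 serves both the large scales and the finitely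
  many below 225 = 15^2.\<close>

lemma maximal_norm_fig_tree:
  assumes B: "B \<noteq> {}" "B \<subseteq> paras" and p: "1 < p" and N: "1 \<le> N" "contains_fig_tree (tree_of B) N"
  shows "ennreal ((1/4) powr p / 40 * ln (real N)) \<le> ennreal_rpow (maximal_norm p B) p"
proof (cases "N < 225")
  case True
  have "ln (real N) \<le> ln 225" using True N by (subst ln_le_cancel_iff) auto
  also have "ln (225::real) = 2 * ln 15" using ln_realpow[of 15 2] by simp
  also have "\<dots> \<le> 2 * (15 - 1)" using ln_le_minus_one[of "15::real"] by simp
  finally have "(1/4) powr p / 40 * ln (real N) \<le> (1/4) powr p / 40 * 40"
    by (intro mult_left_mono) auto
  then have "ennreal ((1/4) powr p / 40 * ln (real N)) \<le> ennreal ((1/4) powr p)"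
    by (intro ennreal_leI) simp
  then show ?thesis using maximal_norm_lower_trivial[OF B p] by (rule order_trans)
next
  case False
  \<comment> \<open>Subtracting 2 gives k (k + 3) \<le> (k + 2)^2 \<le> N, and k \<ge> 13 because
    the root is at least 15.\<close>
  define k where "k = nat \<lfloor>sqrt (real N)\<rfloor> - 2"
  have "sqrt (15^2) \<le> sqrt (real N)" using False by (intro real_sqrt_le_mono) auto
  then have s: "15 \<le> sqrt (real N)" by simp
  then have k: "13 \<le> k" "real k + 2 \<le> sqrt (real N)" "sqrt (real N) < real k + 3"
    unfolding k_def by linarith+
  have "(real k + 2)\<^sup>2 \<le> (sqrt (real N))\<^sup>2" using k by (intro power_mono) auto
  then have "real (k * (k + 3)) \<le> real N" by (simp add: power2_eq_square algebra_simps)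
  then have kN: "k * (k + 1 + 2) \<le> N" by (simp only: of_nat_le_iff) (simp add: algebra_simps)
  interpret tree "tree_of B" "tree_root B" using B by (rule tree_tree_of)
  obtain v where "rich (tree_of B) (k * (k + 1 + 2)) v"
    using contains_fig_tree_rich contains_fig_tree_mono[OF kN N(2)] by blast
  moreover have "\<exists>b\<in>B. b \<subseteq> u" if "u \<in> tree_of B" for u using that by (auto simp: tree_of_def)
  ultimately obtain s P where st: "stree (2 * (1/2) ^ (k + 1)) (tube_ok B) k s P"
    using rich_stree[OF sub _ B(2), of k "k + 1" v] by metis
  have pow: "18 * real k * real k \<le> 2 ^ k" using k(1)
  proof (induction k rule: dec_induct)
    case (step n)
    have "18 * real (Suc n) * real (Suc n) \<le> 2 * (18 * real n * real n)"
    proof -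
      have "3 * real n \<le> real n * real n" using step by (intro mult_right_mono) auto
      moreover have "18 * real (Suc n) * real (Suc n) = 18 * (real n * real n) + 36 * real n + 18"
        by (simp add: algebra_simps)
      moreover have "1 \<le> real n" using step by simp
      ultimately show ?thesis by linarith
    qed
    then show ?case using step by simp
  qed simp
  have "ennreal ((1/4) powr p * (ln (1 + real k / 2) / 5)) \<le> ennreal_rpow (maximal_norm p B) p"
  proof (rule stree_maximal_norm[OF st])
    show "18 * real k * real k * (2 * (1/2) ^ (k + 1)) \<le> 1"
      using pow by (simp add: power_divide field_simps)
  qed (use k p in auto)
  moreover have "(1/4) powr p / 40 * ln (real N) \<le> (1/4) powr p * (ln (1 + real k / 2) / 5)"
  proof -
    have "real N = (sqrt (real N))\<^sup>2" by simp
    also have "\<dots> \<le> (real k + 3)\<^sup>2" using k s by (intro power_mono) auto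
    also have "\<dots> \<le> ((1 + real k / 2)\<^sup>2)\<^sup>2"
    proof (intro power_mono)
      have "13 * real k \<le> real k * real k" using k by (intro mult_right_mono) auto
      moreover have "(1 + real k / 2)\<^sup>2 = 1 + real k + real k * real k / 4"
        by (simp add: power2_eq_square algebra_simps)
      moreover have "13 \<le> real k" using k by simp
      ultimately show "real k + 3 \<le> (1 + real k / 2)\<^sup>2" by linarith
    qed auto
    also have "\<dots> = (1 + real k / 2) ^ 4" by simp
    finally have "ln (real N) \<le> ln ((1 + real k / 2) ^ 4)" using N by (subst ln_le_cancel_iff) auto
    also have "\<dots> = 4 * ln (1 + real k / 2)" by (simp add: ln_realpow)
    finally have "ln (real N) \<le> 4 * ln (1 + real k / 2)" .
    moreover have "0 \<le> ln (1 + real k / 2)" by simp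
    ultimately have "ln (real N) / 40 \<le> ln (1 + real k / 2) / 5" by linarith
    then have "(1/4) powr p * (ln (real N) / 40) \<le> (1/4) powr p * (ln (1 + real k / 2) / 5)"
      by (intro mult_left_mono) simp_all
    then show ?thesis by simp
  qed
  ultimately show ?thesis by (meson ennreal_leI order_trans)
qed

theorem theorem5:
  fixes p :: real
  assumes "1 < p"
  shows "\<exists>A>0. \<forall>B. B \<noteq> {} \<and> B \<subseteq> paras \<longrightarrow>
    ereal A * log_enat (analytic_split (tree_of B)) \<le> enn2ereal (ennreal_rpow (maximal_norm p B) p)"
proof (intro exI[of _ "(1/4) powr p / 40"] conjI allI impI)
  let ?A = "(1/4) powr p / 40 :: real"
  show A: "0 < ?A" by simp
  fix B assume B: "B \<noteq> {} \<and> B \<subseteq> paras"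
  let ?M = "ennreal_rpow (maximal_norm p B) p"
  interpret tree "tree_of B" "tree_root B" using B by (intro tree_tree_of) auto
  have bound: "ereal (?A * ln (real N)) \<le> enn2ereal ?M"
    if "1 \<le> N" "contains_fig_tree (tree_of B) N" for N
  proof -
    have "ereal (?A * ln (real N)) = enn2ereal (ennreal (?A * ln (real N)))"
      using that by (simp add: ln_ge_zero)
    also have "\<dots> \<le> enn2ereal ?M"
      using maximal_norm_fig_tree[of B p N] B assms that by (simp add: less_eq_ennreal.rep_eq)
    finally show ?thesis .
  qed
  have "tree_of B \<noteq> {}" using root by blast
  then show "ereal ?A * log_enat (analytic_split (tree_of B)) \<le> enn2ereal ?M"
  proof (cases rule: analytic_split_cases[OF _ sub, case_names ne inf fin])
    case inf
    have "enn2ereal ?M = \<infinity>"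
    proof (rule ereal_top)
      fix K :: real
      \<comment> \<open>A scale whose bound already exceeds \<open>K\<close>; the maximum with 0
        keeps \<open>N\<close> at least 1, as \<open>bound\<close> demands.\<close>
      define N where "N = nat \<lceil>exp (max 0 (K / ?A))\<rceil>"
      have N: "exp (max 0 (K / ?A)) \<le> real N" unfolding N_def by linarith
      moreover have "1 \<le> exp (max 0 (K / ?A))" by simp
      ultimately have "1 \<le> N" by linarith
      have "K / ?A \<le> ln (real N)" using N \<open>1 \<le> N\<close> by (subst ln_ge_iff) (auto intro: order_trans[rotated])
      then have "K \<le> ?A * ln (real N)" using A by (simp add: field_simps)
      then show "ereal K \<le> enn2ereal ?M" using bound[OF \<open>1 \<le> N\<close> inf(2)] by (meson ereal_less_eq(3) order_trans)
    qed
    then show ?thesis by simp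
  next
    case (fin n)
    \<comment> \<open>For \<open>n = 0\<close> the logarithm is -\<infinity> and stays so after
      multiplication by the positive constant.\<close>
    then show ?thesis using bound[of n] A by (cases "n = 0") (auto simp: log_enat_def)
  qed
qed

end
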